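(* Let $K=SU(n)$, $K_{\mathbb C}=SL(n,\mathbb C)$, let $X_0\in\mathfrak t_{\mathbb C}$ and let $\chi=\rho(X_0)$. Then the complex-symplectic GIT reduction at level $X_0$, by the torus $T_{\mathbb C}=B/N$, of the universal hyperkähler implosion $Q=(K_{\mathbb C}\times\mathfrak b)/\!/N$, namely $$(K_{\mathbb C}\times(X_0+\mathfrak n))/\!/B=\operatorname{Spec}\bigl(\mathcal O(K_{\mathbb C}\times(X_0+\mathfrak n))^B\bigr),$$ is the Kostant variety $V_\chi=\rho^{-1}(\chi)$, the identification being induced by the $B$-invariant map $(g,X)\mapsto gXg^{-1}$.
   Context: $B\subset SL(n,\mathbb C)$ is a Borel subgroup with Lie algebra $\mathfrak b$, $N=[B,B]$ its unipotent radical with Lie algebra $\mathfrak n$, and $\mathfrak b=\mathfrak t_{\mathbb C}\oplus\mathfrak n$ with $\mathfrak t_{\mathbb C}$ a Cartan subalgebra (the Lie algebra of the maximal torus $T_{\mathbb C}\cong B/N$). $B$ acts on $K_{\mathbb C}\times\mathfrak b$ by $b\cdot(g,X)=(gb^{-1},bXb^{-1})$, preserving $K_{\mathbb C}\times(X_0+\mathfrak n)$. The complex-symplectic moment map for the residual $T_{\mathbb C}$-action is induced by the projection $(g,X)\mapsto X_{(0)}\in\mathfrak t_{\mathbb C}$ to the Cartan component, so reduction at level $X_0$ means restricting to $X\in X_0+\mathfrak n$ and taking the GIT quotient by $N$ and $T_{\mathbb C}$, i.e. by $B$. The map $\rho\colon\mathfrak{sl}(n,\mathbb C)\to\mathbb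 C^{n-1}\cong\mathfrak t_{\mathbb C}/W$ is $\rho(X)=(p_1(X),\dots,p_{n-1}(X))$, where $p_1,\dots,p_{n-1}$ generate the ring of invariant polynomials on $\mathfrak{sl}(n,\mathbb C)$; $V_\chi=\rho^{-1}(\chi)$ is called a Kostant variety. The universal hyperkähler implosion for $SU(n)$ is the hyperkähler quotient at level $0$ of $\bigoplus_{i=1}^{n-1}\operatorname{Hom}(\mathbb C^i,\mathbb C^{i+1})\oplus\operatorname{Hom}(\mathbb C^{i+1},\mathbb C^i)$ by $\prod_{i=1}^{n-1}SU(i)$, which is identified with $\operatorname{Spec}(\mathcal O(SL(n,\mathbb C)\times\mathfrak b)^N)=(SL(n,\mathbb C)\times\mathfrak b)/\!/N$. *)

theory Defs
  imports "HOL-Analysis.Analysis" "HOL-Algebra.Solvable_Groups"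
begin

section \<open>Affine complex varieties as sets with an algebra of functions\<close>

text \<open>
  A set of points together with a complex algebra of functions on it. The functions are
  extensional (undefined off the points), so that equality of functions is equality on the points.
\<close>

record 'a function_space =
  points :: "'a set"
  coord :: "('a \<Rightarrow> complex) set"

inductive_set generated_algebra :: "('a \<Rightarrow> complex) set \<Rightarrow> ('a \<Rightarrow> complex) set"
  for C :: "('a \<Rightarrow> complex) set"
  where
    const: "(\<lambda>_. c) \<in> generated_algebra C"
  | base: "f \<in> C \<Longrightarrow> f \<in> generated_algebra C"
  | add: "f \<in> generated_algebra C \<Longrightarrow> g \<in> generated_algebra C \<Longrightarrow>
      (\<lambda>x. f x + g x) \<in> generated_algebra C"
  | mult: "f \<in> generated_algebra C \<Longrightarrow> g \<in> generated_algebra C \<Longrightarrow>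
      (\<lambda>x. f x * g x) \<in> generated_algebra C"

text \<open>
  For a Zariski closed subset S of an affine space with coordinate functions C, this is S with its
  reduced structure: the coordinate ring consists of the restrictions of polynomials.
\<close>

definition affine_variety :: "('a \<Rightarrow> complex) set \<Rightarrow> 'a set \<Rightarrow> 'a function_space" where
  "affine_variety C S = \<lparr>points = S, coord = (\<lambda>f. restrict f S) ` generated_algebra C\<rparr>"

definition zariski :: "'a function_space \<Rightarrow> 'a topology" where
  "zariski V = topology_generated_by ((\<lambda>f. {x \<in> points V. f x \<noteq> 0}) ` coord V)"

definition regular_on :: "'a function_space \<Rightarrow> 'a set \<Rightarrow> ('a \<Rightarrow> complex) \<Rightarrow> bool" where
  "regular_on V U h \<longleftrightarrow>
     (\<forall>x\<in>U. \<exists>W. openin (zariski V) W \<and> x \<in> W \<and> W \<subseteq> U \<and>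
        (\<exists>a\<in>coord V. \<exists>b\<in>coord V. \<forall>y\<in>W. b y \<noteq> 0 \<and> h y = a y / b y))"

text \<open>
  An isomorphism of varieties is a homeomorphism for the Zariski topologies which identifies the
  sheaves of regular functions.
\<close>

definition variety_iso :: "'a function_space \<Rightarrow> 'b function_space \<Rightarrow> ('a \<Rightarrow> 'b) \<Rightarrow> bool" where
  "variety_iso V W F \<longleftrightarrow>
     bij_betw F (points V) (points W) \<and>
     homeomorphic_map (zariski V) (zariski W) F \<and>
     (\<forall>U h. openin (zariski W) U \<longrightarrow>
        (regular_on W U h \<longleftrightarrow> regular_on V {x \<in> points V. F x \<in> U} (\<lambda>x. h (F x))))"

text \<open>
  The spectrum of the algebra \<open>coord R\<close>, in the sense of complex varieties: its points are the
  complex algebra homomorphisms to the complex numbers, and an element of the algebra is the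
  function evaluating homomorphisms at it.
\<close>

definition algebra_chars :: "'a function_space \<Rightarrow> (('a \<Rightarrow> complex) \<Rightarrow> complex) set" where
  "algebra_chars R =
     {\<phi> \<in> extensional (coord R).
        (\<forall>c. \<phi> (\<lambda>x\<in>points R. c) = c) \<and>
        (\<forall>f\<in>coord R. \<forall>g\<in>coord R.
           \<phi> (\<lambda>x\<in>points R. f x + g x) = \<phi> f + \<phi> g \<and>
           \<phi> (\<lambda>x\<in>points R. f x * g x) = \<phi> f * \<phi> g)}"

definition Spec :: "'a function_space \<Rightarrow> (('a \<Rightarrow> complex) \<Rightarrow> complex) function_space" where
  "Spec R = \<lparr>points = algebra_chars R, coord = (\<lambda>f. \<lambda>\<phi>\<in>algebra_chars R. \<phi> f) ` coord R\<rparr>"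

definition invariant_functions ::
    "'g set \<Rightarrow> ('g \<Rightarrow> 'a \<Rightarrow> 'a) \<Rightarrow> 'a function_space \<Rightarrow> 'a function_space" where
  "invariant_functions G act V =
     V\<lparr>coord := {f \<in> coord V. \<forall>g\<in>G. \<forall>x\<in>points V. f (act g x) = f x}\<rparr>"

definition GIT_quotient ::
    "'g set \<Rightarrow> ('g \<Rightarrow> 'a \<Rightarrow> 'a) \<Rightarrow> 'a function_space \<Rightarrow>
      (('a \<Rightarrow> complex) \<Rightarrow> complex) function_space" where
  "GIT_quotient G act V = Spec (invariant_functions G act V)"

definition GIT_map ::
    "'g set \<Rightarrow> ('g \<Rightarrow> 'a \<Rightarrow> 'a) \<Rightarrow> 'a function_space \<Rightarrow> 'a \<Rightarrow> ('a \<Rightarrow> complex) \<Rightarrow> complex" where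
  "GIT_map G act V x = (\<lambda>f\<in>coord (invariant_functions G act V). f x)"

definition pullback :: "'a function_space \<Rightarrow> ('a \<Rightarrow> 'b) \<Rightarrow> ('b \<Rightarrow> complex) \<Rightarrow> 'a \<Rightarrow> complex" where
  "pullback V \<psi> f = (\<lambda>x\<in>points V. f (\<psi> x))"


section \<open>The special linear group and its Lie algebra\<close>

definition mat_coords :: "(complex^'n^'n \<Rightarrow> complex) set" where
  "mat_coords = {f. \<exists>i j. f = (\<lambda>X. X $ i $ j)}"

definition pair_coords :: "((complex^'n^'n) \<times> (complex^'n^'n) \<Rightarrow> complex) set" where
  "pair_coords = (\<lambda>f. f \<circ> fst) ` mat_coords \<union> (\<lambda>f. f \<circ> snd) ` mat_coords"

definition SL :: "(complex^'n^'n) monoid" where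
  "SL = \<lparr>carrier = {g. det g = 1}, monoid.mult = (**), one = mat 1\<rparr>"

definition sl :: "(complex^'n^'n) set" where
  "sl = {X. trace X = 0}"

definition conj_mat :: "complex^'n^'n \<Rightarrow> complex^'n^'n \<Rightarrow> complex^'n^'n" where
  "conj_mat g X = g ** X ** matrix_inv g"

definition closed_connected_solvable :: "(complex^'n^'n) set \<Rightarrow> bool" where
  "closed_connected_solvable H \<longleftrightarrow>
     subgroup H SL \<and>
     closedin (zariski (affine_variety mat_coords (carrier SL))) H \<and>
     connectedin (zariski (affine_variety mat_coords (carrier SL))) H \<and>
     solvable (SL\<lparr>carrier := H\<rparr>)"

definition borel_subgroup :: "(complex^'n^'n) set \<Rightarrow> bool" where
  "borel_subgroup B \<longleftrightarrow>
     closed_connected_solvable B \<and>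
     (\<forall>H. closed_connected_solvable H \<and> B \<subseteq> H \<longrightarrow> H = B)"

text \<open>Velocities at the identity of curves in the closed linear group G.\<close>

definition lie_algebra :: "(complex^'n^'n) set \<Rightarrow> (complex^'n^'n) set" where
  "lie_algebra G =
     {X. \<exists>\<gamma> :: real \<Rightarrow> complex^'n^'n. \<gamma> differentiable_on UNIV \<and> range \<gamma> \<subseteq> G \<and>
           \<gamma> 0 = mat 1 \<and> (\<gamma> has_vector_derivative X) (at 0)}"

definition bracket :: "complex^'n^'n \<Rightarrow> complex^'n^'n \<Rightarrow> complex^'n^'n" where
  "bracket X Y = X ** Y - Y ** X"

definition lie_subalgebra :: "(complex^'n^'n) set \<Rightarrow> bool" where
  "lie_subalgebra h \<longleftrightarrow>
     h \<subseteq> sl \<and> 0 \<in> h \<and> (\<forall>X\<in>h. \<forall>Y\<in>h. X + Y \<in> h) \<and>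
     (\<forall>c. \<forall>X\<in>h. (\<chi> i j. c * X $ i $ j) \<in> h) \<and> (\<forall>X\<in>h. \<forall>Y\<in>h. bracket X Y \<in> h)"

text \<open>
  The real span suffices in the lower central series: each term is closed under complex scalars
  when \<open>h\<close> is.
\<close>

primrec lower_central :: "(complex^'n^'n) set \<Rightarrow> nat \<Rightarrow> (complex^'n^'n) set" where
  "lower_central h 0 = h"
| "lower_central h (Suc k) = span {bracket X Y | X Y. X \<in> h \<and> Y \<in> lower_central h k}"

definition cartan_subalgebra :: "(complex^'n^'n) set \<Rightarrow> bool" where
  "cartan_subalgebra h \<longleftrightarrow>
     lie_subalgebra h \<and> (\<exists>k. lower_central h k = {0}) \<and>
     {X \<in> sl. \<forall>Y\<in>h. bracket X Y \<in> h} = h"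


section \<open>Kostant varieties\<close>

definition invariant_polynomials :: "(complex^'n^'n) function_space" where
  "invariant_polynomials =
     invariant_functions (carrier SL) conj_mat (affine_variety mat_coords sl)"

definition generate_invariants :: "(nat \<Rightarrow> complex^'n^'n \<Rightarrow> complex) \<Rightarrow> bool" where
  "generate_invariants p \<longleftrightarrow>
     p ` {1..CARD('n) - 1} \<subseteq> coord invariant_polynomials \<and>
     coord invariant_polynomials =
       (\<lambda>f. restrict f sl) ` generated_algebra (p ` {1..CARD('n) - 1})"

definition rho ::
    "(nat \<Rightarrow> complex^'n^'n \<Rightarrow> complex) \<Rightarrow> complex^'n^'n \<Rightarrow> nat \<Rightarrow> complex" where
  "rho p X = (\<lambda>k\<in>{1..CARD('n) - 1}. p k X)"

definition kostant_variety ::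
    "(nat \<Rightarrow> complex^'n^'n \<Rightarrow> complex) \<Rightarrow> (nat \<Rightarrow> complex) \<Rightarrow> (complex^'n^'n) function_space" where
  "kostant_variety p c = affine_variety mat_coords {X \<in> sl. rho p X = c}"


section \<open>The implosion and its reductions\<close>

definition borel_act ::
    "complex^'n^'n \<Rightarrow> (complex^'n^'n) \<times> (complex^'n^'n) \<Rightarrow> (complex^'n^'n) \<times> (complex^'n^'n)"
  where "borel_act b = (\<lambda>(g, X). (g ** matrix_inv b, conj_mat b X))"

text \<open>
  The implosion is \<open>(SL \<times> lie_algebra B) // derived SL B\<close>. The moment map of its residual torus
  action is induced by the projection of \<open>(g, X)\<close> to the Cartan component of \<open>X\<close>; hence
  its reduction at level \<open>X0\<close> is the GIT quotient by \<open>B\<close> of the following variety.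
\<close>

definition level_variety ::
    "(complex^'n^'n) set \<Rightarrow> complex^'n^'n \<Rightarrow> ((complex^'n^'n) \<times> (complex^'n^'n)) function_space"
  where "level_variety B X0 =
    affine_variety pair_coords (carrier SL \<times> (\<lambda>Y. X0 + Y) ` lie_algebra (derived SL B))"

definition torus_reduction ::
    "(complex^'n^'n) set \<Rightarrow> complex^'n^'n \<Rightarrow>
      (((complex^'n^'n) \<times> (complex^'n^'n) \<Rightarrow> complex) \<Rightarrow> complex) function_space"
  where "torus_reduction B X0 = GIT_quotient B borel_act (level_variety B X0)"

definition conj_map :: "(complex^'n^'n) \<times> (complex^'n^'n) \<Rightarrow> complex^'n^'n" where
  "conj_map = (\<lambda>(g, X). conj_mat g X)"

end

theory Submission
  imports Defs "HOL-Computational_Algebra.Fundamental_Theorem_Algebra"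
begin

text \<open>
  By the Lie--Kolchin theorem the Borel subgroup is conjugate to the upper triangular one, so
  \<open>X\<^sub>0 + \<nn>\<close> becomes the slice of upper triangular matrices with a fixed diagonal \<open>l\<close>. The essential
  point is that every invariant polynomial function \<open>f\<close> on pairs is a polynomial in the conjugate.

  If the eigenvalues of \<open>X\<close> are the \<open>l i\<close>, the vectors obtained from a vector \<open>v\<close> by applying
  successively the factors \<open>X - l i\<close> are the columns of a matrix which conjugates \<open>X\<close> to a bidiagonal
  matrix of the slice, provided that its determinant \<open>D\<close> is not zero. As the Borel subgroup acts
  simply transitively over matrices with a cyclic vector, \<open>f\<close> is there a polynomial in \<open>X\<close> divided by
  a power of \<open>D\<close>. Taking for \<open>v\<close> the first and the last basis vector gives two such fractions.

  For a suitable grading, the leading forms of the two determinants are monomials in the entries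
  just below and just above the diagonal, and the ideal of the equations for the characteristic
  polynomial has generators whose leading forms are powers of the diagonal entries. Polynomials with
  coprime leading monomials form a regular sequence. Hence the two fractions are equal to a
  polynomial on the fibre, and a polynomial vanishing on the regular orbit lies in the ideal. This
  replaces the theorem of Kostant that the fibres are normal and reduced.
\<close>

section \<open>Polynomial functions\<close>

text \<open>The two fractions for an invariant function have poles along different divisors. Their
  agreement is known only pointwise, whereas removing the poles needs a relation modulo the ideal of
  equations; that a polynomial vanishing on the regular orbit lies in the ideal bridges this gap.
  The poles then cancel as in a Hartogs argument, because the two determinants form a regular
  sequence modulo the ideal.

  The method of leading monomials requires that no two of them share a variable. The coefficients of
  the characteristic polynomial violate this, because their diagonal parts are elementary symmetric
  functions. Multiplying the characteristic series by generating series of complete symmetric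
  functions gives other generators of the same ideal, whose leading monomials are powers with
  exponent \<open>n - r i\<close> of the diagonal entries, \<open>r i\<close> being the rank of the
  index.

  The index type has no order, and a Borel subgroup is given only by maximality. A bijection
  \<open>r\<close> with an initial segment of the natural numbers supplies the order, and
  Lie-Kolchin is proved modulo stable subspaces, which take the place of quotient spaces.\<close>

lemma generated_algebra_cmult:
  "f \<in> generated_algebra C \<Longrightarrow> (\<lambda>x. c * f x) \<in> generated_algebra C"
  by (rule generated_algebra.mult[OF generated_algebra.const])

lemma generated_algebra_uminus:
  assumes "f \<in> generated_algebra C" shows "(\<lambda>x. - f x) \<in> generated_algebra C"
  using generated_algebra_cmult[OF assms, of "-1"] by simp

lemma generated_algebra_diff:
  assumes "f \<in> generated_algebra C" "g \<in> generated_algebra C"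
  shows "(\<lambda>x. f x - g x) \<in> generated_algebra C"
  using generated_algebra.add[OF assms(1) generated_algebra_uminus[OF assms(2)]] by simp

lemma generated_algebra_sum:
  assumes "\<And>i. i \<in> I \<Longrightarrow> f i \<in> generated_algebra C"
  shows "(\<lambda>x. \<Sum>i\<in>I. f i x) \<in> generated_algebra C"
  using assms
  by (induction I rule: infinite_finite_induct)
    (auto intro: generated_algebra.const generated_algebra.add)

lemma generated_algebra_prod:
  assumes "\<And>i. i \<in> I \<Longrightarrow> f i \<in> generated_algebra C"
  shows "(\<lambda>x. \<Prod>i\<in>I. f i x) \<in> generated_algebra C"
  using assms
  by (induction I rule: infinite_finite_induct)
    (auto intro: generated_algebra.const generated_algebra.mult)

lemma generated_algebra_power:
  assumes "f \<in> generated_algebra C" shows "(\<lambda>x. f x ^ k) \<in> generated_algebra C"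
  by (induction k) (auto intro: generated_algebra.const generated_algebra.mult assms)

lemmas generated_algebra_intros =
  generated_algebra.const generated_algebra.add generated_algebra.mult generated_algebra_uminus
  generated_algebra_diff generated_algebra_sum generated_algebra_prod generated_algebra_power

lemma generated_algebra_compose:
  assumes "f \<in> generated_algebra C"
    and "\<And>g. g \<in> C \<Longrightarrow> \<exists>g'\<in>generated_algebra D. \<forall>x\<in>A. g' x = g (\<phi> x)"
  shows "\<exists>f'\<in>generated_algebra D. \<forall>x\<in>A. f' x = f (\<phi> x)"
  using assms(1)
proof induction
  case (const c)
  then show ?case by (intro bexI[where x = "\<lambda>_. c"]) (auto intro: generated_algebra.const)
next
  case (base f)
  then show ?case using assms(2) by blast
next
  case (add f g)
  then obtain f' g' where "f' \<in> generated_algebra D" "g' \<in> generated_algebra D"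
    "\<forall>x\<in>A. f' x = f (\<phi> x)" "\<forall>x\<in>A. g' x = g (\<phi> x)" by blast
  then show ?case
    by (intro bexI[where x = "\<lambda>x. f' x + g' x"]) (auto intro: generated_algebra.add)
next
  case (mult f g)
  then obtain f' g' where "f' \<in> generated_algebra D" "g' \<in> generated_algebra D"
    "\<forall>x\<in>A. f' x = f (\<phi> x)" "\<forall>x\<in>A. g' x = g (\<phi> x)" by blast
  then show ?case
    by (intro bexI[where x = "\<lambda>x. f' x * g' x"]) (auto intro: generated_algebra.mult)
qed

lemma generated_algebra_det:
  fixes M :: "'a \<Rightarrow> complex^'n^'n"
  assumes "\<And>i j. (\<lambda>x. M x $ i $ j) \<in> generated_algebra C"
  shows "(\<lambda>x. det (M x)) \<in> generated_algebra C"
  unfolding det_def by (intro generated_algebra_intros assms)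

lemma generated_algebra_matrix_mult:
  fixes M N :: "'a \<Rightarrow> complex^'n^'n"
  assumes "\<And>i j. (\<lambda>x. M x $ i $ j) \<in> generated_algebra C"
    and "\<And>i j. (\<lambda>x. N x $ i $ j) \<in> generated_algebra C"
  shows "(\<lambda>x. (M x ** N x) $ i $ j) \<in> generated_algebra C"
  unfolding matrix_matrix_mult_def by (simp, intro generated_algebra_intros assms)

abbreviation matrix_polys :: "(complex^'n^'n \<Rightarrow> complex) set" where
  "matrix_polys \<equiv> generated_algebra mat_coords"

lemma entry_poly: "(\<lambda>X. X $ i $ j) \<in> matrix_polys"
  by (rule generated_algebra.base) (auto simp: mat_coords_def)

lemma matrix_poly_compose:
  fixes M :: "'a \<Rightarrow> complex^'n^'n"
  assumes "f \<in> matrix_polys"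
    and "\<And>i j. \<exists>h\<in>generated_algebra C. \<forall>x\<in>A. h x = M x $ i $ j"
  shows "\<exists>h\<in>generated_algebra C. \<forall>x\<in>A. h x = f (M x)"
  by (rule generated_algebra_compose[OF assms(1)]) (use assms(2) in \<open>auto simp: mat_coords_def\<close>)

lemma matrix_poly_compose':
  fixes M :: "'a \<Rightarrow> complex^'n^'n"
  assumes "f \<in> matrix_polys" and "\<And>i j. (\<lambda>x. M x $ i $ j) \<in> generated_algebra C"
  shows "(\<lambda>x. f (M x)) \<in> generated_algebra C"
proof -
  have "\<exists>h\<in>generated_algebra C. \<forall>x\<in>UNIV. h x = f (M x)"
    by (rule matrix_poly_compose[OF assms(1)]) (metis assms(2))
  then obtain h where "h \<in> generated_algebra C" and "\<forall>x. h x = f (M x)" by auto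
  moreover from this(2) have "h = (\<lambda>x. f (M x))" by auto
  ultimately show ?thesis by simp
qed

lemma continuous_matrix_poly:
  fixes f :: "complex^'n^'n \<Rightarrow> complex"
  assumes "f \<in> matrix_polys"
  shows "continuous_on UNIV f"
  using assms
  by induction (auto simp: mat_coords_def intro!: continuous_intros)


section \<open>Determinants\<close>

text \<open>Polynomial in the entries and available over every commutative ring, so it serves both
  as the inverse on \<open>SL\<close> and over power series in the Cayley-Hamilton theorem.\<close>

definition adjugate :: "'a::comm_ring_1^'n^'n \<Rightarrow> 'a^'n^'n" where
  "adjugate A = (\<chi> i j. det (\<chi> k. if k = j then axis i 1 else A $ k))"

text \<open>Linearity in row \<open>m\<close> turns the entry \<open>(l, m)\<close> of the product
  into the determinant of \<open>A\<close> with row \<open>m\<close> replaced by row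
  \<open>l\<close>; two rows coincide unless \<open>l = m\<close>.\<close>

lemma matrix_mult_adjugate: "A ** adjugate A = mat (det A)"
proof -
  have "(A ** adjugate A) $ l $ m = mat (det A) $ l $ m" for l m
  proof -
    have "(A ** adjugate A) $ l $ m =
        (\<Sum>j\<in>UNIV. A $ l $ j * det (\<chi> k. if k = m then axis j 1 else A $ k))"
      by (simp add: matrix_matrix_mult_def adjugate_def)
    also have "\<dots> = (\<Sum>j\<in>UNIV. det (\<chi> k. if k = m then A $ l $ j *s axis j 1 else A $ k))"
      by (simp add: det_row_mul)
    also have "\<dots> = det (\<chi> k. if k = m then \<Sum>j\<in>UNIV. A $ l $ j *s axis j 1 else A $ k)"
      by (rule det_linear_row_sum[symmetric]) simp
    also have "(\<Sum>j\<in>UNIV. A $ l $ j *s axis j 1) = A $ l"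
      by (simp add: vec_eq_iff axis_def if_distrib sum.delta cong: if_cong)
    also have "det (\<chi> k. if k = m then A $ l else A $ k) = mat (det A) $ l $ m"
    proof (cases "l = m")
      case True
      have "(\<chi> k. if k = m then A $ l else A $ k) = A"
        using True by (simp add: vec_eq_iff)
      then show ?thesis using True by (simp add: mat_def)
    next
      case False
      have "det (\<chi> k. if k = m then A $ l else A $ k) = 0"
        by (rule det_identical_rows[of l m]) (use False in \<open>auto simp: row_def\<close>)
      then show ?thesis using False by (simp add: mat_def)
    qed
    finally show ?thesis .
  qed
  then show ?thesis by (simp add: vec_eq_iff)
qed

lemma matrix_inv_unique:
  fixes A B :: "'a::field^'n^'n"
  assumes "A ** B = mat 1"
  shows "matrix_inv A = B"
proof -
  have BA: "B ** A = mat 1" using assms matrix_left_right_inverse by blast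
  have "invertible A" using assms BA by (auto simp: invertible_def)
  have "matrix_inv A = matrix_inv A ** (A ** B)" using assms by simp
  also have "\<dots> = (matrix_inv A ** A) ** B" by (simp add: matrix_mul_assoc)
  also have "\<dots> = B"
  proof -
    have "A ** matrix_inv A = mat 1 \<and> matrix_inv A ** A = mat 1"
      unfolding matrix_inv_def by (rule someI_ex) (use assms BA in blast)
    then show ?thesis by simp
  qed
  finally show ?thesis .
qed

lemma matrix_inv_det:
  fixes A :: "'a::field^'n^'n"
  assumes "det A \<noteq> 0"
  shows "A ** matrix_inv A = mat 1" "matrix_inv A ** A = mat 1"
proof -
  obtain B where "A ** B = mat 1" "B ** A = mat 1"
    using assms unfolding invertible_det_nz[symmetric] invertible_def by blast
  then show "A ** matrix_inv A = mat 1" "matrix_inv A ** A = mat 1"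
    using matrix_inv_unique by metis+
qed

lemma det_matrix_inv:
  fixes A :: "'a::field^'n^'n"
  assumes "det A \<noteq> 0"
  shows "det (matrix_inv A) = inverse (det A)"
proof -
  have "det A * det (matrix_inv A) = 1"
    using matrix_inv_det(1)[OF assms] by (metis det_I det_mul)
  then show ?thesis using assms by (simp add: field_simps)
qed

lemma matrix_inv_mult:
  fixes A B :: "'a::field^'n^'n"
  assumes "det A \<noteq> 0" "det B \<noteq> 0"
  shows "matrix_inv (A ** B) = matrix_inv B ** matrix_inv A"
proof (rule matrix_inv_unique)
  have "A ** B ** (matrix_inv B ** matrix_inv A) = A ** (B ** matrix_inv B) ** matrix_inv A"
    by (simp add: matrix_mul_assoc)
  then show "A ** B ** (matrix_inv B ** matrix_inv A) = mat 1"
    using assms by (simp add: matrix_inv_det)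
qed

lemma matrix_inv_matrix_inv:
  fixes A :: "'a::field^'n^'n"
  assumes "det A \<noteq> 0"
  shows "matrix_inv (matrix_inv A) = A"
  using assms matrix_inv_det matrix_inv_unique by blast

lemma adjugate_eq_matrix_inv:
  fixes A :: "'a::field^'n^'n"
  assumes "det A = 1"
  shows "matrix_inv A = adjugate A"
  using matrix_inv_unique[of A "adjugate A"] matrix_mult_adjugate[of A] assms by simp

lemma generated_algebra_adjugate:
  fixes M :: "'a \<Rightarrow> complex^'n^'n"
  assumes "\<And>i j. (\<lambda>x. M x $ i $ j) \<in> generated_algebra C"
  shows "(\<lambda>x. adjugate (M x) $ i $ j) \<in> generated_algebra C"
proof -
  have "(\<lambda>x. (if k = j then axis i 1 else M x $ k) $ l) \<in> generated_algebra C" for k l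
    by (cases "k = j") (auto intro: generated_algebra.const assms)
  then show ?thesis unfolding adjugate_def
    by (simp, intro generated_algebra_det, simp)
qed

text \<open>A permutation preserves the sum of all ranks, so if no rank dropped, none could rise
  either. This leaves only the identity in the determinant of a triangular matrix.\<close>

lemma permutes_rank_less:
  fixes r :: "'n::finite \<Rightarrow> nat"
  assumes "inj r" "p permutes UNIV" "p \<noteq> id"
  shows "\<exists>i. r (p i) < r i"
proof (rule ccontr)
  assume "\<not> ?thesis"
  then have le: "r i \<le> r (p i)" for i by (simp add: not_less)
  have "(\<Sum>i\<in>UNIV. r (p i)) = (\<Sum>i\<in>UNIV. r i)"
    using sum.permute[OF assms(2), of r] by (simp add: o_def)
  then have "r i = r (p i)" for i
    using sum_mono_inv[of r UNIV "\<lambda>i. r (p i)"] le by simp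
  then have "p i = i" for i using assms(1) by (metis injD)
  then show False using assms(3) by auto
qed

lemma det_upper_triangular:
  fixes r :: "'n::finite \<Rightarrow> nat" and A :: "'a::comm_ring_1^'n^'n"
  assumes "inj r" and upper: "\<And>i j. r j < r i \<Longrightarrow> A $ i $ j = 0"
  shows "det A = (\<Prod>i\<in>UNIV. A $ i $ i)"
proof -
  have "det A = (\<Sum>p\<in>{id}. of_int (sign p) * (\<Prod>i\<in>UNIV. A $ i $ p i))"
    unfolding det_def
  proof (rule sum.mono_neutral_right)
    show "\<forall>p\<in>{p. p permutes UNIV} - {id}. of_int (sign p) * (\<Prod>i\<in>UNIV. A $ i $ p i) = 0"
    proof
      fix p :: "'n \<Rightarrow> 'n" assume "p \<in> {p. p permutes UNIV} - {id}"
      then obtain i where "r (p i) < r i" using permutes_rank_less[OF assms(1)] by blast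
      then have "A $ i $ p i = 0" by (rule upper)
      then have "(\<Prod>i\<in>UNIV. A $ i $ p i) = 0" by (intro prod_zero) auto
      then show "of_int (sign p) * (\<Prod>i\<in>UNIV. A $ i $ p i) = 0" by simp
    qed
  qed (auto simp: permutes_id)
  then show ?thesis by (simp add: sign_id)
qed


section \<open>The characteristic power series and the Cayley--Hamilton theorem\<close>

text \<open>The matrix \<open>1 - t A\<close>. Its determinant is the reversed characteristic
  polynomial, a series with constant term 1, so linear factors can be divided out by geometric
  series.\<close>

definition char_matrix :: "complex^'n^'n \<Rightarrow> complex fps^'n^'n" where
  "char_matrix A = (\<chi> i j. (if i = j then 1 else 0) - fps_const (A $ i $ j) * fps_X)"

definition char_fps :: "complex^'n^'n \<Rightarrow> complex fps" where
  "char_fps A = det (char_matrix A)"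

lemma poly_fps_mult:
  assumes "\<And>k. (\<lambda>x. fps_nth (f x) k) \<in> generated_algebra C"
    and "\<And>k. (\<lambda>x. fps_nth (g x) k) \<in> generated_algebra C"
  shows "(\<lambda>x. fps_nth (f x * g x) k) \<in> generated_algebra C"
  unfolding fps_mult_nth by (intro generated_algebra_intros assms)

lemma poly_fps_prod:
  assumes "\<And>i k. i \<in> I \<Longrightarrow> (\<lambda>x. fps_nth (f i x) k) \<in> generated_algebra C"
  shows "(\<lambda>x. fps_nth (\<Prod>i\<in>I. f i x) k) \<in> generated_algebra C"
  using assms
proof (induction I arbitrary: k rule: infinite_finite_induct)
  case (insert i I)
  then show ?case by (auto intro!: poly_fps_mult)
qed (auto intro: generated_algebra.const)

lemma char_fps_poly: "(\<lambda>X :: complex^'n^'n. fps_nth (char_fps X) k) \<in> matrix_polys"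
proof -
  have e: "(\<lambda>X :: complex^'n^'n. fps_nth (char_matrix X $ i $ j) k) \<in> matrix_polys" for i j k
    by (cases "k = 1"; cases "k = 0"; cases "i = j")
      (auto simp: char_matrix_def intro: generated_algebra.const generated_algebra_uminus entry_poly
        split: if_splits)
  have "(\<lambda>X :: complex^'n^'n. fps_nth (of_int z * (\<Prod>i\<in>UNIV. char_matrix X $ i $ p i)) k)
      \<in> matrix_polys" for z :: int and p
    by (rule poly_fps_mult) (auto intro: poly_fps_prod e simp: generated_algebra.const)
  then show ?thesis unfolding char_fps_def det_def
    by (simp add: fps_sum_nth generated_algebra_sum)
qed

definition const_matrix :: "complex^'n^'n \<Rightarrow> complex fps^'n^'n" where
  "const_matrix A = (\<chi> i j. fps_const (A $ i $ j))"

lemma fps_const_sum: "fps_const (\<Sum>i\<in>I. f i) = (\<Sum>i\<in>I. fps_const (f i :: complex))"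
  by (induction I rule: infinite_finite_induct) (auto simp flip: fps_const_add)

lemma const_matrix_mult: "const_matrix (A ** B) = const_matrix A ** const_matrix B"
  by (simp add: const_matrix_def matrix_matrix_mult_def vec_eq_iff fps_const_sum)

lemma const_matrix_1: "const_matrix (mat 1) = mat 1"
  by (simp add: const_matrix_def mat_def vec_eq_iff)

lemma char_matrix_eq: "char_matrix A = mat 1 - mat fps_X ** const_matrix A"
  by (simp add: char_matrix_def const_matrix_def vec_eq_iff mat_def matrix_matrix_mult_def
      if_distrib[of "\<lambda>x. x * _"] if_distrib[of "\<lambda>x. _ * x"] sum.delta mult.commute cong: if_cong)

lemma mat_commute: "mat (c::'a::comm_ring_1) ** A = A ** mat c"
  by (simp add: vec_eq_iff mat_def matrix_matrix_mult_def if_distrib[of "\<lambda>x. x * _"]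
      if_distrib[of "\<lambda>x. _ * x"] sum.delta sum.delta' mult.commute cong: if_cong)

lemma matrix_diff_ldistrib: "A ** (B - C) = A ** B - A ** (C :: 'a::comm_ring_1^'n^'n)"
  by (simp add: vec_eq_iff matrix_matrix_mult_def right_diff_distrib sum_subtractf)

lemma matrix_diff_rdistrib: "(B - C) ** A = B ** A - (C :: 'a::comm_ring_1^'n^'n) ** A"
  by (simp add: vec_eq_iff matrix_matrix_mult_def left_diff_distrib sum_subtractf)

lemma char_fps_conj:
  fixes g A :: "complex^'n^'n"
  assumes "det g \<noteq> 0"
  shows "char_fps (g ** A ** matrix_inv g) = char_fps A"
proof -
  let ?g = "const_matrix g" and ?h = "const_matrix (matrix_inv g)"
  have gh: "?g ** ?h = mat 1"
    using matrix_inv_det(1)[OF assms] by (simp flip: const_matrix_mult add: const_matrix_1)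
  have "char_matrix (g ** A ** matrix_inv g) = ?g ** char_matrix A ** ?h"
    by (simp add: char_matrix_eq matrix_diff_ldistrib matrix_diff_rdistrib gh const_matrix_mult
        matrix_mul_assoc mat_commute[of fps_X ?g])
  then have "char_fps (g ** A ** matrix_inv g) = det ?g * char_fps A * det ?h"
    by (simp add: char_fps_def det_mul)
  also have "\<dots> = char_fps A * det (?g ** ?h)" by (simp add: det_mul)
  finally show ?thesis by (simp add: gh)
qed

primrec matpow :: "'a::comm_ring_1^'n^'n \<Rightarrow> nat \<Rightarrow> 'a^'n^'n" where
  "matpow A 0 = mat 1"
| "matpow A (Suc k) = matpow A k ** A"

lemma matpow_commute: "A ** matpow A k = matpow A k ** A"
  by (induction k) (simp_all add: matrix_mul_assoc)

lemma fps_prod_degree: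
  fixes f :: "'i \<Rightarrow> complex fps"
  assumes "finite I" "\<And>i k. i \<in> I \<Longrightarrow> d i < k \<Longrightarrow> fps_nth (f i) k = 0"
    and "(\<Sum>i\<in>I. d i) < k"
  shows "fps_nth (\<Prod>i\<in>I. f i) k = 0"
  using assms
proof (induction I arbitrary: k rule: finite_induct)
  case (insert a I)
  have "fps_nth (f a) j * fps_nth (\<Prod>i\<in>I. f i) (k - j) = 0" if "j \<le> k" for j
  proof (cases "d a < j")
    case False
    then have "fps_nth (\<Prod>i\<in>I. f i) (k - j) = 0"
      using insert.hyps insert.prems that by (intro insert.IH) auto
    then show ?thesis by simp
  qed (use insert.prems in auto)
  then have "(\<Sum>j=0..k. fps_nth (f a) j * fps_nth (\<Prod>i\<in>I. f i) (k - j)) = 0"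
    by (intro sum.neutral) auto
  then show ?case using insert.hyps by (simp add: fps_mult_nth)
qed auto

text \<open>The series of the powers of \<open>A\<close> inverts \<open>1 - t A\<close>, so it
  becomes the adjugate after multiplication by the characteristic series. The adjugate has degree
  less than n in \<open>t\<close>; the assertion is the vanishing of its coefficient at
  \<open>t^n\<close>.\<close>

theorem cayley_hamilton:
  fixes A :: "complex^'n^'n"
  shows "(\<Sum>k\<le>CARD('n). fps_nth (char_fps A) k * matpow A (CARD('n) - k) $ i $ j) = 0"
proof -
  define G :: "complex fps^'n^'n" where "G = (\<chi> i j. Abs_fps (\<lambda>k. matpow A k $ i $ j))"
  have "fps_nth ((G ** char_matrix A) $ i $ j) k = fps_nth (mat 1 $ i $ j) k" for i j k
  proof -
    have "(G ** char_matrix A) $ i $ j =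
        (\<Sum>l\<in>UNIV. G $ i $ l * ((if l = j then 1 else 0) - fps_const (A $ l $ j) * fps_X))"
      by (simp add: matrix_matrix_mult_def char_matrix_def)
    also have "\<dots> = G $ i $ j - (\<Sum>l\<in>UNIV. fps_const (A $ l $ j) * G $ i $ l) * fps_X"
      by (simp add: right_diff_distrib sum_subtractf if_distrib[of "\<lambda>x. _ * x"] sum.delta'
          sum_distrib_right sum_distrib_left mult_ac cong: if_cong)
    finally show ?thesis
      by (cases k) (auto simp: G_def mat_def fps_sum_nth matrix_matrix_mult_def mult.commute)
  qed
  then have G: "G ** char_matrix A = mat 1" by (simp add: vec_eq_iff fps_eq_iff)
  have "adjugate (char_matrix A) = G ** (char_matrix A ** adjugate (char_matrix A))"
    by (simp add: matrix_mul_assoc G)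
  then have "adjugate (char_matrix A) = G ** mat (char_fps A)"
    by (simp add: matrix_mult_adjugate char_fps_def)
  then have "fps_nth (adjugate (char_matrix A) $ i $ j) CARD('n) =
      fps_nth (char_fps A * G $ i $ j) CARD('n)"
    by (simp add: matrix_matrix_mult_def mat_def if_distrib[of "\<lambda>x. _ * x"] sum.delta mult.commute cong: if_cong)
  also have "\<dots> = (\<Sum>k\<le>CARD('n). fps_nth (char_fps A) k * matpow A (CARD('n) - k) $ i $ j)"
    by (simp add: fps_mult_nth G_def atLeast0AtMost)
  also have "fps_nth (adjugate (char_matrix A) $ i $ j) CARD('n) = 0"
  proof -
    let ?M = "\<chi> k. if k = j then axis i 1 else char_matrix A $ k"
    have zero: "fps_nth (\<Prod>l\<in>UNIV. ?M $ l $ p l) CARD('n) = 0" for p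
    \<comment> \<open>Row \<open>j\<close> was replaced by a constant row, so only n - 1 factors can
      contribute a power of the variable.\<close>
    proof (rule fps_prod_degree[where d = "\<lambda>l. if l = j then 0 else 1"])
      show "fps_nth (?M $ l $ p l) k = 0" if "(if l = j then 0 else 1) < k" for l k
        using that by (auto simp: axis_def char_matrix_def split: if_splits)
      have "(\<Sum>l\<in>UNIV. if l = j then 0 else 1) = CARD('n) - 1"
        by (subst sum.If_cases) (auto simp: Compl_eq_Diff_UNIV card_Diff_singleton)
      then show "(\<Sum>l\<in>UNIV. if l = j then 0 else 1) < CARD('n)"
        by (simp add: zero_less_card_finite)
    qed simp
    show ?thesis unfolding adjugate_def det_def
      by (simp add: fps_sum_nth fps_mult_of_int_nth zero[simplified])
  qed
  finally show ?thesis by simp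
qed


section \<open>Regular sequences from coprime leading monomials\<close>

text \<open>Polynomials are treated as functions, not as formal expressions. Spans of families of
  functions replace sets of formal sums, and comparing coefficients rests on
  \<open>independent_family\<close>.\<close>

definition combs :: "('e \<Rightarrow> 'a \<Rightarrow> complex) \<Rightarrow> 'e set \<Rightarrow> ('a \<Rightarrow> complex) set" where
  "combs b E = {(\<lambda>x. \<Sum>\<alpha>\<in>A. c \<alpha> * b \<alpha> x) | A c. finite A \<and> A \<subseteq> E}"

lemma combsI: "finite A \<Longrightarrow> A \<subseteq> E \<Longrightarrow> (\<lambda>x. \<Sum>\<alpha>\<in>A. c \<alpha> * b \<alpha> x) \<in> combs b E"
  unfolding combs_def by blast

lemma combsE:
  assumes "f \<in> combs b E"
  obtains A c where "finite A" "A \<subseteq> E" "f = (\<lambda>x. \<Sum>\<alpha>\<in>A. c \<alpha> * b \<alpha> x)"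
  using assms unfolding combs_def by blast

lemma combs_scaled_base: "\<alpha> \<in> E \<Longrightarrow> (\<lambda>x. c * b \<alpha> x) \<in> combs b E"
  using combsI[of "{\<alpha>}" E "\<lambda>_. c" b] by simp

lemma combs_base: "\<alpha> \<in> E \<Longrightarrow> b \<alpha> \<in> combs b E"
  using combs_scaled_base[of \<alpha> E 1 b] by simp

lemma combs_zero: "(\<lambda>x. 0) \<in> combs b E"
  using combsI[of "{}" E undefined b] by simp

lemma combs_cmult: "f \<in> combs b E \<Longrightarrow> (\<lambda>x. c * f x) \<in> combs b E"
proof (erule combsE)
  fix A d assume "finite A" "A \<subseteq> E" "f = (\<lambda>x. \<Sum>\<alpha>\<in>A. d \<alpha> * b \<alpha> x)"
  then show ?thesis using combsI[of A E "\<lambda>\<alpha>. c * d \<alpha>" b]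
    by (simp add: sum_distrib_left mult.assoc)
qed

lemma combs_add:
  assumes "f \<in> combs b E" "g \<in> combs b E"
  shows "(\<lambda>x. f x + g x) \<in> combs b E"
proof -
  obtain A c where A: "finite A" "A \<subseteq> E" "f = (\<lambda>x. \<Sum>\<alpha>\<in>A. c \<alpha> * b \<alpha> x)"
    using assms(1) by (rule combsE)
  obtain B d where B: "finite B" "B \<subseteq> E" "g = (\<lambda>x. \<Sum>\<alpha>\<in>B. d \<alpha> * b \<alpha> x)"
    using assms(2) by (rule combsE)
  let ?c = "\<lambda>\<alpha>. (if \<alpha> \<in> A then c \<alpha> else 0) + (if \<alpha> \<in> B then d \<alpha> else 0)"
  have "f x + g x = (\<Sum>\<alpha>\<in>A \<union> B. ?c \<alpha> * b \<alpha> x)" for x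
  proof -
    have "f x = (\<Sum>\<alpha>\<in>A \<union> B. (if \<alpha> \<in> A then c \<alpha> else 0) * b \<alpha> x)"
      unfolding A(3) using A B by (intro sum.mono_neutral_cong_left) auto
    moreover have "g x = (\<Sum>\<alpha>\<in>A \<union> B. (if \<alpha> \<in> B then d \<alpha> else 0) * b \<alpha> x)"
      unfolding B(3) using A B by (intro sum.mono_neutral_cong_left) auto
    ultimately show ?thesis by (simp only: sum.distrib[symmetric] distrib_right)
  qed
  then show ?thesis using combsI[of "A \<union> B" E ?c b] A B by simp
qed

lemma combs_uminus: "f \<in> combs b E \<Longrightarrow> (\<lambda>x. - f x) \<in> combs b E"
  using combs_cmult[of f b E "-1"] by simp

lemma combs_diff: "f \<in> combs b E \<Longrightarrow> g \<in> combs b E \<Longrightarrow> (\<lambda>x. f x - g x) \<in> combs b E"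
  using combs_add[OF _ combs_uminus, of f b E g] by simp

lemma combs_sum:
  assumes "\<And>i. i \<in> I \<Longrightarrow> f i \<in> combs b E"
  shows "(\<lambda>x. \<Sum>i\<in>I. f i x) \<in> combs b E"
  using assms by (induction I rule: infinite_finite_induct) (auto intro: combs_zero combs_add)

lemma combs_mono: "E \<subseteq> E' \<Longrightarrow> combs b E \<subseteq> combs b E'"
  unfolding combs_def by blast

lemma combs_induct [consumes 1, case_names zero add base]:
  assumes "f \<in> combs b E" and "P (\<lambda>x. 0)"
    and "\<And>f g. P f \<Longrightarrow> P g \<Longrightarrow> P (\<lambda>x. f x + g x)"
    and "\<And>c \<alpha>. \<alpha> \<in> E \<Longrightarrow> P (\<lambda>x. c * b \<alpha> x)"
  shows "P f"
proof -
  obtain A c where A: "finite A" "A \<subseteq> E" "f = (\<lambda>x. \<Sum>\<alpha>\<in>A. c \<alpha> * b \<alpha> x)"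
    using assms(1) by (rule combsE)
  from A(1,2) have "P (\<lambda>x. \<Sum>\<alpha>\<in>A. c \<alpha> * b \<alpha> x)"
    by (induction A rule: finite_induct) (auto intro: assms(2-4))
  then show ?thesis using A(3) by simp
qed

definition independent_family :: "('e \<Rightarrow> 'a \<Rightarrow> complex) \<Rightarrow> bool" where
  "independent_family b \<longleftrightarrow>
     (\<forall>A c. finite A \<longrightarrow> (\<forall>x. (\<Sum>\<alpha>\<in>A. c \<alpha> * b \<alpha> x) = 0) \<longrightarrow> (\<forall>\<alpha>\<in>A. c \<alpha> = 0))"

text \<open>Subtracting the two expansions gives a relation in which no index occurs twice.\<close>

lemma independent_family_disjoint:
  assumes "independent_family b" "finite A" "A \<inter> E = {}"
    and "(\<lambda>x. \<Sum>\<alpha>\<in>A. c \<alpha> * b \<alpha> x) \<in> combs b E" and "\<alpha> \<in> A"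
  shows "c \<alpha> = 0"
proof -
  obtain B d where B: "finite B" "B \<subseteq> E"
    and eq: "(\<lambda>x. \<Sum>\<alpha>\<in>A. c \<alpha> * b \<alpha> x) = (\<lambda>x. \<Sum>\<alpha>\<in>B. d \<alpha> * b \<alpha> x)"
    using assms(4) by (rule combsE)
  have AB: "A \<inter> B = {}" using B assms(3) by blast
  let ?c = "\<lambda>\<alpha>. if \<alpha> \<in> A then c \<alpha> else - d \<alpha>"
  have "(\<Sum>\<alpha>\<in>A \<union> B. ?c \<alpha> * b \<alpha> x) = 0" for x
  proof -
    have "(\<Sum>\<alpha>\<in>A \<union> B. ?c \<alpha> * b \<alpha> x) = (\<Sum>\<alpha>\<in>A. ?c \<alpha> * b \<alpha> x) + (\<Sum>\<alpha>\<in>B. ?c \<alpha> * b \<alpha> x)"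
      using assms(2) B(1) AB by (rule sum.union_disjoint)
    also have "(\<Sum>\<alpha>\<in>B. ?c \<alpha> * b \<alpha> x) = (\<Sum>\<alpha>\<in>B. - (d \<alpha> * b \<alpha> x))"
      using AB by (intro sum.cong) auto
    finally show ?thesis using fun_cong[OF eq, of x] by (simp add: sum_negf)
  qed
  then have sum0: "\<forall>x. (\<Sum>\<alpha>\<in>A \<union> B. ?c \<alpha> * b \<alpha> x) = 0" by blast
  have "\<forall>\<alpha>\<in>A \<union> B. ?c \<alpha> = 0"
    by (rule assms(1)[unfolded independent_family_def, THEN spec, THEN spec, THEN mp, THEN mp, OF _ sum0])
      (use assms(2) B(1) in simp)
  then have "?c \<alpha> = 0" using assms(5) by blast
  then show ?thesis using assms(5) by simp
qed

section \<open>Monomials in the matrix entries\<close>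

type_synonym 'n exponent = "'n \<times> 'n \<Rightarrow> nat"

definition mon :: "'n exponent \<Rightarrow> complex^'n^'n \<Rightarrow> complex" where
  "mon \<alpha> X = (\<Prod>v\<in>UNIV. X $ fst v $ snd v ^ \<alpha> v)"

lemma mon_add: "mon (\<lambda>v. \<alpha> v + \<beta> v) X = mon \<alpha> X * mon \<beta> X"
  by (simp add: mon_def power_add prod.distrib)

lemma mon_zero [simp]: "mon (\<lambda>_. 0) X = 1"
  by (simp add: mon_def)

lemma mon_single: "mon (\<lambda>v. if v = (i, j) then k else 0) X = X $ i $ j ^ k"
proof -
  have "mon (\<lambda>v. if v = (i, j) then k else 0) X =
      (\<Prod>v\<in>UNIV. if v = (i, j) then X $ i $ j ^ k else 1)"
    unfolding mon_def by (rule prod.cong) auto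
  then show ?thesis by simp
qed

text \<open>Dedekind's argument: distinct multiplicative characters are independent.\<close>

lemma independent_mon: "independent_family (mon :: 'n::finite exponent \<Rightarrow> _)"
proof -
  have "\<forall>\<alpha>\<in>A. c \<alpha> = 0" if "finite A" "\<forall>X. (\<Sum>\<alpha>\<in>A. c \<alpha> * mon \<alpha> X) = 0"
    for A :: "'n exponent set" and c
    using that
  proof (induction A arbitrary: c rule: finite_induct)
    case (insert a A)
    have "\<forall>\<alpha>\<in>A. c \<alpha> = 0"
    proof
      fix \<alpha> assume \<alpha>: "\<alpha> \<in> A"
      then obtain v where v: "\<alpha> v \<noteq> a v" using insert.hyps by (metis ext)
      \<comment> \<open>Doubling the one variable in which \<open>\<alpha>\<close> and
        \<open>a\<close> differ multiplies each monomial by its own character value. Subtracting the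
        original relation times the value at \<open>a\<close> eliminates \<open>a\<close>, and
        \<open>\<alpha>\<close> keeps a nonzero factor.\<close>
      define Y :: "complex^'n^'n" where "Y = (\<chi> i j. if (i, j) = v then 2 else 1)"
      have Y: "mon \<gamma> Y = 2 ^ \<gamma> v" for \<gamma>
      proof -
        have "mon \<gamma> Y = (\<Prod>u\<in>UNIV. if u = v then 2 ^ \<gamma> v else 1)"
          unfolding mon_def Y_def by (rule prod.cong) auto
        then show ?thesis by simp
      qed
      have "(\<Sum>\<gamma>\<in>A. (c \<gamma> * (mon \<gamma> Y - mon a Y)) * mon \<gamma> X) = 0" for X
      proof -
        have "(\<Sum>\<gamma>\<in>insert a A. c \<gamma> * mon \<gamma> (\<chi> i j. X $ i $ j * Y $ i $ j)) = 0"
          using insert.prems by blast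
        moreover have "mon \<gamma> (\<chi> i j. X $ i $ j * Y $ i $ j) = mon \<gamma> X * mon \<gamma> Y" for \<gamma>
          by (simp add: mon_def power_mult_distrib prod.distrib)
        ultimately have 1: "(\<Sum>\<gamma>\<in>insert a A. c \<gamma> * (mon \<gamma> X * mon \<gamma> Y)) = 0" by simp
        have "(\<Sum>\<gamma>\<in>insert a A. c \<gamma> * mon \<gamma> X) * mon a Y = 0" using insert.prems by simp
        then have 2: "(\<Sum>\<gamma>\<in>insert a A. c \<gamma> * (mon \<gamma> X * mon a Y)) = 0"
          by (simp add: sum_distrib_right mult.assoc del: sum.insert)
        from 1 2 have "(\<Sum>\<gamma>\<in>insert a A. c \<gamma> * (mon \<gamma> X * mon \<gamma> Y) - c \<gamma> * (mon \<gamma> X * mon a Y)) = 0"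
          unfolding sum_subtractf by simp
        then show ?thesis using insert.hyps by (simp add: algebra_simps)
      qed
      then have "c \<alpha> * (mon \<alpha> Y - mon a Y) = 0"
        using insert.IH[of "\<lambda>\<gamma>. c \<gamma> * (mon \<gamma> Y - mon a Y)"] \<alpha> by blast
      moreover have "(2::complex) ^ \<alpha> v \<noteq> 2 ^ a v"
      proof
        assume "(2::complex) ^ \<alpha> v = 2 ^ a v"
        then have "norm ((2::complex) ^ \<alpha> v) = norm ((2::complex) ^ a v)" by simp
        then show False using v by (simp add: norm_power)
      qed
      ultimately show "c \<alpha> = 0" by (simp add: Y)
    qed
    moreover have "c a = 0"
    proof -
      have "(\<Sum>\<gamma>\<in>insert a A. c \<gamma> * mon \<gamma> (\<chi> i j. 1)) = 0" using insert.prems by blast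
      moreover have "(\<Sum>\<gamma>\<in>A. c \<gamma> * mon \<gamma> (\<chi> i j. 1)) = 0"
        using \<open>\<forall>\<alpha>\<in>A. c \<alpha> = 0\<close> by (intro sum.neutral) auto
      ultimately show ?thesis using insert.hyps by (simp add: mon_def)
    qed
    ultimately show ?case by simp
  qed simp
  then show ?thesis unfolding independent_family_def by blast
qed

lemma mon_poly: "mon \<alpha> \<in> matrix_polys"
  unfolding mon_def by (intro generated_algebra_intros entry_poly)

lemma combs_mon_mult:
  assumes "f \<in> combs mon E" "g \<in> combs mon E'"
    and "\<And>\<alpha> \<beta>. \<alpha> \<in> E \<Longrightarrow> \<beta> \<in> E' \<Longrightarrow> (\<lambda>v. \<alpha> v + \<beta> v) \<in> E''"
  shows "(\<lambda>X. f X * g X) \<in> combs mon E''"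
  using assms(1)
proof (induction rule: combs_induct)
  case (base c \<alpha>)
  from assms(2) show ?case
  proof (induction rule: combs_induct)
    case (base d \<beta>)
    have "(\<lambda>X. (c * d) * mon (\<lambda>v. \<alpha> v + \<beta> v) X) \<in> combs mon E''"
      using assms(3) base \<open>\<alpha> \<in> E\<close> by (intro combs_scaled_base) auto
    then show ?case by (simp add: mon_add algebra_simps)
  qed (auto simp: distrib_left intro: combs_zero combs_add)
qed (auto simp: distrib_right intro: combs_zero combs_add)

lemma matrix_polys_eq: "(matrix_polys :: (complex^'n^'n \<Rightarrow> complex) set) = combs mon UNIV"
proof
  show "(matrix_polys :: (complex^'n^'n \<Rightarrow> complex) set) \<subseteq> combs mon UNIV"
  proof
    fix f :: "complex^'n^'n \<Rightarrow> complex" assume "f \<in> matrix_polys"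
    then show "f \<in> combs mon UNIV"
    proof induction
      case (const c)
      then show ?case using combs_scaled_base[of "\<lambda>_. 0" UNIV c mon] by simp
    next
      case (base f)
      then obtain i j where "f = (\<lambda>X. X $ i $ j)" by (auto simp: mat_coords_def)
      then show ?case
        using combs_base[of "\<lambda>v. if v = (i, j) then 1 else 0" UNIV mon]
          mon_single[of i j 1] by (auto simp: fun_eq_iff) (metis (no_types, lifting) ext power_one_right)
    qed (auto intro: combs_add combs_mon_mult)
  qed
  show "combs mon UNIV \<subseteq> (matrix_polys :: (complex^'n^'n \<Rightarrow> complex) set)"
  proof
    fix f :: "complex^'n^'n \<Rightarrow> complex" assume "f \<in> combs mon UNIV"
    then show "f \<in> matrix_polys"
      by (induction rule: combs_induct) (auto intro!: generated_algebra_intros mon_poly)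
  qed
qed

section \<open>Ideals of polynomial functions\<close>

definition gen_ideal ::
    "('k \<Rightarrow> complex^'n^'n \<Rightarrow> complex) \<Rightarrow> 'k set \<Rightarrow> (complex^'n^'n \<Rightarrow> complex) set" where
  "gen_ideal F J = {(\<lambda>X. \<Sum>k\<in>J. a k X * F k X) | a. \<forall>k\<in>J. a k \<in> matrix_polys}"

lemma gen_ideal_add:
  assumes "f \<in> gen_ideal F J" "g \<in> gen_ideal F J" shows "(\<lambda>X. f X + g X) \<in> gen_ideal F J"
proof -
  obtain a where a: "f = (\<lambda>X. \<Sum>k\<in>J. a k X * F k X)" "\<forall>k\<in>J. a k \<in> matrix_polys"
    using assms(1) by (auto simp: gen_ideal_def)
  obtain b where b: "g = (\<lambda>X. \<Sum>k\<in>J. b k X * F k X)" "\<forall>k\<in>J. b k \<in> matrix_polys"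
    using assms(2) by (auto simp: gen_ideal_def)
  have "(\<lambda>X. f X + g X) = (\<lambda>X. \<Sum>k\<in>J. (a k X + b k X) * F k X)"
    by (simp add: a b distrib_right sum.distrib)
  moreover have "\<forall>k\<in>J. (\<lambda>X. a k X + b k X) \<in> matrix_polys"
    using a b by (auto intro: generated_algebra.add)
  ultimately show ?thesis unfolding gen_ideal_def
    by (intro CollectI exI[of _ "\<lambda>k X. a k X + b k X"]) auto
qed

lemma gen_ideal_mult:
  assumes "h \<in> matrix_polys" "f \<in> gen_ideal F J" shows "(\<lambda>X. h X * f X) \<in> gen_ideal F J"
proof -
  obtain a where a: "f = (\<lambda>X. \<Sum>k\<in>J. a k X * F k X)" "\<forall>k\<in>J. a k \<in> matrix_polys"
    using assms(2) by (auto simp: gen_ideal_def)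
  have "(\<lambda>X. h X * f X) = (\<lambda>X. \<Sum>k\<in>J. (h X * a k X) * F k X)"
    by (simp add: a sum_distrib_left mult.assoc)
  moreover have "\<forall>k\<in>J. (\<lambda>X. h X * a k X) \<in> matrix_polys"
    using a assms(1) by (auto intro: generated_algebra.mult)
  ultimately show ?thesis unfolding gen_ideal_def
    by (intro CollectI exI[of _ "\<lambda>k X. h X * a k X"]) auto
qed

lemma gen_ideal_zero: "(\<lambda>X. 0) \<in> gen_ideal F J"
  unfolding gen_ideal_def
  by (intro CollectI exI[of _ "\<lambda>k X. 0"]) (auto intro: generated_algebra.const)

lemma gen_ideal_generator:
  assumes "k \<in> J" "finite J" shows "F k \<in> gen_ideal F J"
proof -
  have "F k = (\<lambda>X. \<Sum>j\<in>J. (if j = k then 1 else 0) * F j X)"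
    using assms by (simp add: if_distrib[of "\<lambda>x. x * _"] sum.delta' cong: if_cong)
  then show ?thesis unfolding gen_ideal_def
    by (intro CollectI exI[of _ "\<lambda>j X. if j = k then 1 else 0"])
      (auto intro: generated_algebra.const)
qed

lemma gen_ideal_uminus: "f \<in> gen_ideal F J \<Longrightarrow> (\<lambda>X. - f X) \<in> gen_ideal F J"
  using gen_ideal_mult[OF generated_algebra.const[of "-1"], of f F J] by simp

lemma gen_ideal_diff:
  "f \<in> gen_ideal F J \<Longrightarrow> g \<in> gen_ideal F J \<Longrightarrow> (\<lambda>X. f X - g X) \<in> gen_ideal F J"
  using gen_ideal_add[OF _ gen_ideal_uminus, of f F J g] by simp

lemma gen_ideal_sum:
  assumes "\<And>i. i \<in> I \<Longrightarrow> f i \<in> gen_ideal F J"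
  shows "(\<lambda>X. \<Sum>i\<in>I. f i X) \<in> gen_ideal F J"
  using assms
  by (induction I rule: infinite_finite_induct) (auto intro: gen_ideal_zero gen_ideal_add)

lemma gen_ideal_mono:
  assumes "J \<subseteq> J'" "finite J'" shows "gen_ideal F J \<subseteq> gen_ideal F J'"
proof
  fix f assume "f \<in> gen_ideal F J"
  then obtain a where a: "f = (\<lambda>X. \<Sum>k\<in>J. a k X * F k X)" "\<forall>k\<in>J. a k \<in> matrix_polys"
    by (auto simp: gen_ideal_def)
  show "f \<in> gen_ideal F J'" unfolding a(1)
    by (intro gen_ideal_sum gen_ideal_mult) (use a assms in \<open>auto intro: gen_ideal_generator\<close>)
qed

section \<open>Weights, leading monomials and regular sequences\<close>

definition weight :: "('n::finite \<times> 'n \<Rightarrow> nat) \<Rightarrow> 'n exponent \<Rightarrow> nat" where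
  "weight w \<alpha> = (\<Sum>v\<in>UNIV. \<alpha> v * w v)"

lemma weight_add: "weight w (\<lambda>v. \<alpha> v + \<beta> v) = weight w \<alpha> + weight w \<beta>"
  by (simp add: weight_def distrib_right sum.distrib)

text \<open>A weight does not order the monomials totally. The part of top weight is therefore
  required to be one monomial with coefficient 1, which makes leading monomials
  multiplicative.\<close>

definition leading ::
    "('n::finite \<times> 'n \<Rightarrow> nat) \<Rightarrow> (complex^'n^'n \<Rightarrow> complex) \<Rightarrow> 'n exponent \<Rightarrow> bool" where
  "leading w f \<alpha> \<longleftrightarrow> (\<lambda>X. f X - mon \<alpha> X) \<in> combs mon {\<beta>. weight w \<beta> < weight w \<alpha>}"

lemma leading_mon: "leading w (mon \<alpha>) \<alpha>"
  by (simp add: leading_def combs_zero)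

lemma leading_one: "leading w (\<lambda>_. 1) (\<lambda>_. 0)"
  by (simp add: leading_def combs_zero)

lemma leading_combs:
  assumes "leading w f \<alpha>" shows "f \<in> combs mon {\<beta>. weight w \<beta> \<le> weight w \<alpha>}"
proof -
  have "(\<lambda>X. (f X - mon \<alpha> X) + mon \<alpha> X) \<in> combs mon {\<beta>. weight w \<beta> \<le> weight w \<alpha>}"
  proof (intro combs_add combs_base)
    have "{\<beta>. weight w \<beta> < weight w \<alpha>} \<subseteq> {\<beta>. weight w \<beta> \<le> weight w \<alpha>}" by auto
    from combs_mono[OF this, of mon]
    show "(\<lambda>X. f X - mon \<alpha> X) \<in> combs mon {\<beta>. weight w \<beta> \<le> weight w \<alpha>}"
      using assms unfolding leading_def by blast
  qed simp
  then show ?thesis by simp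
qed

lemma leading_poly: "leading w f \<alpha> \<Longrightarrow> f \<in> matrix_polys"
  using leading_combs combs_mono[of _ UNIV mon] by (force simp: matrix_polys_eq)

lemma leading_mult:
  assumes "leading w f \<alpha>" "leading w g \<beta>"
  shows "leading w (\<lambda>X. f X * g X) (\<lambda>v. \<alpha> v + \<beta> v)"
proof -
  let ?E = "{\<gamma>. weight w \<gamma> < weight w \<alpha> + weight w \<beta>}"
  have "(\<lambda>X. (f X - mon \<alpha> X) * g X + mon \<alpha> X * (g X - mon \<beta> X)) \<in> combs mon ?E"
  proof (rule combs_add)
    show "(\<lambda>X. (f X - mon \<alpha> X) * g X) \<in> combs mon ?E"
      by (rule combs_mon_mult[OF assms(1)[unfolded leading_def] leading_combs[OF assms(2)]])
        (auto simp: weight_add)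
    show "(\<lambda>X. mon \<alpha> X * (g X - mon \<beta> X)) \<in> combs mon ?E"
      by (rule combs_mon_mult[OF combs_base[of \<alpha> "{\<alpha>}"] assms(2)[unfolded leading_def]])
        (auto simp: weight_add)
  qed
  then show ?thesis by (simp add: leading_def mon_add weight_add algebra_simps)
qed

lemma leading_power: "leading w f \<alpha> \<Longrightarrow> leading w (\<lambda>X. f X ^ k) (\<lambda>v. k * \<alpha> v)"
proof (induction k)
  case (Suc k)
  then show ?case using leading_mult[of w f \<alpha> "\<lambda>X. f X ^ k" "\<lambda>v. k * \<alpha> v"] by simp
qed (simp add: leading_one)

lemma leading_prod:
  assumes "finite I" "\<And>i. i \<in> I \<Longrightarrow> leading w (f i) (\<alpha> i)"
  shows "leading w (\<lambda>X. \<Prod>i\<in>I. f i X) (\<lambda>v. \<Sum>i\<in>I. \<alpha> i v)"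
  using assms
  by (induction I rule: finite_induct) (auto intro: leading_one leading_mult)

text \<open>Monomials with disjoint sets of variables form a regular sequence in every order; the
  locale transfers this to polynomials having such leading monomials.\<close>

locale coprime_leading =
  fixes w :: "'n::finite \<times> 'n \<Rightarrow> nat" and K :: "'k set"
    and F :: "'k \<Rightarrow> complex^'n^'n \<Rightarrow> complex" and m :: "'k \<Rightarrow> 'n exponent"
  assumes finite_K: "finite K"
    and leading_F: "k \<in> K \<Longrightarrow> leading w (F k) (m k)"
    and nonconstant: "k \<in> K \<Longrightarrow> \<exists>v. m k v \<noteq> 0"
    and coprime_m: "j \<in> K \<Longrightarrow> k \<in> K \<Longrightarrow> j \<noteq> k \<Longrightarrow> m j v = 0 \<or> m k v = 0"
begin

text \<open>The exponent of the highest power of \<open>mon (m k)\<close> dividing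
  \<open>mon \<alpha>\<close>. The minimum is over a nonempty set by
  \<open>nonconstant\<close>.\<close>

definition mult_of :: "'k \<Rightarrow> 'n exponent \<Rightarrow> nat" where
  "mult_of k \<alpha> = Min ((\<lambda>v. \<alpha> v div m k v) ` {v. m k v \<noteq> 0})"

definition rest :: "'n exponent \<Rightarrow> 'n exponent" where
  "rest \<alpha> v = \<alpha> v - (\<Sum>k\<in>K. mult_of k \<alpha> * m k v)"

text \<open>
  The family \<open>\<theta>\<close> is a triangular change of basis which turns multiplication by the monomial
  \<open>mon (m k)\<close> into multiplication by \<open>F k\<close>.
\<close>

definition \<theta> :: "'n exponent \<Rightarrow> complex^'n^'n \<Rightarrow> complex" where
  "\<theta> \<alpha> X = mon (rest \<alpha>) X * (\<Prod>k\<in>K. F k X ^ mult_of k \<alpha>)"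

lemma mult_of_le: "mult_of k \<alpha> * m k v \<le> \<alpha> v"
proof (cases "m k v = 0")
  case False
  then have "mult_of k \<alpha> \<le> \<alpha> v div m k v"
    unfolding mult_of_def by (intro Min_le) auto
  then show ?thesis by (metis div_times_less_eq_dividend dual_order.trans mult_le_mono1)
qed simp

text \<open>By coprimality at most one summand is nonzero at \<open>v\<close>. Hence the truncated
  subtraction in \<open>rest\<close> is exact.\<close>

lemma sum_mult_of_le: "(\<Sum>k\<in>K. mult_of k \<alpha> * m k v) \<le> \<alpha> v"
proof (cases "\<exists>k\<in>K. m k v \<noteq> 0")
  case True
  then obtain k where k: "k \<in> K" "m k v \<noteq> 0" by blast
  have "(\<Sum>j\<in>K. mult_of j \<alpha> * m j v) = (\<Sum>j\<in>{k}. mult_of j \<alpha> * m j v)"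
  proof (intro sum.mono_neutral_right ballI)
    fix j assume "j \<in> K - {k}"
    then show "mult_of j \<alpha> * m j v = 0" using coprime_m[of j k v] k by simp
  qed (use k finite_K in auto)
  then show ?thesis using mult_of_le by simp
qed simp

lemma mult_of_add:
  assumes "j \<in> K" "k \<in> K"
  shows "mult_of j (\<lambda>v. \<alpha> v + m k v) = mult_of j \<alpha> + (if j = k then 1 else 0)"
proof (cases "j = k")
  case True
  have "mult_of k (\<lambda>v. \<alpha> v + m k v) = Min ((\<lambda>v. \<alpha> v div m k v + 1) ` {v. m k v \<noteq> 0})"
    unfolding mult_of_def by (intro arg_cong[where f = Min] image_cong) auto
  also have "\<dots> = mult_of k \<alpha> + 1"
    unfolding mult_of_def by (rule Min_add_commute) (use nonconstant assms in auto)
  finally show ?thesis using True by simp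
next
  case False
  have "mult_of j (\<lambda>v. \<alpha> v + m k v) = mult_of j \<alpha>"
    unfolding mult_of_def
  proof (intro arg_cong[where f = Min] image_cong refl)
    fix v assume "v \<in> {v. m j v \<noteq> 0}"
    then show "(\<alpha> v + m k v) div m j v = \<alpha> v div m j v"
      using coprime_m[OF assms False, of v] by simp
  qed
  then show ?thesis using False by simp
qed

lemma theta_add:
  assumes "k \<in> K" shows "\<theta> (\<lambda>v. \<alpha> v + m k v) X = F k X * \<theta> \<alpha> X"
proof -
  have "rest (\<lambda>v. \<alpha> v + m k v) = rest \<alpha>"
  proof
    fix v
    have "(\<Sum>j\<in>K. mult_of j (\<lambda>v. \<alpha> v + m k v) * m j v) =
        (\<Sum>j\<in>K. mult_of j \<alpha> * m j v + (if j = k then m k v else 0))"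
      using assms by (intro sum.cong) (auto simp: mult_of_add)
    then show "rest (\<lambda>v. \<alpha> v + m k v) v = rest \<alpha> v"
      using assms finite_K by (simp add: rest_def sum.distrib sum.delta)
  qed
  moreover have "(\<Prod>j\<in>K. F j X ^ mult_of j (\<lambda>v. \<alpha> v + m k v)) =
      (\<Prod>j\<in>K. F j X ^ mult_of j \<alpha> * (if j = k then F k X else 1))"
    using assms by (intro prod.cong) (auto simp: mult_of_add)
  ultimately show ?thesis using assms finite_K
    by (simp add: \<theta>_def prod.distrib prod.delta)
qed

lemma leading_theta: "leading w (\<theta> \<alpha>) \<alpha>"
proof -
  have "leading w (\<theta> \<alpha>) (\<lambda>v. rest \<alpha> v + (\<Sum>k\<in>K. mult_of k \<alpha> * m k v))"
    unfolding \<theta>_def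
    by (intro leading_mult leading_mon leading_prod leading_power leading_F finite_K)
  moreover have "(\<lambda>v. rest \<alpha> v + (\<Sum>k\<in>K. mult_of k \<alpha> * m k v)) = \<alpha>"
    using sum_mult_of_le by (simp add: rest_def fun_eq_iff)
  ultimately show ?thesis by simp
qed

text \<open>The change of basis is unitriangular for the weight, and weights are natural numbers, so
  it can be inverted by induction on the weight.\<close>

lemma mon_combs_theta: "mon \<alpha> \<in> combs \<theta> UNIV"
proof (induction "weight w \<alpha>" arbitrary: \<alpha> rule: less_induct)
  case less
  from leading_theta[of \<alpha>] have "(\<lambda>X. \<theta> \<alpha> X - mon \<alpha> X) \<in> combs \<theta> UNIV"
    unfolding leading_def
    by (induction rule: combs_induct) (auto intro: combs_zero combs_add combs_cmult less)
  from combs_diff[OF combs_base[OF UNIV_I] this, of \<alpha>]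
  show ?case by simp
qed

lemma polys_combs_theta: "f \<in> matrix_polys \<Longrightarrow> f \<in> combs \<theta> UNIV"
  unfolding matrix_polys_eq
  by (induction rule: combs_induct) (auto intro: combs_zero combs_add combs_cmult mon_combs_theta)

text \<open>In a nontrivial relation the terms of maximal weight have leading monomials that would
  lie in the span of monomials of smaller weight, contrary to
  \<open>independent_mon\<close>.\<close>

lemma independent_theta: "independent_family \<theta>"
  unfolding independent_family_def
proof (intro allI impI)
  fix A :: "'n exponent set" and c
  assume A: "finite A" and zero: "\<forall>X. (\<Sum>\<alpha>\<in>A. c \<alpha> * \<theta> \<alpha> X) = 0"
  show "\<forall>\<alpha>\<in>A. c \<alpha> = 0"
  proof (rule ccontr)
    let ?A = "{\<alpha>\<in>A. c \<alpha> \<noteq> 0}"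
    assume "\<not> (\<forall>\<alpha>\<in>A. c \<alpha> = 0)"
    then have "finite ?A" "?A \<noteq> {}" using A by auto
    then have "Max (weight w ` ?A) \<in> weight w ` ?A" by (intro Max_in) auto
    then obtain \<alpha>\<^sub>0 where "\<alpha>\<^sub>0 \<in> ?A" "weight w \<alpha>\<^sub>0 = Max (weight w ` ?A)" by auto
    then have a0: "\<alpha>\<^sub>0 \<in> ?A" "\<forall>\<alpha>\<in>?A. weight w \<alpha> \<le> weight w \<alpha>\<^sub>0"
      using \<open>finite ?A\<close> by (simp_all del: Max_less_iff)
    define d where "d = weight w \<alpha>\<^sub>0"
    let ?B = "{\<alpha>\<in>?A. weight w \<alpha> = d}" and ?E = "{\<beta>. weight w \<beta> < d}"
    have "(\<lambda>X. \<Sum>\<alpha>\<in>?B. c \<alpha> * mon \<alpha> X) \<in> combs mon ?E"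
    proof -
      have eq: "(\<Sum>\<alpha>\<in>?B. c \<alpha> * mon \<alpha> X) =
          - (\<Sum>\<alpha>\<in>?A. c \<alpha> * (\<theta> \<alpha> X - mon \<alpha> X)) - (\<Sum>\<alpha>\<in>?A - ?B. c \<alpha> * mon \<alpha> X)" for X
      proof -
        have "(\<Sum>\<alpha>\<in>?A. c \<alpha> * \<theta> \<alpha> X) = (\<Sum>\<alpha>\<in>A. c \<alpha> * \<theta> \<alpha> X)"
          using A by (intro sum.mono_neutral_left) auto
        moreover have "(\<Sum>\<alpha>\<in>?A. c \<alpha> * mon \<alpha> X) =
            (\<Sum>\<alpha>\<in>?A - ?B. c \<alpha> * mon \<alpha> X) + (\<Sum>\<alpha>\<in>?B. c \<alpha> * mon \<alpha> X)"
          using A by (intro sum.subset_diff) auto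
        ultimately show ?thesis using zero by (simp add: right_diff_distrib sum_subtractf)
      qed
      have "(\<lambda>X. \<Sum>\<alpha>\<in>?A. c \<alpha> * (\<theta> \<alpha> X - mon \<alpha> X)) \<in> combs mon ?E"
      proof (rule combs_sum, rule combs_cmult)
        fix \<alpha> assume "\<alpha> \<in> ?A"
        then have "weight w \<alpha> \<le> d" using a0(2) d_def by blast
        then have "{\<beta>. weight w \<beta> < weight w \<alpha>} \<subseteq> ?E" by auto
        from combs_mono[OF this] show "(\<lambda>X. \<theta> \<alpha> X - mon \<alpha> X) \<in> combs mon ?E"
          using leading_theta[of \<alpha>] unfolding leading_def by blast
      qed
      moreover have "(\<lambda>X. \<Sum>\<alpha>\<in>?A - ?B. c \<alpha> * mon \<alpha> X) \<in> combs mon ?E"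
      proof (rule combs_sum, rule combs_scaled_base)
        fix \<alpha> assume "\<alpha> \<in> ?A - ?B"
        then have "weight w \<alpha> \<le> d" "weight w \<alpha> \<noteq> d" using a0(2) d_def by blast+
        then show "\<alpha> \<in> ?E" by simp
      qed
      ultimately have "(\<lambda>X. - (\<Sum>\<alpha>\<in>?A. c \<alpha> * (\<theta> \<alpha> X - mon \<alpha> X)) -
          (\<Sum>\<alpha>\<in>?A - ?B. c \<alpha> * mon \<alpha> X)) \<in> combs mon ?E"
        by (rule combs_diff[OF combs_uminus])
      then show ?thesis by (simp only: eq)
    qed
    then have "c \<alpha>\<^sub>0 = 0"
      by (intro independent_family_disjoint[OF independent_mon, of ?B ?E]) (use A a0 d_def in auto)
    then show False using a0 by simp
  qed
qed

definition divisible :: "'k set \<Rightarrow> 'n exponent set" where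
  "divisible J = {\<alpha>. \<exists>k\<in>J. \<forall>v. m k v \<le> \<alpha> v}"

lemma theta_mult_combs:
  assumes "k \<in> K" "f \<in> combs \<theta> UNIV" "k \<in> J"
  shows "(\<lambda>X. f X * F k X) \<in> combs \<theta> (divisible J)"
  using assms(2)
proof (induction rule: combs_induct)
  case (base c \<alpha>)
  have "(\<lambda>X. c * \<theta> (\<lambda>v. \<alpha> v + m k v) X) \<in> combs \<theta> (divisible J)"
    by (rule combs_scaled_base) (unfold divisible_def, use assms(3) in \<open>blast intro: le_add2\<close>)
  then show ?case by (simp add: theta_add[OF assms(1)] algebra_simps)
qed (auto simp: distrib_right intro: combs_zero combs_add)

text \<open>In the basis \<open>\<theta>\<close> multiplication by \<open>F k\<close> is the shift
  of exponents by \<open>m k\<close>, so the ideal looks like a monomial ideal.\<close>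

lemma gen_ideal_eq:
  assumes "J \<subseteq> K" shows "gen_ideal F J = combs \<theta> (divisible J)"
proof
  show "gen_ideal F J \<subseteq> combs \<theta> (divisible J)"
    using assms
    by (auto simp: gen_ideal_def intro!: combs_sum theta_mult_combs polys_combs_theta)
  show "combs \<theta> (divisible J) \<subseteq> gen_ideal F J"
  proof
    fix f assume "f \<in> combs \<theta> (divisible J)"
    then show "f \<in> gen_ideal F J"
    proof (induction rule: combs_induct)
      case (base c \<alpha>)
      then obtain k where k: "k \<in> J" "\<forall>v. m k v \<le> \<alpha> v" by (auto simp: divisible_def)
      let ?\<gamma> = "\<lambda>v. \<alpha> v - m k v"
      have "\<alpha> = (\<lambda>v. ?\<gamma> v + m k v)" using k by (simp add: fun_eq_iff)
      then have "\<theta> \<alpha> X = \<theta> ?\<gamma> X * F k X" for X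
        using theta_add[of k ?\<gamma> X] k assms by (metis mult.commute subsetD)
      then have eq: "(\<lambda>X. c * \<theta> \<alpha> X) = (\<lambda>X. (c * \<theta> ?\<gamma> X) * F k X)" by (simp add: mult.assoc)
      show ?case unfolding eq
        by (intro gen_ideal_mult gen_ideal_generator generated_algebra_cmult leading_poly[OF leading_theta])
          (use k assms finite_K finite_subset in auto)
    qed (auto intro: gen_ideal_zero gen_ideal_add)
  qed
qed

text \<open>Shifting by \<open>m k\<close> neither creates nor destroys divisibility by
  \<open>m j\<close> for \<open>j\<close> in \<open>J\<close>, since the variables are disjoint. The
  part of \<open>a\<close> outside the ideal therefore stays outside after multiplication by
  \<open>F k\<close>, and independence forces it to be zero.\<close>

theorem nonzerodivisor:
  assumes "k \<in> K" "J \<subseteq> K" "k \<notin> J" "a \<in> matrix_polys"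
    and Fa: "(\<lambda>X. F k X * a X) \<in> gen_ideal F J"
  shows "a \<in> gen_ideal F J"
proof -
  obtain A c where A: "finite A" "a = (\<lambda>X. \<Sum>\<alpha>\<in>A. c \<alpha> * \<theta> \<alpha> X)"
    using polys_combs_theta[OF assms(4)] by (auto elim: combsE)
  let ?A = "A - divisible J" and ?s = "\<lambda>\<alpha> v. \<alpha> v + m k v"
  have shift: "?s \<alpha> \<in> divisible J \<longleftrightarrow> \<alpha> \<in> divisible J" for \<alpha>
  proof -
    have "(\<forall>v. m j v \<le> \<alpha> v + m k v) \<longleftrightarrow> (\<forall>v. m j v \<le> \<alpha> v)" if "j \<in> J" for j
    proof -
      have "j \<in> K" "j \<noteq> k" using that assms by auto
      from coprime_m[OF this(1) assms(1) this(2)] show ?thesis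
        by (metis add.right_neutral le0 trans_le_add1)
    qed
    then show ?thesis by (auto simp: divisible_def)
  qed
  have inj: "inj ?s" by (intro injI) (simp add: fun_eq_iff)
  have split: "a X = (\<Sum>\<alpha>\<in>?A. c \<alpha> * \<theta> \<alpha> X) + (\<Sum>\<alpha>\<in>A \<inter> divisible J. c \<alpha> * \<theta> \<alpha> X)" for X
    unfolding A(2) using A(1) by (subst sum.Int_Diff[where B = "divisible J"]) auto
  have in_J: "(\<lambda>X. \<Sum>\<alpha>\<in>A \<inter> divisible J. c \<alpha> * \<theta> \<alpha> X) \<in> gen_ideal F J"
    unfolding gen_ideal_eq[OF assms(2)] by (rule combsI) (use A in auto)
  have "(\<lambda>X. F k X * a X - F k X * (\<Sum>\<alpha>\<in>A \<inter> divisible J. c \<alpha> * \<theta> \<alpha> X)) \<in> gen_ideal F J"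
    by (intro gen_ideal_diff Fa gen_ideal_mult in_J leading_poly[OF leading_F[OF assms(1)]])
  also have "(\<lambda>X. F k X * a X - F k X * (\<Sum>\<alpha>\<in>A \<inter> divisible J. c \<alpha> * \<theta> \<alpha> X)) =
      (\<lambda>X. \<Sum>\<alpha>\<in>?A. c \<alpha> * \<theta> (?s \<alpha>) X)"
    by (simp add: split theta_add[OF assms(1)] distrib_left sum_distrib_left mult.left_commute)
  also have "\<dots> = (\<lambda>X. \<Sum>\<gamma>\<in>?s ` ?A. c (inv_into UNIV ?s \<gamma>) * \<theta> \<gamma> X)"
    by (subst sum.reindex) (auto simp: inv_f_f[OF inj] intro: inj_on_subset[OF inj])
  finally have *: "(\<lambda>X. \<Sum>\<gamma>\<in>?s ` ?A. c (inv_into UNIV ?s \<gamma>) * \<theta> \<gamma> X) \<in> combs \<theta> (divisible J)"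
    using gen_ideal_eq[OF assms(2)] by simp
  have "c \<alpha> = 0" if "\<alpha> \<in> ?A" for \<alpha>
    using independent_family_disjoint[OF independent_theta _ _ *, of "?s \<alpha>"] that A(1) shift
    by (auto simp: inv_f_f[OF inj])
  then have "a = (\<lambda>X. \<Sum>\<alpha>\<in>A \<inter> divisible J. c \<alpha> * \<theta> \<alpha> X)"
    by (auto simp: split fun_eq_iff intro!: sum.neutral)
  then show ?thesis using in_J by simp
qed

end


section \<open>Leading monomials for the Kostant variety\<close>

text \<open>Subtracting \<open>\<mu> k\<close> at each step, instead of taking plain powers of
  \<open>X\<close>, makes the matrix of \<open>X\<close> in this basis bidiagonal with prescribed
  diagonal rather than a companion matrix; so it is a point of the slice.\<close>

primrec kry :: "(nat \<Rightarrow> complex) \<Rightarrow> complex^'n \<Rightarrow> complex^'n^'n \<Rightarrow> nat \<Rightarrow> complex^'n" where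
  "kry \<mu> v X 0 = v"
| "kry \<mu> v X (Suc k) = X *v kry \<mu> v X k - \<mu> k *s kry \<mu> v X k"

definition geometric :: "complex \<Rightarrow> complex fps" where
  "geometric x = Abs_fps (\<lambda>k. x ^ k)"

lemma geometric_inverse: "(1 - fps_const x * fps_X) * geometric x = 1"
proof (rule fps_ext)
  fix k show "fps_nth ((1 - fps_const x * fps_X) * geometric x) k = fps_nth 1 k"
    by (cases k) (simp_all add: geometric_def left_diff_distrib mult.assoc)
qed

text \<open>An ordering of the indices by 0, ..., n - 1. It fixes the standard flag and thereby what
  upper triangular means.\<close>

locale ranking =
  fixes r :: "'n::finite \<Rightarrow> nat"
  assumes bij_r: "bij_betw r UNIV {..<CARD('n)}"
begin

lemma inj_r: "inj r"
  using bij_r by (rule bij_betw_imp_inj_on)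

lemma r_less: "r i < CARD('n)"
  using bij_r by (auto simp: bij_betw_def)

lemma r_eq_iff [simp]: "r i = r j \<longleftrightarrow> i = j"
  using inj_r by (auto dest: injD)

definition at_rank :: "nat \<Rightarrow> 'n" where "at_rank k = inv_into UNIV r k"

lemma r_at_rank: "k < CARD('n) \<Longrightarrow> r (at_rank k) = k"
  unfolding at_rank_def by (rule f_inv_into_f) (use bij_r in \<open>auto simp: bij_betw_def\<close>)

lemma at_rank_r [simp]: "at_rank (r i) = i"
  unfolding at_rank_def by (rule inv_into_f_f[OF inj_r UNIV_I])

text \<open>\<open>gap\<close> exceeds \<open>n^2 + n\<close>, so that one off-diagonal factor loses
  more than the tie-breaking summands on the diagonal can ever gain. \<open>base\<close> is large
  enough to keep all weights nonnegative.\<close>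

definition gap :: int where "gap = int (CARD('n) * CARD('n) + CARD('n) + 1)"
definition base :: int where "base = gap * int (CARD('n) * CARD('n))"

text \<open>
  The negative squares of the distances to the diagonal single out, in an invariant of height 0
  under the diagonal torus, the part in the diagonal entries, and in the minors of Krylov vectors
  the part in the entries next to the diagonal. The summand on the diagonal breaks the remaining
  ties.
\<close>

definition int_wt :: "'n \<times> 'n \<Rightarrow> int" where
  "int_wt v = (if fst v = snd v then base + int (r (fst v)) + 1
     else base - gap * (int (r (fst v)) - int (r (snd v)))\<^sup>2)"

definition wt :: "'n \<times> 'n \<Rightarrow> nat" where "wt v = nat (int_wt v)"

lemma gap_pos: "0 < gap" "int CARD('n) < gap" "int CARD('n) * int CARD('n) + int CARD('n) < gap"
  unfolding gap_def of_nat_add of_nat_mult of_nat_1 by (auto simp: add_nonneg_pos)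

lemma base_nonneg: "0 \<le> base"
  using gap_pos by (simp add: base_def)

lemma base_ge: "int CARD('n) * int CARD('n) < base + int CARD('n)"
proof -
  have "1 * int (CARD('n) * CARD('n)) \<le> gap * int (CARD('n) * CARD('n))"
    by (rule mult_right_mono) (use gap_pos(1) in linarith)+
  moreover have "0 < int CARD('n)" by simp
  ultimately show ?thesis unfolding base_def by (simp only: of_nat_mult mult_1)
qed

lemma wt_int: "int (wt v) = int_wt v"
proof -
  have "(int (r i) - int (r j))\<^sup>2 \<le> int (CARD('n) * CARD('n))" for i j
  proof -
    have "\<bar>int (r i) - int (r j)\<bar> \<le> int CARD('n)"
      using r_less[of i] r_less[of j] by linarith
    then have "\<bar>int (r i) - int (r j)\<bar>\<^sup>2 \<le> (int CARD('n))\<^sup>2" by (rule power_mono) simp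
    then show ?thesis by (simp add: power2_eq_square)
  qed
  then have "gap * (int (r i) - int (r j))\<^sup>2 \<le> base" for i j
    unfolding base_def using gap_pos(1) by (intro mult_left_mono) auto
  then show ?thesis using base_nonneg by (auto simp: wt_def int_wt_def)
qed

text \<open>An integer bound allows differences of weights without truncation. For a negative bound
  only the zero function remains.\<close>

definition le :: "int \<Rightarrow> (complex^'n^'n \<Rightarrow> complex) set" where
  "le z = combs mon {\<alpha>. int (weight wt \<alpha>) \<le> z}"

lemma le_mono: "f \<in> le z \<Longrightarrow> z \<le> z' \<Longrightarrow> f \<in> le z'"
  unfolding le_def by (rule subsetD[OF combs_mono]) auto

lemma le_zero [simp]: "(\<lambda>X. 0) \<in> le z" unfolding le_def by (rule combs_zero)

lemma le_add: "f \<in> le z \<Longrightarrow> g \<in> le z \<Longrightarrow> (\<lambda>X. f X + g X) \<in> le z"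
  unfolding le_def by (rule combs_add)

lemma le_diff: "f \<in> le z \<Longrightarrow> g \<in> le z \<Longrightarrow> (\<lambda>X. f X - g X) \<in> le z"
  unfolding le_def by (rule combs_diff)

lemma le_uminus: "f \<in> le z \<Longrightarrow> (\<lambda>X. - f X) \<in> le z"
  unfolding le_def by (rule combs_uminus)

lemma le_cmult: "f \<in> le z \<Longrightarrow> (\<lambda>X. c * f X) \<in> le z"
  unfolding le_def by (rule combs_cmult)

lemma le_sum: "(\<And>i. i \<in> I \<Longrightarrow> f i \<in> le z) \<Longrightarrow> (\<lambda>X. \<Sum>i\<in>I. f i X) \<in> le z"
  unfolding le_def by (rule combs_sum)

lemma le_mon: "int (weight wt \<alpha>) \<le> z \<Longrightarrow> mon \<alpha> \<in> le z"
  unfolding le_def by (rule combs_base) simp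

lemma le_const: "0 \<le> z \<Longrightarrow> (\<lambda>X. c) \<in> le z"
  using le_cmult[OF le_mon[of "\<lambda>_. 0" z], of c] by (simp add: weight_def)

lemma le_mult:
  assumes "f \<in> le a" "g \<in> le b" "a + b \<le> z" shows "(\<lambda>X. f X * g X) \<in> le z"
  using assms(1,2) unfolding le_def
  by (rule combs_mon_mult) (use assms(3) in \<open>auto simp: weight_add\<close>)

lemma le_prod:
  assumes "finite I" "\<And>i. i \<in> I \<Longrightarrow> f i \<in> le (z i)"
  shows "(\<lambda>X. \<Prod>i\<in>I. f i X) \<in> le (\<Sum>i\<in>I. z i)"
  using assms
proof (induction I rule: finite_induct)
  case (insert i I)
  have "(\<lambda>X. f i X * (\<Prod>i\<in>I. f i X)) \<in> le (\<Sum>i\<in>insert i I. z i)"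
    by (rule le_mult[of _ "z i" _ "\<Sum>i\<in>I. z i"]) (use insert in auto)
  then show ?case using insert.hyps by simp
qed (auto intro: le_const)

lemma le_power: "f \<in> le z \<Longrightarrow> (\<lambda>X. f X ^ k) \<in> le (int k * z)"
proof (induction k)
  case (Suc k)
  then show ?case using le_mult[of f z "\<lambda>X. f X ^ k" "int k * z" "int (Suc k) * z"]
    by (simp add: algebra_simps)
qed (simp add: le_const)

lemma weight_single: "weight wt (\<lambda>v. if v = u then k else 0) = k * wt u"
proof -
  have "weight wt (\<lambda>v. if v = u then k else 0) = (\<Sum>v\<in>UNIV. if v = u then k * wt u else 0)"
    unfolding weight_def by (rule sum.cong) auto
  then show ?thesis by simp
qed

lemma le_entry: "int_wt (i, j) \<le> z \<Longrightarrow> (\<lambda>X. X $ i $ j) \<in> le z"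
  using le_mon[of "\<lambda>v. if v = (i, j) then 1 else 0" z]
  by (simp add: weight_single wt_int mon_single[of i j 1, simplified, abs_def])

lemma leading_iff: "leading wt f \<alpha> \<longleftrightarrow> (\<lambda>X. f X - mon \<alpha> X) \<in> le (int (weight wt \<alpha>) - 1)"
proof -
  have "{\<beta>. weight wt \<beta> < weight wt \<alpha>} = {\<beta>. int (weight wt \<beta>) \<le> int (weight wt \<alpha>) - 1}" by auto
  then show ?thesis by (simp add: leading_def le_def)
qed

subsection \<open>Divided differences of the characteristic polynomial\<close>

text \<open>The series variable gets weight \<open>-\<kappa>\<close>; then \<open>\<delta>\<close>
  measures by how much a series stays below weight 0, and these savings add up in products.\<close>

definition bounded :: "int \<Rightarrow> int \<Rightarrow> (complex^'n^'n \<Rightarrow> complex fps) \<Rightarrow> bool" where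
  "bounded \<kappa> \<delta> \<Phi> \<longleftrightarrow> (\<forall>k. (\<lambda>X. fps_nth (\<Phi> X) k) \<in> le (int k * \<kappa> - \<delta>))"

lemma bounded_mult:
  assumes "bounded \<kappa> \<delta> \<Phi>" "bounded \<kappa> \<delta>' \<Psi>"
  shows "bounded \<kappa> (\<delta> + \<delta>') (\<lambda>X. \<Phi> X * \<Psi> X)"
  unfolding bounded_def fps_mult_nth
proof (intro allI le_sum)
  fix k j :: nat assume "j \<in> {0..k}"
  then show "(\<lambda>X. fps_nth (\<Phi> X) j * fps_nth (\<Psi> X) (k - j)) \<in> le (int k * \<kappa> - (\<delta> + \<delta>'))"
  proof (intro le_mult[of _ "int j * \<kappa> - \<delta>" _ "int (k - j) * \<kappa> - \<delta>'"])
    show "int j * \<kappa> - \<delta> + (int (k - j) * \<kappa> - \<delta>') \<le> int k * \<kappa> - (\<delta> + \<delta>')"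
      using \<open>j \<in> {0..k}\<close> by (simp add: of_nat_diff algebra_simps)
  qed (use assms[unfolded bounded_def] in blast)+
qed

lemma bounded_one: "0 \<le> \<kappa> \<Longrightarrow> bounded \<kappa> 0 (\<lambda>X. 1)"
  unfolding bounded_def by (auto intro: le_const)

lemma bounded_prod:
  assumes "0 \<le> \<kappa>" "finite I" "\<And>i. i \<in> I \<Longrightarrow> bounded \<kappa> (\<delta> i) (\<Phi> i)"
  shows "bounded \<kappa> (\<Sum>i\<in>I. \<delta> i) (\<lambda>X. \<Prod>i\<in>I. \<Phi> i X)"
  using assms(2,3)
  by (induction I rule: finite_induct) (auto intro: bounded_one bounded_mult assms(1))

lemma bounded_mono: "bounded \<kappa> \<delta> \<Phi> \<Longrightarrow> \<delta>' \<le> \<delta> \<Longrightarrow> bounded \<kappa> \<delta>' \<Phi>"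
  unfolding bounded_def by (auto intro: le_mono)

lemma bounded_sum:
  "(\<And>i. i \<in> I \<Longrightarrow> bounded \<kappa> \<delta> (\<Phi> i)) \<Longrightarrow> bounded \<kappa> \<delta> (\<lambda>X. \<Sum>i\<in>I. \<Phi> i X)"
  unfolding bounded_def fps_sum_nth by (auto intro: le_sum)

lemma bounded_geometric:
  assumes "int_wt (i, i) \<le> \<kappa>" shows "bounded \<kappa> 0 (\<lambda>X. geometric (X $ i $ i))"
  unfolding bounded_def geometric_def
  by (auto intro: le_power[OF le_entry[OF assms]])

text \<open>The generating series of the complete homogeneous symmetric polynomials in the diagonal
  entries of rank less than \<open>m\<close>.\<close>

definition complete_series :: "nat \<Rightarrow> complex^'n^'n \<Rightarrow> complex fps" where
  "complete_series m X = (\<Prod>j | r j < m. geometric (X $ j $ j))"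

lemma bounded_complete_series:
  assumes "base + int m \<le> \<kappa>" shows "bounded \<kappa> 0 (complete_series m)"
proof -
  have "bounded \<kappa> (\<Sum>j | r j < m. 0) (\<lambda>X. \<Prod>j | r j < m. geometric (X $ j $ j))"
    using assms base_nonneg
    by (intro bounded_prod bounded_geometric) (auto simp: int_wt_def)
  then show ?thesis by (simp add: complete_series_def[abs_def])
qed

lemma complete_Suc: "complete_series (Suc (r i)) X = complete_series (r i) X * geometric (X $ i $ i)"
proof -
  have "{j. r j < Suc (r i)} = insert i {j. r j < r i}"
    by (auto simp: less_Suc_eq)
  then show ?thesis by (simp add: complete_series_def mult.commute)
qed

definition spread :: "('n \<Rightarrow> complex) \<Rightarrow> complex fps" where
  "spread l = (\<Prod>i\<in>UNIV. 1 - fps_const (l i) * fps_X)"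

text \<open>
  With the variable inverted, this is the divided difference at \<open>X $ j $ j\<close>, \<open>r j \<le> r i\<close>,
  of the difference of two monic polynomials. In contrast to the coefficients themselves, these
  divided differences have pairwise coprime leading monomials.
\<close>

definition divdiff :: "('n \<Rightarrow> complex) \<Rightarrow> 'n \<Rightarrow> complex^'n^'n \<Rightarrow> complex" where
  "divdiff l i X =
     fps_nth ((spread l - char_fps X) * complete_series (Suc (r i)) X) (CARD('n) - r i)"

text \<open>Every permutation other than the identity uses an off-diagonal entry, and one such
  factor already saves \<open>gap\<close>.\<close>

lemma bounded_offdiagonal:
  "bounded (base + int CARD('n)) gap (\<lambda>X. char_fps X - spread (\<lambda>i. X $ i $ i))"
proof -
  let ?\<kappa> = "base + int CARD('n)"
  let ?P = "{p :: 'n \<Rightarrow> 'n. p permutes UNIV}"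
  have entry: "bounded ?\<kappa> (if p i = i then 0 else gap) (\<lambda>X. char_matrix X $ i $ p i)" for p i
    unfolding bounded_def
  proof
    fix k
    show "(\<lambda>X. fps_nth (char_matrix X $ i $ p i) k) \<in> le (int k * ?\<kappa> - (if p i = i then 0 else gap))"
    proof (cases "p i = i")
      case True
      have "int_wt (i, i) \<le> ?\<kappa>" using r_less[of i] by (simp add: int_wt_def)
      then show ?thesis using True
        by (cases "k = 0"; cases "k = 1")
          (auto simp: char_matrix_def intro: le_const le_uminus le_entry)
    next
      case False
      have "1 \<le> (int (r i) - int (r (p i)))\<^sup>2"
        using False by (simp add: int_one_le_iff_zero_less)
      then have "gap * 1 \<le> gap * (int (r i) - int (r (p i)))\<^sup>2"
        using gap_pos(1) by (intro mult_left_mono) auto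
      then have "int_wt (i, p i) \<le> ?\<kappa> - gap" using False by (auto simp: int_wt_def)
      then show ?thesis using False
        by (cases "k = 1"; cases "k = 0") (auto simp: char_matrix_def intro: le_uminus le_entry)
    qed
  qed
  have "char_fps X - spread (\<lambda>i. X $ i $ i) =
      (\<Sum>p\<in>?P - {id}. of_int (sign p) * (\<Prod>i\<in>UNIV. char_matrix X $ i $ p i))" for X
  proof -
    have "char_fps X = of_int (sign (id :: 'n \<Rightarrow> 'n)) * (\<Prod>i\<in>UNIV. char_matrix X $ i $ id i) +
        (\<Sum>p\<in>?P - {id}. of_int (sign p) * (\<Prod>i\<in>UNIV. char_matrix X $ i $ p i))"
      unfolding char_fps_def det_def by (rule sum.remove) (auto simp: permutes_id finite_permutations)
    then show ?thesis by (simp add: sign_id spread_def char_matrix_def)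
  qed
  moreover have "bounded ?\<kappa> gap (\<lambda>X. of_int (sign p) * (\<Prod>i\<in>UNIV. char_matrix X $ i $ p i))"
    if "p \<in> ?P - {id}" for p
  proof -
    have "\<exists>i. p i \<noteq> i" using that by (auto simp: fun_eq_iff)
    then obtain i where "p i \<noteq> i" by blast
    then have "gap \<le> (\<Sum>i\<in>UNIV. if p i = i then 0 else gap)"
      using member_le_sum[of i UNIV "\<lambda>i. if p i = i then 0 else gap"] gap_pos(1) by auto
    moreover have "bounded ?\<kappa> (\<Sum>i\<in>UNIV. if p i = i then 0 else gap)
        (\<lambda>X. \<Prod>i\<in>UNIV. char_matrix X $ i $ p i)"
      using base_nonneg by (intro bounded_prod entry) auto
    ultimately have "bounded ?\<kappa> gap (\<lambda>X. \<Prod>i\<in>UNIV. char_matrix X $ i $ p i)"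
      by (rule bounded_mono[rotated])
    then show ?thesis unfolding bounded_def
      by (auto simp: fps_mult_of_int_nth intro: le_cmult)
  qed
  ultimately show ?thesis using bounded_sum[of "?P - {id}"] by simp
qed

lemma spread_zero: "fps_nth (spread l) 0 = 1"
proof -
  have "fps_nth (\<Prod>i\<in>I. 1 - fps_const (l i) * fps_X) 0 = 1" for I
    by (induction I rule: infinite_finite_induct) auto
  then show ?thesis by (simp add: spread_def)
qed

lemma complete_series_zero: "fps_nth (complete_series m X) 0 = 1"
proof -
  have "fps_nth (\<Prod>j\<in>I. geometric (X $ j $ j)) 0 = 1" for I
    by (induction I rule: infinite_finite_induct) (auto simp: geometric_def)
  then show ?thesis by (simp add: complete_series_def)
qed

text \<open>The geometric series cancel the linear factors of rank at most \<open>r i\<close>. What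
  is left has degree \<open>n - r i - 1\<close>, one less than the coefficient asked for.\<close>

lemma spread_complete_series:
  "fps_nth (spread (\<lambda>j. X $ j $ j) * complete_series (Suc (r i)) X) (CARD('n) - r i) = 0"
proof -
  let ?lo = "{j. r j < Suc (r i)}" and ?hi = "{j. r i < r j}"
  let ?f = "\<lambda>j. 1 - fps_const (X $ j $ j) * fps_X"
  have "spread (\<lambda>j. X $ j $ j) = prod ?f ?hi * prod ?f ?lo"
    unfolding spread_def
    by (subst prod.union_disjoint[symmetric]) (auto intro!: prod.cong)
  then have "spread (\<lambda>j. X $ j $ j) * complete_series (Suc (r i)) X =
      prod ?f ?hi * (\<Prod>j\<in>?lo. ?f j * geometric (X $ j $ j))"
    by (simp add: complete_series_def prod.distrib mult.assoc)
  then have eq: "spread (\<lambda>j. X $ j $ j) * complete_series (Suc (r i)) X = prod ?f ?hi"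
    by (simp add: geometric_inverse)
  have "card ?hi = CARD('n) - Suc (r i)"
  proof -
    have "r ` ?hi = {Suc (r i)..<CARD('n)}"
    proof
      show "r ` ?hi \<subseteq> {Suc (r i)..<CARD('n)}" using r_less by auto
      show "{Suc (r i)..<CARD('n)} \<subseteq> r ` ?hi"
      proof
        fix k assume "k \<in> {Suc (r i)..<CARD('n)}"
        then show "k \<in> r ` ?hi" using r_at_rank[of k] by (intro image_eqI[of _ _ "at_rank k"]) auto
      qed
    qed
    then have "card {Suc (r i)..<CARD('n)} = card ?hi"
      using card_image[OF inj_on_subset[OF inj_r subset_UNIV], of ?hi] by simp
    then show ?thesis by simp
  qed
  then have "(\<Sum>j\<in>?hi. 1) < CARD('n) - r i" using r_less[of i] by simp
  then have "fps_nth (prod ?f ?hi) (CARD('n) - r i) = 0"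
    by (intro fps_prod_degree[where d = "\<lambda>_. 1"]) auto
  then show ?thesis by (simp add: eq)
qed

text \<open>Up to terms of small weight, the divided difference is the complete symmetric polynomial
  of degree \<open>n - r i\<close> in the diagonal entries of rank at most \<open>r i\<close>. The
  entry at \<open>i\<close> is the heaviest of them, so its pure power leads.\<close>

lemma leading_divdiff:
  "leading wt (divdiff l i) (\<lambda>v. if v = (i, i) then CARD('n) - r i else 0)"
proof -
  let ?\<kappa> = "base + int CARD('n)" and ?\<kappa>' = "base + int (r i)" and ?K = "CARD('n) - r i"
  let ?H = "complete_series (Suc (r i))"
  \<comment> \<open>One less than the weight of the expected leading monomial, since a diagonal
    entry has weight \<open>base + r i + 1\<close>.\<close>
  define z where "z = int ?K * (?\<kappa>' + 1) - 1"
  have K: "int ?K = int CARD('n) - int (r i)" "1 \<le> int ?K" "?K \<noteq> 0" using r_less[of i] by auto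
  have small: "int ?K * ?\<kappa> - \<delta> \<le> z" if "int CARD('n) * int CARD('n) < \<delta>" for \<delta>
  proof -
    have "int ?K * (int CARD('n) - int (r i) - 1) \<le> int CARD('n) * int CARD('n)"
      using K by (intro mult_mono) auto
    then show ?thesis unfolding z_def using that by (simp add: algebra_simps)
  qed
  have H: "bounded ?\<kappa> 0 ?H" by (rule bounded_complete_series) (use r_less[of i] in auto)
  \<comment> \<open>The coefficients are constants, of weight 0, and the one at \<open>t^0\<close>
    vanishes; each of the others saves at least one full \<open>?\<kappa>\<close>.\<close>
  have "bounded ?\<kappa> ?\<kappa> (\<lambda>X. spread l - 1)"
    unfolding bounded_def
  proof
    fix k show "(\<lambda>X. fps_nth (spread l - 1) k) \<in> le (int k * ?\<kappa> - ?\<kappa>)"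
    proof (cases k)
      case (Suc j)
      have "0 \<le> int j * ?\<kappa>" using base_nonneg by simp
      then show ?thesis using Suc by (intro le_const) (simp add: algebra_simps)
    qed (simp add: spread_zero)
  qed
  from bounded_mult[OF this H] have 1: "(\<lambda>X. fps_nth ((spread l - 1) * ?H X) ?K) \<in> le z"
    unfolding bounded_def using small[of ?\<kappa>] base_ge
    by (auto intro: le_mono)
  from bounded_mult[OF bounded_offdiagonal H]
  have 2: "(\<lambda>X. fps_nth ((char_fps X - spread (\<lambda>i. X $ i $ i)) * ?H X) ?K) \<in> le z"
    unfolding bounded_def using small[of gap] gap_pos(3)
    by (auto intro: le_mono)
  \<comment> \<open>Every other term contains \<open>j \<ge> 1\<close> diagonal factors of rank
    below \<open>r i\<close>, and each of these loses at least 1 against the entry at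
    \<open>i\<close>.\<close>
  have 3: "(\<lambda>X. fps_nth (?H X) ?K - X $ i $ i ^ ?K) \<in> le z"
  proof -
    have H': "bounded ?\<kappa>' 0 (complete_series (r i))" by (rule bounded_complete_series) simp
    have "fps_nth (?H X) ?K - X $ i $ i ^ ?K =
        (\<Sum>j\<in>{1..?K}. fps_nth (complete_series (r i) X) j * X $ i $ i ^ (?K - j))" for X
      using K by (simp add: complete_Suc fps_mult_nth geometric_def complete_series_zero
          sum.atLeast_Suc_atMost)
    moreover have "(\<lambda>X. \<Sum>j\<in>{1..?K}. fps_nth (complete_series (r i) X) j * X $ i $ i ^ (?K - j)) \<in> le z"
    proof (rule le_sum)
      fix j assume j: "j \<in> {1..?K}"
      have a: "(\<lambda>X. fps_nth (complete_series (r i) X) j) \<in> le (int j * ?\<kappa>')"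
        using H' by (simp add: bounded_def)
      have b: "(\<lambda>X. X $ i $ i ^ (?K - j)) \<in> le (int (?K - j) * (?\<kappa>' + 1))"
        by (rule le_power[OF le_entry]) (simp add: int_wt_def)
      have c: "int (?K - j) = int ?K - int j" using j by auto
      show "(\<lambda>X. fps_nth (complete_series (r i) X) j * X $ i $ i ^ (?K - j)) \<in> le z"
        by (rule le_mult[OF a b]) (unfold c z_def, use j in \<open>simp add: algebra_simps\<close>)
    qed
    ultimately show ?thesis by simp
  qed
  have "divdiff l i X - X $ i $ i ^ ?K = fps_nth ((spread l - 1) * ?H X) ?K
      + (fps_nth (?H X) ?K - X $ i $ i ^ ?K)
      - fps_nth ((char_fps X - spread (\<lambda>i. X $ i $ i)) * ?H X) ?K" for X
  proof -
    have "(spread l - char_fps X) * ?H X = (spread l - 1) * ?H X + ?H X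
        - (char_fps X - spread (\<lambda>i. X $ i $ i)) * ?H X - spread (\<lambda>i. X $ i $ i) * ?H X"
      by (simp add: algebra_simps)
    then show ?thesis unfolding divdiff_def using spread_complete_series[of X i] by simp
  qed
  then have "(\<lambda>X. divdiff l i X - X $ i $ i ^ ?K) \<in> le z"
    using le_diff[OF le_add[OF 1 3] 2] by (simp only:)
  then show ?thesis
    by (simp add: leading_iff mon_single weight_single wt_int int_wt_def z_def ac_simps)
qed

subsection \<open>Determinants of Krylov vectors\<close>

context
  fixes s :: "'n \<Rightarrow> nat"
  assumes s: "s = r \<or> s = (\<lambda>i. CARD('n) - 1 - r i)"
begin

text \<open>Off the diagonal the weight depends only on squared differences of ranks, so the order
  and its reversal can be treated together.\<close>

lemma s_diff_sq: "(int (s i) - int (s j))\<^sup>2 = (int (r i) - int (r j))\<^sup>2"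
proof -
  have "int (CARD('n) - 1 - r i) - int (CARD('n) - 1 - r j) = - (int (r i) - int (r j))"
    using r_less[of i] r_less[of j] by (simp add: of_nat_diff)
  then show ?thesis using s by (auto simp: power2_commute)
qed

lemma inj_s: "s i = s j \<longleftrightarrow> i = j"
proof
  assume "s i = s j"
  then have "(int (r i) - int (r j))\<^sup>2 = 0" using s_diff_sq[of i j] by simp
  then show "i = j" by simp
qed simp

lemma s_less: "s i < CARD('n)"
  using s r_less[of i] by auto

lemma s_surj: "k < CARD('n) \<Longrightarrow> \<exists>i. s i = k"
  using s
proof
  assume "s = r" "k < CARD('n)"
  then show ?thesis using r_at_rank[of k] by blast
next
  assume "s = (\<lambda>i. CARD('n) - 1 - r i)" "k < CARD('n)"
  moreover from this(2) have "CARD('n) - 1 - k < CARD('n)" by linarith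
  ultimately show ?thesis using r_at_rank[of "CARD('n) - 1 - k"]
    by (intro exI[of _ "at_rank (CARD('n) - 1 - k)"]) simp
qed

text \<open>The product of the entries along the path of heights 0, 1, ..., \<open>k\<close>. All
  these entries lie next to the diagonal, below it for \<open>s = r\<close> and above it for the
  reversed order.\<close>

primrec path_exp :: "nat \<Rightarrow> 'n exponent" where
  "path_exp 0 = (\<lambda>v. 0)"
| "path_exp (Suc k) = (\<lambda>v. (if s (snd v) = k \<and> s (fst v) = Suc k then 1 else 0) + path_exp k v)"

lemma int_wt_adjacent: "s i = Suc (s j) \<Longrightarrow> int_wt (i, j) = base - gap"
  using s_diff_sq[of i j] by (auto simp: int_wt_def)

lemma adjacent_eq:
  assumes "s i = Suc k" "s j = k"
  shows "(\<lambda>v. if s (snd v) = k \<and> s (fst v) = Suc k then 1 else 0) = (\<lambda>v. if v = (i, j) then 1 else 0)"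
proof
  fix v
  have "s (snd v) = k \<longleftrightarrow> snd v = j" "s (fst v) = Suc k \<longleftrightarrow> fst v = i"
    using assms inj_s by metis+
  then show "(if s (snd v) = k \<and> s (fst v) = Suc k then 1 else 0) = (if v = (i, j) then 1 else 0)"
    by (auto simp: prod_eq_iff)
qed

lemma weight_path: "k < CARD('n) \<Longrightarrow> int (weight wt (path_exp k)) = int k * (base - gap)"
proof (induction k)
  case (Suc k)
  obtain i j where ij: "s i = Suc k" "s j = k" using s_surj Suc.prems Suc_lessD by metis
  have "int (weight wt (path_exp (Suc k))) = int_wt (i, j) + int k * (base - gap)"
    using Suc
    by (simp add: weight_add weight_single wt_int
        adjacent_eq[OF ij, THEN arg_cong[where f = "weight wt"]])
  then show ?case using int_wt_adjacent[of i j] ij by (simp add: algebra_simps)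
qed (simp add: weight_def)

text \<open>Completing the square: \<open>- h^2 = 1 - 2 h - (h - 1)^2\<close>. The bound is linear
  in the height difference \<open>h\<close>, hence telescopes along paths, and it is attained only
  for steps of height exactly 1. On the diagonal, \<open>gap > n\<close> leaves room for the
  tie-breaking summand.\<close>

lemma int_wt_height:
  "int_wt (i, j) \<le> base + gap - 2 * gap * (int (s i) - int (s j)) - (if s i = Suc (s j) then 0 else 1)"
proof (cases "i = j")
  case True
  then show ?thesis using r_less[of j] gap_pos(2) by (simp add: int_wt_def)
next
  case False
  let ?h = "int (s i) - int (s j)"
  have eq: "int_wt (i, j) = base + gap - 2 * gap * ?h - gap * (?h - 1)\<^sup>2"
  proof -
    have "int_wt (i, j) = base - gap * ?h\<^sup>2"
      using False by (simp add: int_wt_def s_diff_sq)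
    moreover have "gap * (?h - 1)\<^sup>2 = gap * ?h\<^sup>2 - 2 * gap * ?h + gap"
      unfolding power2_eq_square by (simp only: algebra_simps)
    ultimately show ?thesis by linarith
  qed
  have "(if s i = Suc (s j) then 0 else 1) \<le> (?h - 1)\<^sup>2"
    by (auto simp: int_one_le_iff_zero_less)
  also have "1 * (?h - 1)\<^sup>2 \<le> gap * (?h - 1)\<^sup>2" using gap_pos(1) by (intro mult_right_mono) auto
  finally show ?thesis using eq by simp
qed

text \<open>A coordinate of the Krylov vector is a sum over paths from the start. The linear bounds
  telescope to a value that depends only on the end point, and a path all of whose steps rise by 1
  is the only one without loss.\<close>

lemma kry_leading:
  assumes "s i\<^sub>0 = 0" "k < CARD('n)"
  shows "(\<lambda>X. kry \<mu> (axis i\<^sub>0 1) X k $ i - (if s i = k then mon (path_exp k) X else 0))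
     \<in> le (int k * (base + gap) - 2 * gap * int (s i) - 1)"
  using assms(2)
proof (induction k arbitrary: i)
  case 0
  have "i = i\<^sub>0 \<longleftrightarrow> s i = 0" using inj_s assms(1) by metis
  then have "axis i\<^sub>0 1 $ i - (if s i = 0 then mon (path_exp 0) X else 0) = 0" for X
    by (auto simp: axis_def)
  then show ?case by simp
next
  case (Suc k)
  let ?f = "\<lambda>i X. kry \<mu> (axis i\<^sub>0 1) X k $ i"
  let ?m = "\<lambda>i X. if s i = k then mon (path_exp k) X else 0"
  let ?z = "int (Suc k) * (base + gap) - 2 * gap * int (s i) - 1"
  have IH: "(\<lambda>X. ?f i X - ?m i X) \<in> le (int k * (base + gap) - 2 * gap * int (s i) - 1)" for i
    using Suc by simp
  have wk: "int (weight wt (path_exp k)) = int k * (base + gap) - 2 * gap * int k"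
    using weight_path[of k] Suc.prems by (simp add: algebra_simps)
  then have mk: "mon (path_exp k) \<in> le (int k * (base + gap) - 2 * gap * int k)"
    by (intro le_mon) simp
  have m: "?m i \<in> le (int k * (base + gap) - 2 * gap * int (s i))" for i
    using mk by (cases "s i = k") auto
  have f: "?f i \<in> le (int k * (base + gap) - 2 * gap * int (s i))"
    using le_add[OF le_mono[OF IH[of i]] m[of i]] by simp
  have 1: "(\<lambda>X. \<Sum>j\<in>UNIV. X $ i $ j * (?f j X - ?m j X)) \<in> le ?z"
  proof (rule le_sum)
    fix j
    have "(\<lambda>X. X $ i $ j) \<in> le (base + gap - 2 * gap * (int (s i) - int (s j)))"
      using int_wt_height[of i j] by (intro le_entry) (auto split: if_splits)
    then show "(\<lambda>X. X $ i $ j * (?f j X - ?m j X)) \<in> le ?z"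
      by (rule le_mult[OF _ IH[of j]]) (simp add: algebra_simps)
  qed
  have 2: "(\<lambda>X. (\<Sum>j\<in>UNIV. X $ i $ j * ?m j X) - (if s i = Suc k then mon (path_exp (Suc k)) X else 0)) \<in> le ?z"
  proof -
    obtain j where j: "s j = k" using s_surj Suc.prems Suc_lessD by metis
    have sum: "(\<Sum>j\<in>UNIV. X $ i $ j * ?m j X) = X $ i $ j * mon (path_exp k) X" for X
    proof -
      have "(\<Sum>l\<in>UNIV. X $ i $ l * ?m l X) = (\<Sum>l\<in>UNIV. if l = j then X $ i $ j * mon (path_exp k) X else 0)"
        by (rule sum.cong) (use j inj_s in auto)
      then show ?thesis by simp
    qed
    show ?thesis
    proof (cases "s i = Suc k")
      case True
      have "mon (path_exp (Suc k)) X = X $ i $ j * mon (path_exp k) X" for X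
        unfolding path_exp.simps mon_add adjacent_eq[OF True j] by (simp add: mon_single)
      then show ?thesis using True by (simp add: sum)
    next
      case False
      have "(\<lambda>X. X $ i $ j) \<in> le (base + gap - 2 * gap * (int (s i) - int (s j)) - 1)"
        using int_wt_height[of i j] False j by (intro le_entry) auto
      then have "(\<lambda>X. X $ i $ j * mon (path_exp k) X) \<in> le ?z"
        by (rule le_mult[OF _ mk]) (simp add: algebra_simps j)
      then show ?thesis using False by (simp add: sum)
    qed
  qed
  \<comment> \<open>The shift contributes no matrix entry and so falls behind by
    \<open>base + gap\<close>, which is positive.\<close>
  have 3: "(\<lambda>X. \<mu> k * ?f i X) \<in> le ?z"
    by (rule le_cmult, rule le_mono[OF f]) (use base_nonneg gap_pos(1) in \<open>simp add: algebra_simps\<close>)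
  have "kry \<mu> (axis i\<^sub>0 1) X (Suc k) $ i - (if s i = Suc k then mon (path_exp (Suc k)) X else 0) =
      (\<Sum>j\<in>UNIV. X $ i $ j * (?f j X - ?m j X))
      + ((\<Sum>j\<in>UNIV. X $ i $ j * ?m j X) - (if s i = Suc k then mon (path_exp (Suc k)) X else 0))
      - \<mu> k * ?f i X" for X
    by (simp add: matrix_vector_mult_def right_diff_distrib sum_subtractf)
  then show ?case using le_diff[OF le_add[OF 1 2] 3] by (simp only:)
qed

definition krylov_det :: "(nat \<Rightarrow> complex) \<Rightarrow> 'n \<Rightarrow> complex^'n^'n \<Rightarrow> complex" where
  "krylov_det \<mu> i\<^sub>0 X = det (\<chi> i j. kry \<mu> (axis i\<^sub>0 1) X (s j) $ i)"

definition path_total :: "'n exponent" where "path_total v = (\<Sum>i\<in>UNIV. path_exp (s i) v)"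

text \<open>The linear bounds on the entries add up to the same total for every permutation. Each
  off-diagonal position loses a further 1, so only the identity term reaches the top weight.\<close>

lemma leading_krylov_det:
  assumes "s i\<^sub>0 = 0"
  shows "leading wt (krylov_det \<mu> i\<^sub>0) path_total"
proof -
  let ?f = "\<lambda>i j X. kry \<mu> (axis i\<^sub>0 1) X (s j) $ i"
  let ?P = "{p :: 'n \<Rightarrow> 'n. p permutes UNIV}"
  let ?z = "int (weight wt path_total) - 1"
  have diag: "leading wt (?f i i) (path_exp (s i))" for i
  proof -
    have "int (weight wt (path_exp (s i))) - 1 = int (s i) * (base + gap) - 2 * gap * int (s i) - 1"
      using weight_path[OF s_less, of i] by (simp add: algebra_simps)
    then show ?thesis
      using kry_leading[OF assms s_less[of i], where i = i] unfolding leading_iff by simp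
  qed
  have entry: "?f i j \<in> le (int (s j) * (base + gap) - 2 * gap * int (s i) - (if i = j then 0 else 1))" for i j
  proof (cases "i = j")
    case True
    have "?f j j \<in> le (int (weight wt (path_exp (s j))))"
      using leading_combs[OF diag[of j]] by (simp add: le_def)
    moreover have "int (weight wt (path_exp (s j))) = int (s j) * (base + gap) - 2 * gap * int (s j)"
      using weight_path[OF s_less, of j] by (simp add: algebra_simps)
    ultimately show ?thesis using True by simp
  next
    case False
    then show ?thesis using kry_leading[OF assms s_less[of j], where i = i] inj_s by simp
  qed
  have wp: "int (weight wt path_total) = (\<Sum>i\<in>UNIV. int (s i) * (base - gap))"
  proof -
    have "weight wt path_total = (\<Sum>i\<in>UNIV. weight wt (path_exp (s i)))"
      unfolding weight_def path_total_def sum_distrib_right by (rule sum.swap)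
    then show ?thesis using weight_path[OF s_less] by simp
  qed
  have "(\<lambda>X. of_int (sign p) * (\<Prod>i\<in>UNIV. ?f i (p i) X)) \<in> le ?z" if p: "p \<in> ?P - {id}" for p
  proof (rule le_cmult)
    let ?b = "\<lambda>i. int (s (p i)) * (base + gap) - 2 * gap * int (s i) - (if i = p i then 0 else 1)"
    have "\<exists>i. p i \<noteq> i" using p by (auto simp: fun_eq_iff)
    then obtain i where i: "i \<noteq> p i" by metis
    have perm: "(\<Sum>i\<in>UNIV. int (s (p i)) * (base + gap)) = (\<Sum>i\<in>UNIV. int (s i) * (base + gap))"
      using sum.permute[of p UNIV "\<lambda>i. int (s i) * (base + gap)"] p by (simp add: o_def)
    have "(1::int) \<le> (\<Sum>i\<in>UNIV. if i = p i then 0 else 1)"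
      using member_le_sum[of i UNIV "\<lambda>i. if i = p i then 0 else (1::int)"] i by auto
    then have "(\<Sum>i\<in>UNIV. ?b i) \<le> (\<Sum>i\<in>UNIV. int (s i) * (base + gap) - 2 * gap * int (s i)) - 1"
      unfolding sum_subtractf perm by simp
    also have "\<dots> = ?z" unfolding wp by (simp add: algebra_simps)
    finally have b: "(\<Sum>i\<in>UNIV. ?b i) \<le> ?z" .
    have "(\<lambda>X. \<Prod>i\<in>UNIV. ?f i (p i) X) \<in> le (\<Sum>i\<in>UNIV. ?b i)"
      by (rule le_prod[OF finite entry])
    then show "(\<lambda>X. \<Prod>i\<in>UNIV. ?f i (p i) X) \<in> le ?z" using b by (rule le_mono)
  qed
  then have 1: "(\<lambda>X. \<Sum>p\<in>?P - {id}. of_int (sign p) * (\<Prod>i\<in>UNIV. ?f i (p i) X)) \<in> le ?z"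
    by (rule le_sum)
  have "leading wt (\<lambda>X. \<Prod>i\<in>UNIV. ?f i i X) path_total"
    unfolding path_total_def[abs_def] by (rule leading_prod) (auto intro: diag)
  then have 2: "(\<lambda>X. (\<Prod>i\<in>UNIV. ?f i i X) - mon path_total X) \<in> le ?z"
    by (simp add: leading_iff)
  have "krylov_det \<mu> i\<^sub>0 X = of_int (sign (id :: 'n \<Rightarrow> 'n)) * (\<Prod>i\<in>UNIV. ?f i (id i) X) +
      (\<Sum>p\<in>?P - {id}. of_int (sign p) * (\<Prod>i\<in>UNIV. ?f i (p i) X))" for X
    unfolding krylov_det_def det_def
    by (subst sum.remove[of ?P id]) (auto simp: permutes_id finite_permutations)
  then have "krylov_det \<mu> i\<^sub>0 X - mon path_total X = ((\<Prod>i\<in>UNIV. ?f i i X) - mon path_total X) +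
      (\<Sum>p\<in>?P - {id}. of_int (sign p) * (\<Prod>i\<in>UNIV. ?f i (p i) X))" for X
    by (simp add: sign_id)
  then show ?thesis using le_add[OF 2 1] unfolding leading_iff by (simp only:)
qed

lemma path_support: "path_exp k v \<noteq> 0 \<Longrightarrow> s (fst v) = Suc (s (snd v))"
  by (induction k) (auto split: if_splits)

lemma path_total_support: "path_total v \<noteq> 0 \<Longrightarrow> s (fst v) = Suc (s (snd v))"
  unfolding path_total_def using path_support by auto

lemma path_total_nonzero:
  assumes "1 < CARD('n)" shows "\<exists>v. path_total v \<noteq> 0"
proof -
  obtain i j where "s i = 1" "s j = 0" using s_surj[of 1] s_surj[of 0] assms by auto
  then have "path_exp (s i) (i, j) \<noteq> 0" by simp
  then have "path_total (i, j) \<noteq> 0" unfolding path_total_def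
    by (metis UNIV_I finite sum_eq_0_iff)
  then show ?thesis by blast
qed

text \<open>For n = 1 the leading monomial is 1, which \<open>coprime_leading\<close> excludes; this
  case is handled separately below.\<close>

lemma krylov_det_one:
  assumes "s i\<^sub>0 = 0" "CARD('n) = 1" shows "krylov_det \<mu> i\<^sub>0 X = 1"
proof -
  have "s i = 0" for i using s_less[of i] assms(2) by simp
  then have "path_total = (\<lambda>_. 0)" by (simp add: path_total_def fun_eq_iff)
  then have "weight wt path_total = 0" by (simp add: weight_def)
  with leading_krylov_det[OF assms(1), of \<mu>]
  have "(\<lambda>X. krylov_det \<mu> i\<^sub>0 X - 1) \<in> combs mon {}"
    using \<open>path_total = (\<lambda>_. 0)\<close> by (simp add: leading_def)
  then have "(\<lambda>X. krylov_det \<mu> i\<^sub>0 X - 1) = (\<lambda>X. 0)" by (auto simp: combs_def)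
  then show ?thesis by (metis eq_iff_diff_eq_0)
qed

end

end


lemma char_fps_zero: "fps_nth (char_fps (A :: complex^'n^'n)) 0 = 1"
proof -
  have prod0: "fps_nth (\<Prod>i\<in>I. f i) 0 = (\<Prod>i\<in>I. fps_nth (f i) 0)" for f :: "'n \<Rightarrow> complex fps" and I
    by (induction I rule: infinite_finite_induct) auto
  have "fps_nth (char_fps A) 0 = det (mat 1 :: complex^'n^'n)"
    unfolding char_fps_def det_def
    by (simp add: fps_sum_nth fps_mult_of_int_nth prod0 char_matrix_def mat_def
        if_distrib[of "\<lambda>f. fps_nth f 0"] cong: if_cong)
  then show ?thesis by simp
qed

lemma matpow_poly: "(\<lambda>X. matpow X k $ i $ j) \<in> matrix_polys"
proof (induction k arbitrary: i j)
  case (Suc k)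
  then show ?case by (simp, intro generated_algebra_matrix_mult entry_poly)
qed (simp add: mat_def generated_algebra.const)

lemma matpow_vector_poly: "(\<lambda>X. (matpow X k *v v) $ i) \<in> matrix_polys"
  unfolding matrix_vector_mult_def by (simp, intro generated_algebra_intros matpow_poly)

lemma kry_poly: "(\<lambda>X. kry \<mu> v X k $ i) \<in> matrix_polys"
proof (induction k arbitrary: i)
  case (Suc k)
  then show ?case
    by (simp add: matrix_vector_mult_def, intro generated_algebra_intros entry_poly)
qed (simp add: generated_algebra.const)

lemma matrix_vector_mult_combination:
  fixes A :: "'a::field^'n^'m"
  shows "A *v (\<Sum>k\<in>I. c k *s w k) = (\<Sum>k\<in>I. c k *s (A *v w k))"
  by (induction I rule: infinite_finite_induct)
    (auto simp: matrix_vector_right_distrib vector_scalar_commute)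

lemma mat_mult_entry: "(mat (c::'a::comm_ring_1) ** A) $ i $ j = c * A $ i $ j"
  by (simp add: matrix_matrix_mult_def mat_def if_distrib[of "\<lambda>x. x * _"] cong: if_cong)

text \<open>Commuting factors \<open>X - \<mu> j\<close> expand like a polynomial; in reversed form
  its coefficients are those of the product of the \<open>1 - \<mu> j t\<close>. This makes them
  comparable with \<open>char_fps\<close>.\<close>

lemma kry_expand:
  "kry \<mu> v X m = (\<Sum>k\<le>m. fps_nth (\<Prod>j<m. 1 - fps_const (\<mu> j) * fps_X) k *s (matpow X (m - k) *v v))"
proof (induction m)
  case (Suc m)
  let ?P = "\<lambda>m k. fps_nth (\<Prod>j<m. 1 - fps_const (\<mu> j) * fps_X) k"
  let ?w = "\<lambda>k. matpow X k *v v"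
  have P: "?P (Suc m) k = ?P m k - (if k = 0 then 0 else \<mu> m * ?P m (k - 1))" for k
    by (cases k) (simp_all add: right_diff_distrib mult.assoc[symmetric] mult.commute[of _ "fps_const _"])
  have top: "?P m (Suc m) = 0"
    by (rule fps_prod_degree[where d = "\<lambda>_. 1"]) auto
  have Xw: "X *v ?w k = ?w (Suc k)" for k
    by (simp add: matrix_vector_mul_assoc matpow_commute)
  have "X *v kry \<mu> v X m = (\<Sum>k\<le>m. ?P m k *s ?w (Suc m - k))"
    unfolding Suc.IH by (simp add: matrix_vector_mult_combination Xw Suc_diff_le del: matpow.simps)
  also have "\<dots> = (\<Sum>k\<le>Suc m. ?P m k *s ?w (Suc m - k))"
    using top by simp
  finally have 1: "X *v kry \<mu> v X m = (\<Sum>k\<le>Suc m. ?P m k *s ?w (Suc m - k))" .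
  have 2: "\<mu> m *s kry \<mu> v X m = (\<Sum>k\<le>Suc m. (if k = 0 then 0 else \<mu> m * ?P m (k - 1)) *s ?w (Suc m - k))"
    unfolding Suc.IH
    by (simp add: vec.scale_sum_right sum.atMost_Suc_shift[of _ m] del: sum.atMost_Suc)
  show ?case unfolding kry.simps 1 2
    by (simp only: P vec.scale_left_diff_distrib sum_subtractf)
qed simp

text \<open>Conjugation does not see scalar factors, and an n-th root of the inverse determinant,
  taken with the complex logarithm, moves \<open>g\<close> into \<open>SL\<close>.\<close>

lemma scale_det:
  fixes g :: "complex^'n^'n"
  assumes "det g \<noteq> 0"
  obtains h where "det h = 1" "\<And>X. h ** X ** matrix_inv h = g ** X ** matrix_inv g"
    "\<And>X. matrix_inv h ** X ** h = matrix_inv g ** X ** g"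
proof -
  define c where "c = exp (- Ln (det g) / of_nat CARD('n))"
  have "c ^ CARD('n) = exp (of_nat CARD('n) * (- Ln (det g) / of_nat CARD('n)))"
    unfolding c_def by (rule exp_of_nat_mult[symmetric])
  also have "\<dots> = exp (- Ln (det g))" by simp
  also have "\<dots> = inverse (det g)" using assms by (simp add: exp_minus)
  finally have c: "c ^ CARD('n) = inverse (det g)" .
  have "c \<noteq> 0" by (simp add: c_def)
  have det_c: "det (mat c :: complex^'n^'n) = c ^ CARD('n)"
    by (subst det_diagonal) (auto simp: mat_def)
  have inv_c: "matrix_inv (mat c :: complex^'n^'n) = mat (inverse c)"
    by (rule matrix_inv_unique) (use \<open>c \<noteq> 0\<close> in \<open>auto simp: vec_eq_iff mat_def matrix_matrix_mult_def
        if_distrib[of "\<lambda>x. x * _"] if_distrib[of "\<lambda>x. _ * x"] cong: if_cong\<close>)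
  have cc: "mat c ** mat (inverse c) = (mat 1 :: complex^'n^'n)"
    using matrix_inv_det(1)[of "mat c :: complex^'n^'n"] \<open>c \<noteq> 0\<close> by (simp add: det_c inv_c)
  define h where "h = g ** mat c"
  have det_h: "det h = 1" using assms c by (simp add: h_def det_mul det_c)
  have inv_h: "matrix_inv h = mat (inverse c) ** matrix_inv g"
    unfolding h_def using \<open>c \<noteq> 0\<close> assms by (subst matrix_inv_mult) (auto simp: det_c inv_c)
  have 1: "h ** X ** matrix_inv h = g ** X ** matrix_inv g" for X
  proof -
    have "h ** X ** matrix_inv h = g ** (mat c ** X) ** mat (inverse c) ** matrix_inv g"
      unfolding inv_h unfolding h_def by (simp add: matrix_mul_assoc)
    also have "\<dots> = g ** X ** (mat c ** mat (inverse c)) ** matrix_inv g"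
      by (simp add: mat_commute[of c X] matrix_mul_assoc)
    finally show ?thesis by (simp add: cc)
  qed
  have 2: "matrix_inv h ** X ** h = matrix_inv g ** X ** g" for X
  proof -
    let ?Z = "matrix_inv g ** X ** g"
    have "matrix_inv h ** X ** h = (mat (inverse c) ** ?Z) ** mat c"
      unfolding inv_h unfolding h_def by (simp add: matrix_mul_assoc)
    also have "\<dots> = ?Z ** (mat (inverse c) ** mat c)"
      unfolding mat_commute[of "inverse c" ?Z] by (rule matrix_mul_assoc[symmetric])
    also have "mat (inverse c) ** mat c = (mat 1 :: complex^'n^'n)"
      using cc by (simp only: mat_commute[of c "mat (inverse c)"])
    finally show ?thesis by simp
  qed
  show ?thesis using that[OF det_h 1 2] .
qed

section \<open>Krylov matrices and bidiagonal form modulo the ideal of the fibre\<close>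

context ranking
begin

text \<open>The eigenvalues are taken from the last rank downwards, and \<open>krylov\<close> places
  its columns in the same reversed order; otherwise the bidiagonal form would be lower
  triangular.\<close>

definition step_value :: "('n \<Rightarrow> complex) \<Rightarrow> nat \<Rightarrow> complex" where
  "step_value l k = l (at_rank (CARD('n) - 1 - k))"

definition krylov :: "('n \<Rightarrow> complex) \<Rightarrow> complex^'n \<Rightarrow> complex^'n^'n \<Rightarrow> complex^'n^'n" where
  "krylov l v X = (\<chi> i j. kry (step_value l) v X (CARD('n) - 1 - r j) $ i)"

definition bidiagonal :: "('n \<Rightarrow> complex) \<Rightarrow> complex^'n^'n" where
  "bidiagonal l = (\<chi> i j. if i = j then l i else if r j = Suc (r i) then 1 else 0)"

text \<open>The ideal of the equations \<open>char_fps X = spread l\<close>, generated by divided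
  differences because these have coprime leading monomials. \<open>coefficient_in_ideal\<close>
  recovers the coefficients.\<close>

definition kostant_ideal :: "('n \<Rightarrow> complex) \<Rightarrow> (complex^'n^'n \<Rightarrow> complex) set" where
  "kostant_ideal l = gen_ideal (divdiff l) UNIV"

lemmas kostant_ideal_add = gen_ideal_add[of _ "divdiff l" UNIV for l, folded kostant_ideal_def]
lemmas kostant_ideal_diff = gen_ideal_diff[of _ "divdiff l" UNIV for l, folded kostant_ideal_def]
lemmas kostant_ideal_mult = gen_ideal_mult[of _ _ "divdiff l" UNIV for l, folded kostant_ideal_def]
lemmas kostant_ideal_sum = gen_ideal_sum[of _ _ "divdiff l" UNIV for l, folded kostant_ideal_def]
lemmas kostant_ideal_zero = gen_ideal_zero[of "divdiff l" UNIV for l, folded kostant_ideal_def]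

lemma kostant_ideal_vanish:
  assumes "f \<in> kostant_ideal l" "char_fps X = spread l" shows "f X = 0"
  using assms by (auto simp: kostant_ideal_def gen_ideal_def divdiff_def)

lemma complete_series_poly: "(\<lambda>X. fps_nth (complete_series m X) k) \<in> matrix_polys"
  unfolding complete_series_def
  by (rule poly_fps_prod) (simp add: geometric_def generated_algebra_power entry_poly)

text \<open>The divided differences depend unitriangularly on the coefficients, as the complete
  series have constant term 1; the system is solved recursively.\<close>

lemma coefficient_in_ideal:
  assumes "k \<le> CARD('n)"
  shows "(\<lambda>X. fps_nth (spread l - char_fps X) k) \<in> kostant_ideal l"
  using assms
proof (induction k rule: less_induct)
  case (less k)
  let ?a = "\<lambda>j X. fps_nth (spread l - char_fps X) j"
  show ?case
  proof (cases "k = 0")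
    case True
    then show ?thesis by (simp add: spread_zero char_fps_zero kostant_ideal_zero)
  next
    case False
    define i where "i = at_rank (CARD('n) - k)"
    have i: "r i = CARD('n) - k" "CARD('n) - r i = k"
      unfolding i_def using False less.prems by (auto simp: r_at_rank)
    have "?a k X = divdiff l i X - (\<Sum>j<k. fps_nth (complete_series (Suc (r i)) X) (k - j) * ?a j X)" for X
    proof -
      have "divdiff l i X = (\<Sum>j\<le>k. ?a j X * fps_nth (complete_series (Suc (r i)) X) (k - j))"
        unfolding divdiff_def i(2) fps_mult_nth by (simp add: atLeast0AtMost)
      also have "\<dots> = (\<Sum>j<k. ?a j X * fps_nth (complete_series (Suc (r i)) X) (k - j)) + ?a k X"
        by (simp add: lessThan_Suc_atMost[symmetric] complete_series_zero)
      finally show ?thesis by (simp add: mult.commute)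
    qed
    moreover have "divdiff l i \<in> kostant_ideal l"
      unfolding kostant_ideal_def by (rule gen_ideal_generator) auto
    then have "(\<lambda>X. divdiff l i X - (\<Sum>j<k. fps_nth (complete_series (Suc (r i)) X) (k - j) * ?a j X))
        \<in> kostant_ideal l"
      by (rule kostant_ideal_diff, intro kostant_ideal_sum kostant_ideal_mult complete_series_poly
          less.IH) (use less.prems in auto)
    ultimately show ?thesis by simp
  qed
qed

lemma spread_steps: "(\<Prod>j<CARD('n). 1 - fps_const (step_value l j) * fps_X) = spread l"
proof -
  have "bij_betw (\<lambda>i. CARD('n) - 1 - r i) UNIV {..<CARD('n)}"
  proof (rule bij_betwI[where g = "\<lambda>k. at_rank (CARD('n) - 1 - k)"])
    fix k assume "k \<in> {..<CARD('n)}"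
    then have "CARD('n) - 1 - k < CARD('n)" "k \<le> CARD('n) - 1" by auto
    then show "CARD('n) - 1 - r (at_rank (CARD('n) - 1 - k)) = k" by (simp add: r_at_rank)
  next
    fix i show "at_rank (CARD('n) - 1 - (CARD('n) - 1 - r i)) = i"
      using r_less[of i] by (simp add: less_Suc_eq_le[symmetric])
  qed (auto simp: less_imp_diff_less)
  from prod.reindex_bij_betw[OF this, of "\<lambda>j. 1 - fps_const (step_value l j) * fps_X"]
  have "(\<Prod>j<CARD('n). 1 - fps_const (step_value l j) * fps_X) =
      (\<Prod>i\<in>UNIV. 1 - fps_const (step_value l (CARD('n) - 1 - r i)) * fps_X)" by simp
  also have "\<dots> = spread l"
  proof -
    have "step_value l (CARD('n) - 1 - r i) = l i" for i
      using r_less[of i] by (simp add: step_value_def less_Suc_eq_le[symmetric])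
    then show ?thesis by (simp add: spread_def)
  qed
  finally show ?thesis .
qed

text \<open>The n-th vector is the polynomial with roots \<open>l i\<close>, evaluated at
  \<open>X\<close> and applied to \<open>v\<close>. Subtracting the characteristic polynomial, which
  gives 0 by Cayley-Hamilton, leaves combinations of the coefficient differences.\<close>

lemma kry_last_in_ideal:
  "(\<lambda>X. kry (step_value l) v X CARD('n) $ i) \<in> kostant_ideal l"
proof -
  let ?n = "CARD('n)"
  have "kry (step_value l) v X ?n $ i =
      (\<Sum>k\<le>?n. (matpow X (?n - k) *v v) $ i * fps_nth (spread l - char_fps X) k)" for X
  proof -
    have "(\<Sum>k\<le>?n. fps_nth (char_fps X) k * (matpow X (?n - k) *v v) $ i) =
        (\<Sum>k\<le>?n. \<Sum>j\<in>UNIV. fps_nth (char_fps X) k * matpow X (?n - k) $ i $ j * v $ j)"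
      by (simp add: matrix_vector_mult_def sum_distrib_left mult.assoc)
    also have "\<dots> = (\<Sum>j\<in>UNIV. (\<Sum>k\<le>?n. fps_nth (char_fps X) k * matpow X (?n - k) $ i $ j) * v $ j)"
      unfolding sum_distrib_right by (rule sum.swap)
    also have "\<dots> = 0" by (simp add: cayley_hamilton)
    finally show ?thesis
      unfolding kry_expand[of "step_value l" v X "CARD('n)"] spread_steps
      by (simp add: left_diff_distrib right_diff_distrib sum_subtractf mult.commute)
  qed
  moreover have "(\<lambda>X. \<Sum>k\<le>?n. (matpow X (?n - k) *v v) $ i * fps_nth (spread l - char_fps X) k)
      \<in> kostant_ideal l"
    by (intro kostant_ideal_sum kostant_ideal_mult matpow_vector_poly coefficient_in_ideal) auto
  ultimately show ?thesis by simp
qed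

text \<open>Each column is sent to its multiple by \<open>l j\<close> plus the next Krylov vector.
  Only the column of rank 0 has no successor in the matrix, and the error there is the n-th
  vector.\<close>

lemma krylov_step:
  "(X ** krylov l v X - krylov l v X ** bidiagonal l) $ i $ j =
     (if r j = 0 then kry (step_value l) v X CARD('n) $ i else 0)"
proof -
  let ?k = "CARD('n) - 1 - r j" and ?u = "kry (step_value l) v X"
  have "step_value l ?k = l j"
    using r_less[of j] by (simp add: step_value_def less_Suc_eq_le[symmetric])
  then have 1: "(X ** krylov l v X) $ i $ j = ?u (Suc ?k) $ i + l j * ?u ?k $ i"
    by (simp add: matrix_matrix_mult_def matrix_vector_mult_def krylov_def)
  have "(krylov l v X ** bidiagonal l) $ i $ j =
      (\<Sum>a\<in>UNIV. if a = j then ?u ?k $ i * l j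
         else if r j = Suc (r a) then ?u (Suc ?k) $ i else 0)"
    unfolding matrix_matrix_mult_def krylov_def bidiagonal_def using r_less[of j]
    by (auto intro!: sum.cong simp: Suc_diff_Suc)
  also have "\<dots> = (\<Sum>a\<in>UNIV. (if a = j then ?u ?k $ i * l j else 0)
      + (if r j = Suc (r a) then ?u (Suc ?k) $ i else 0))"
    by (rule sum.cong) auto
  also have "\<dots> = l j * ?u ?k $ i + (\<Sum>a\<in>UNIV. if r j = Suc (r a) then ?u (Suc ?k) $ i else 0)"
    by (simp add: sum.distrib)
  also have "(\<Sum>a\<in>UNIV. if r j = Suc (r a) then ?u (Suc ?k) $ i else 0) =
      (if r j = 0 then 0 else ?u (Suc ?k) $ i)"
  proof (cases "r j")
    case (Suc m)
    have "m < CARD('n)" using r_less[of j] Suc by simp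
    then have "r j = Suc (r a) \<longleftrightarrow> a = at_rank m" for a
      using Suc r_at_rank[of m] by auto
    then show ?thesis using Suc by simp
  qed simp
  finally have 2: "(krylov l v X ** bidiagonal l) $ i $ j =
      l j * ?u ?k $ i + (if r j = 0 then 0 else ?u (Suc ?k) $ i)" .
  show ?thesis
  proof (cases "r j = 0")
    case True
    then have "Suc ?k = CARD('n)" by simp
    then show ?thesis using 1 2 True by (simp del: kry.simps)
  qed (use 1 2 in \<open>simp del: kry.simps\<close>)
qed

lemma krylov_conj:
  assumes "char_fps X = spread l" shows "X ** krylov l v X = krylov l v X ** bidiagonal l"
proof -
  have "kry (step_value l) v X CARD('n) $ i = 0" for i
    using kostant_ideal_vanish[OF kry_last_in_ideal assms] .
  then have "(X ** krylov l v X - krylov l v X ** bidiagonal l) $ i $ j = 0" for i j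
    unfolding krylov_step by simp
  then show ?thesis by (simp add: vec_eq_iff)
qed

lemma krylov_poly: "(\<lambda>X. krylov l v X $ i $ j) \<in> matrix_polys"
  unfolding krylov_def by (simp add: kry_poly)

lemma det_krylov_poly: "(\<lambda>X. det (krylov l v X)) \<in> matrix_polys"
  by (intro generated_algebra_det krylov_poly)

text \<open>\<open>R\<close> is the numerator of \<open>P\<close> over a power of the Krylov
  determinant. The congruence concerns the fibre, but the last clause holds for every
  \<open>X\<close> with nonzero determinant; thus information on one orbit determines
  \<open>R\<close> everywhere.\<close>

definition expands ::
    "('n \<Rightarrow> complex) \<Rightarrow> complex^'n \<Rightarrow> (complex^'n^'n \<Rightarrow> complex) \<Rightarrow> nat \<Rightarrow> (complex^'n^'n \<Rightarrow> complex) \<Rightarrow> bool"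
  where "expands l v P m R \<longleftrightarrow>
     R \<in> matrix_polys \<and> (\<lambda>X. det (krylov l v X) ^ m * P X - R X) \<in> kostant_ideal l \<and>
     (\<forall>X. det (krylov l v X) \<noteq> 0 \<longrightarrow>
        R X = det (krylov l v X) ^ m * P (krylov l v X ** bidiagonal l ** matrix_inv (krylov l v X)))"

text \<open>For a single entry, multiply the defect of \<open>krylov_step\<close> by the adjugate of
  the Krylov matrix. Sums and products then follow by taking common denominators.\<close>

lemma krylov_expansion:
  assumes "P \<in> matrix_polys"
  shows "\<exists>m R. expands l v P m R"
  using assms
proof induction
  case (const c)
  have "expands l v (\<lambda>_. c) 0 (\<lambda>_. c)"
    by (simp add: expands_def kostant_ideal_zero generated_algebra.const)
  then show ?case by blast
next
  case (base f)
  then obtain i j where f: "f = (\<lambda>X. X $ i $ j)" by (auto simp: mat_coords_def)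
  let ?U = "krylov l v"
  let ?R = "\<lambda>X. (?U X ** bidiagonal l ** adjugate (?U X)) $ i $ j"
  have UA: "?U X ** adjugate (?U X) = mat (det (?U X))" for X by (rule matrix_mult_adjugate)
  have "det (?U X) * f X - ?R X =
      (\<Sum>k\<in>UNIV. adjugate (?U X) $ k $ j * (X ** ?U X - ?U X ** bidiagonal l) $ i $ k)" for X
  proof -
    have "(X ** ?U X - ?U X ** bidiagonal l) ** adjugate (?U X) =
        mat (det (?U X)) ** X - ?U X ** bidiagonal l ** adjugate (?U X)"
      by (simp add: matrix_diff_rdistrib UA mat_commute flip: matrix_mul_assoc)
    then have "((X ** ?U X - ?U X ** bidiagonal l) ** adjugate (?U X)) $ i $ j =
        det (?U X) * X $ i $ j - ?R X"
      by (simp add: mat_mult_entry)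
    then show ?thesis by (simp add: f matrix_matrix_mult_def[of "_ - _"] mult.commute)
  qed
  moreover have "(\<lambda>X. \<Sum>k\<in>UNIV. adjugate (?U X) $ k $ j * (X ** ?U X - ?U X ** bidiagonal l) $ i $ k)
      \<in> kostant_ideal l"
    unfolding krylov_step
  proof (intro kostant_ideal_sum kostant_ideal_mult generated_algebra_adjugate krylov_poly)
    fix k show "(\<lambda>X. if r k = 0 then kry (step_value l) v X CARD('n) $ i else 0) \<in> kostant_ideal l"
      by (cases "r k = 0") (auto intro: kry_last_in_ideal kostant_ideal_zero)
  qed
  ultimately have 1: "(\<lambda>X. det (?U X) ^ 1 * f X - ?R X) \<in> kostant_ideal l" by simp
  have 2: "?R \<in> matrix_polys"
    by (intro generated_algebra_matrix_mult generated_algebra_adjugate krylov_poly generated_algebra.const)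
  have 3: "?R X = det (?U X) ^ 1 * f (?U X ** bidiagonal l ** matrix_inv (?U X))"
    if "det (?U X) \<noteq> 0" for X
  proof -
    have "adjugate (?U X) = matrix_inv (?U X) ** (?U X ** adjugate (?U X))"
      using that by (simp add: matrix_mul_assoc matrix_inv_det)
    then have "adjugate (?U X) = mat (det (?U X)) ** matrix_inv (?U X)"
      by (simp add: UA mat_commute)
    then have "?U X ** bidiagonal l ** adjugate (?U X) =
        (?U X ** bidiagonal l ** mat (det (?U X))) ** matrix_inv (?U X)"
      by (simp add: matrix_mul_assoc)
    also have "\<dots> = mat (det (?U X)) ** (?U X ** bidiagonal l ** matrix_inv (?U X))"
      by (simp only: mat_commute[symmetric] matrix_mul_assoc)
    finally show ?thesis
      by (simp add: f mat_mult_entry)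
  qed
  have "expands l v f 1 ?R" unfolding expands_def using 1 2 3 by simp
  then show ?case by blast
next
  case (add f g)
  let ?D = "\<lambda>X. det (krylov l v X)"
  let ?Y = "\<lambda>X. krylov l v X ** bidiagonal l ** matrix_inv (krylov l v X)"
  obtain m R where R: "expands l v f m R" using add.IH(1) by blast
  obtain k S where S: "expands l v g k S" using add.IH(2) by blast
  note R = R[unfolded expands_def, THEN conjunct1] R[unfolded expands_def, THEN conjunct2, THEN conjunct1]
    R[unfolded expands_def, THEN conjunct2, THEN conjunct2, rule_format]
  note S = S[unfolded expands_def, THEN conjunct1] S[unfolded expands_def, THEN conjunct2, THEN conjunct1]
    S[unfolded expands_def, THEN conjunct2, THEN conjunct2, rule_format]
  let ?T = "\<lambda>X. ?D X ^ k * R X + ?D X ^ m * S X"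
  have "(\<lambda>X. ?D X ^ k * (?D X ^ m * f X - R X) + ?D X ^ m * (?D X ^ k * g X - S X)) \<in> kostant_ideal l"
    by (intro kostant_ideal_add kostant_ideal_mult R(2) S(2) generated_algebra_power det_krylov_poly)
  then have 1: "(\<lambda>X. ?D X ^ (m + k) * (f X + g X) - ?T X) \<in> kostant_ideal l"
    by (simp add: algebra_simps power_add)
  have 2: "?T \<in> matrix_polys"
    by (intro generated_algebra_intros det_krylov_poly R(1) S(1))
  have 3: "?T X = ?D X ^ (m + k) * (f (?Y X) + g (?Y X))" if "?D X \<noteq> 0" for X
    using R(3)[OF that] S(3)[OF that] by (simp add: algebra_simps power_add)
  have "expands l v (\<lambda>X. f X + g X) (m + k) ?T" unfolding expands_def using 1 2 3 by simp
  then show ?case by blast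
next
  case (mult f g)
  let ?D = "\<lambda>X. det (krylov l v X)"
  let ?Y = "\<lambda>X. krylov l v X ** bidiagonal l ** matrix_inv (krylov l v X)"
  obtain m R where R: "expands l v f m R" using mult.IH(1) by blast
  obtain k S where S: "expands l v g k S" using mult.IH(2) by blast
  note R = R[unfolded expands_def, THEN conjunct1] R[unfolded expands_def, THEN conjunct2, THEN conjunct1]
    R[unfolded expands_def, THEN conjunct2, THEN conjunct2, rule_format]
  note S = S[unfolded expands_def, THEN conjunct1] S[unfolded expands_def, THEN conjunct2, THEN conjunct1]
    S[unfolded expands_def, THEN conjunct2, THEN conjunct2, rule_format]
  let ?T = "\<lambda>X. R X * S X"
  have "(\<lambda>X. (?D X ^ k * g X) * (?D X ^ m * f X - R X) + R X * (?D X ^ k * g X - S X)) \<in> kostant_ideal l"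
    by (intro kostant_ideal_add kostant_ideal_mult R S generated_algebra_intros det_krylov_poly mult.hyps)
  then have 1: "(\<lambda>X. ?D X ^ (m + k) * (f X * g X) - ?T X) \<in> kostant_ideal l"
    by (simp add: algebra_simps power_add)
  have 2: "?T \<in> matrix_polys"
    by (intro generated_algebra_intros R(1) S(1))
  have 3: "?T X = ?D X ^ (m + k) * (f (?Y X) * g (?Y X))" if "?D X \<noteq> 0" for X
    using R(3)[OF that] S(3)[OF that] by (simp add: algebra_simps power_add)
  have "expands l v (\<lambda>X. f X * g X) (m + k) ?T" unfolding expands_def using 1 2 3 by simp
  then show ?case by blast
qed

section \<open>The two Krylov minors as a regular sequence\<close>

definition first_index :: 'n where "first_index = at_rank 0"
definition last_index :: 'n where "last_index = at_rank (CARD('n) - 1)"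

lemma r_first: "r first_index = 0" and r_last: "r last_index = CARD('n) - 1"
  by (simp_all add: first_index_def last_index_def r_at_rank)

definition height :: "bool \<Rightarrow> 'n \<Rightarrow> nat" where
  "height b = (if b then r else (\<lambda>i. CARD('n) - 1 - r i))"

definition start :: "bool \<Rightarrow> 'n" where "start b = (if b then first_index else last_index)"

lemma height_cases: "height b = r \<or> height b = (\<lambda>i. CARD('n) - 1 - r i)"
  by (simp add: height_def)

lemma height_start: "height b (start b) = 0"
  by (simp add: height_def start_def r_first r_last)

text \<open>\<open>True\<close> starts at the first basis vector and has its leading monomial below
  the diagonal; \<open>False\<close> starts at the last one and has it above.\<close>

definition minor :: "('n \<Rightarrow> complex) \<Rightarrow> bool \<Rightarrow> complex^'n^'n \<Rightarrow> complex" where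
  "minor l b = krylov_det (height b) (step_value l) (start b)"

lemma leading_minor: "leading wt (minor l b) (path_total (height b))"
  unfolding minor_def by (rule leading_krylov_det[OF height_cases height_start])

lemma minor_poly: "minor l b \<in> matrix_polys"
  using leading_minor by (rule leading_poly)

text \<open>The columns of the two determinants are the same up to a reversal of their order.\<close>

lemma det_krylov_minor:
  obtains \<sigma> where "\<sigma> \<noteq> 0" "\<And>X. det (krylov l (axis (start b) 1) X) = \<sigma> * minor l b X"
proof (cases b)
  case False
  then have "det (krylov l (axis (start b) 1) X) = minor l b X" for X
    unfolding krylov_def minor_def krylov_det_def[OF height_cases] by (simp add: height_def)
  then show ?thesis using that[of 1] by simp
next
  case True
  let ?p = "\<lambda>j. at_rank (CARD('n) - 1 - r j)"
  have "CARD('n) - 1 - r j < CARD('n)" for j by (simp add: less_imp_diff_less)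
  then have rp: "r (?p j) = CARD('n) - 1 - r j" for j by (rule r_at_rank)
  have "?p (?p j) = j" for j
    using r_less[of j] unfolding rp by (simp add: less_Suc_eq_le[symmetric])
  then have perm: "?p permutes UNIV"
    by (intro bij_imp_permutes bij_betw_byWitness[where f' = ?p]) auto
  have "krylov l (axis (start b) 1) X =
      (\<chi> i j. (\<chi> i j. kry (step_value l) (axis (start b) 1) X (height b j) $ i) $ i $ ?p j)" for X
    using True unfolding vec_eq_iff krylov_def height_def by (simp add: rp[simplified])
  then have "det (krylov l (axis (start b) 1) X) = of_int (sign ?p) * minor l b X" for X
    unfolding minor_def krylov_det_def[OF height_cases] using det_permute_columns[OF perm] by metis
  then show ?thesis using that[of "of_int (sign ?p)"] by (simp add: sign_def)
qed

text \<open>The minors enter with a power because the pole order of the fractions is arbitrary;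
  powers do not affect coprimality.\<close>

definition gens :: "('n \<Rightarrow> complex) \<Rightarrow> nat \<Rightarrow> 'n + bool \<Rightarrow> complex^'n^'n \<Rightarrow> complex" where
  "gens l m k = (case k of Inl i \<Rightarrow> divdiff l i | Inr b \<Rightarrow> (\<lambda>X. minor l b X ^ m))"

lemma coprime_gens:
  assumes "1 < CARD('n)" "0 < m"
  shows "coprime_leading wt UNIV (gens l m)
    (\<lambda>k. case k of Inl i \<Rightarrow> (\<lambda>v. if v = (i, i) then CARD('n) - r i else 0)
                 | Inr b \<Rightarrow> (\<lambda>v. m * path_total (height b) v))"
    (is "coprime_leading wt UNIV _ ?e")
proof
  show "finite (UNIV :: ('n + bool) set)" by simp
next
  fix k :: "'n + bool"
  show "leading wt (gens l m k) (?e k)"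
    by (cases k) (auto simp: gens_def intro: leading_divdiff leading_power leading_minor)
  show "\<exists>v. ?e k v \<noteq> 0"
  proof (cases k)
    case (Inl i)
    then show ?thesis using r_less[of i] by (auto intro!: exI[of _ "(i, i)"])
  next
    case (Inr b)
    then show ?thesis using path_total_nonzero[OF height_cases assms(1), of b] assms(2) by auto
  qed
next
  fix j k :: "'n + bool" and v
  assume "j \<noteq> k"
  have off: "path_total (height b) v \<noteq> 0 \<Longrightarrow> height b (fst v) = Suc (height b (snd v))" for b
    by (rule path_total_support[OF height_cases])
  have diag: "?e (Inl i) v = 0 \<or> ?e (Inr b) v = 0" for i b
    using off[of b] by (cases "v = (i, i)") auto
  have opposite: "?e (Inr True) v = 0 \<or> ?e (Inr False) v = 0"
  proof (rule ccontr)
    assume "\<not> ?thesis"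
    then have "height True (fst v) = Suc (height True (snd v))"
      "height False (fst v) = Suc (height False (snd v))" using off by auto
    then show False by (simp add: height_def)
  qed
  show "?e j v = 0 \<or> ?e k v = 0"
  proof (cases j; cases k)
    fix i i' assume "j = Inl i" "k = Inl i'"
    then show ?thesis using \<open>j \<noteq> k\<close> by auto
  next
    fix b b' assume jk: "j = Inr b" "k = Inr b'"
    show ?thesis using \<open>j \<noteq> k\<close> opposite unfolding jk by (cases b; cases b') auto
  next
    fix i b assume jk: "j = Inl i" "k = Inr b"
    show ?thesis unfolding jk by (rule diag)
  next
    fix i b assume jk: "j = Inr b" "k = Inl i"
    show ?thesis unfolding jk using diag by (rule disj_commute[THEN iffD1])
  qed
qed

lemma gens_ideal: "gen_ideal (gens l m) (range Inl) = kostant_ideal l"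
proof -
  have sum: "(\<Sum>k\<in>range Inl. a k X * gens l m k X) = (\<Sum>i\<in>UNIV. a (Inl i) X * divdiff l i X)" for a X
    by (subst sum.reindex) (auto simp: gens_def)
  show ?thesis
  proof
    show "gen_ideal (gens l m) (range Inl) \<subseteq> kostant_ideal l"
      unfolding kostant_ideal_def gen_ideal_def sum by auto
    show "kostant_ideal l \<subseteq> gen_ideal (gens l m) (range Inl)"
    proof
      fix f assume "f \<in> kostant_ideal l"
      then obtain a where a: "f = (\<lambda>X. \<Sum>i\<in>UNIV. a i X * divdiff l i X)" "\<forall>i. a i \<in> matrix_polys"
        by (auto simp: kostant_ideal_def gen_ideal_def)
      then show "f \<in> gen_ideal (gens l m) (range Inl)"
        unfolding gen_ideal_def sum
        by (intro CollectI exI[of _ "\<lambda>k. case k of Inl i \<Rightarrow> a i | Inr b \<Rightarrow> a undefined"]) auto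
    qed
  qed
qed

lemma minor_one: "CARD('n) = 1 \<Longrightarrow> minor l b X = 1"
  unfolding minor_def by (rule krylov_det_one[OF height_cases height_start])

lemma card_cases: "CARD('n) = 1 \<or> 1 < CARD('n)"
  using zero_less_card_finite[where 'a = 'n] by linarith

text \<open>The \<open>Inl\<close> members of the regular family generate the ideal, and the power
  of the minor is a further member. If it is constant, for n = 1 or \<open>m = 0\<close>, the claim
  is immediate.\<close>

lemma minor_nonzerodivisor:
  assumes "a \<in> matrix_polys" "(\<lambda>X. minor l b X ^ m * a X) \<in> kostant_ideal l"
  shows "a \<in> kostant_ideal l"
proof (cases "CARD('n) = 1 \<or> m = 0")
  case True
  then show ?thesis using assms(2) by (auto simp: minor_one)
next
  case False
  then interpret coprime_leading wt UNIV "gens l m"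
    "\<lambda>k. case k of Inl i \<Rightarrow> (\<lambda>v. if v = (i, i) then CARD('n) - r i else 0)
                 | Inr b \<Rightarrow> (\<lambda>v. m * path_total (height b) v)"
    using card_cases by (intro coprime_gens) auto
  show ?thesis
    using nonzerodivisor[of "Inr b" "range Inl" a] assms by (simp add: gens_ideal gens_def image_iff)
qed

text \<open>Removal of the pole: modulo the ideal enlarged by the power of one minor, the power of
  the other is still a nonzerodivisor, so \<open>p\<close> itself lies in the enlarged ideal and its
  cofactor is \<open>h\<close>.\<close>

lemma minor_regular:
  assumes "p \<in> matrix_polys" "q \<in> matrix_polys"
    and pq: "(\<lambda>X. minor l (\<not> b) X ^ m * p X - minor l b X ^ m * q X) \<in> kostant_ideal l"
  shows "\<exists>h\<in>matrix_polys. (\<lambda>X. p X - minor l b X ^ m * h X) \<in> kostant_ideal l"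
proof (cases "CARD('n) = 1 \<or> m = 0")
  case True
  then have "(\<lambda>X. p X - minor l b X ^ m * p X) = (\<lambda>X. 0)" by (auto simp: minor_one)
  then show ?thesis by (intro bexI[OF _ assms(1)]) (simp add: kostant_ideal_zero)
next
  case False
  then interpret coprime_leading wt UNIV "gens l m"
    "\<lambda>k. case k of Inl i \<Rightarrow> (\<lambda>v. if v = (i, i) then CARD('n) - r i else 0)
                 | Inr b' \<Rightarrow> (\<lambda>v. m * path_total (height b') v)"
    using card_cases by (intro coprime_gens) auto
  let ?J = "insert (Inr b) (range Inl)"
  have sub: "kostant_ideal l \<subseteq> gen_ideal (gens l m) ?J"
    unfolding gens_ideal[symmetric, of l m] by (rule gen_ideal_mono) auto
  have "(\<lambda>X. q X * gens l m (Inr b) X) \<in> gen_ideal (gens l m) ?J"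
    by (intro gen_ideal_mult assms(2) gen_ideal_generator) auto
  from gen_ideal_add[OF subsetD[OF sub pq] this]
  have *: "(\<lambda>X. gens l m (Inr (\<not> b)) X * p X) \<in> gen_ideal (gens l m) ?J"
    by (simp add: gens_def mult.commute)
  have "p \<in> gen_ideal (gens l m) ?J"
    by (rule nonzerodivisor[OF _ _ _ assms(1) *]) auto
  then obtain a where a: "p = (\<lambda>X. \<Sum>k\<in>?J. a k X * gens l m k X)" "\<forall>k\<in>?J. a k \<in> matrix_polys"
    by (auto simp: gen_ideal_def)
  have "(\<lambda>X. p X - minor l b X ^ m * a (Inr b) X) = (\<lambda>X. \<Sum>k\<in>range Inl. a k X * gens l m k X)"
    unfolding a(1) by (subst sum.insert) (auto simp: gens_def mult.commute)
  also have "\<dots> \<in> kostant_ideal l"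
    unfolding gens_ideal[symmetric, of l m] gen_ideal_def using a(2) by blast
  finally show ?thesis using a(2) by blast
qed

text \<open>The conjugates of the bidiagonal matrix are dense in the fibre of the characteristic series.\<close>

lemma vanish_on_orbit:
  assumes "P \<in> matrix_polys" and orbit: "\<And>g. det g = 1 \<Longrightarrow> P (g ** bidiagonal l ** matrix_inv g) = 0"
  shows "P \<in> kostant_ideal l"
proof -
  obtain \<sigma> where \<sigma>: "\<sigma> \<noteq> 0" "\<And>X. det (krylov l (axis (start True) 1) X) = \<sigma> * minor l True X"
    using det_krylov_minor[of l True] by metis
  let ?U = "krylov l (axis (start True) 1)" and ?D = "\<lambda>X. minor l True X"
  obtain m R where R: "expands l (axis (start True) 1) P m R"
    using krylov_expansion[OF assms(1), of l] by blast
  note R = R[unfolded expands_def, THEN conjunct1] R[unfolded expands_def, THEN conjunct2, THEN conjunct1]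
    R[unfolded expands_def, THEN conjunct2, THEN conjunct2, rule_format]
  \<comment> \<open>For every \<open>X\<close> with nonzero Krylov determinant, on the fibre or not,
    \<open>R X\<close> is a multiple of the value of \<open>P\<close> at a conjugate of the
    bidiagonal matrix; \<open>scale_det\<close> makes the conjugating matrix unimodular.\<close>
  have "det (?U X) * R X = 0" for X
  proof (cases "det (?U X) = 0")
    case False
    from scale_det[OF False] obtain h where "det h = 1"
      "\<And>Y. h ** Y ** matrix_inv h = ?U X ** Y ** matrix_inv (?U X)" by metis
    then have "P (?U X ** bidiagonal l ** matrix_inv (?U X)) = 0" using orbit by metis
    then show ?thesis using R(3)[OF False] by simp
  qed simp
  then have eq: "det (?U X) * (det (?U X) ^ m * P X - R X) = det (?U X) ^ Suc m * P X" for X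
    by (simp only: right_diff_distrib power_Suc mult.assoc diff_zero)
  have "(\<lambda>X. det (?U X) * (det (?U X) ^ m * P X - R X)) \<in> kostant_ideal l"
    by (intro kostant_ideal_mult R(2) det_krylov_poly)
  then have "(\<lambda>X. det (?U X) ^ Suc m * P X) \<in> kostant_ideal l"
    by (simp only: eq)
  from kostant_ideal_mult[OF generated_algebra.const[of "inverse \<sigma> ^ Suc m"] this]
  have "(\<lambda>X. ?D X ^ Suc m * P X) \<in> kostant_ideal l"
    using \<sigma>(1) by (simp add: \<sigma>(2) power_mult_distrib field_simps)
  then show ?thesis by (rule minor_nonzerodivisor[OF assms(1)])
qed

end


section \<open>Invariant functions are polynomials in the conjugate\<close>

lemma generated_algebra_univariate:
  assumes "f \<in> generated_algebra {\<lambda>s. s}"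
  obtains p where "f = poly p"
proof -
  have "\<exists>p. f = poly p" using assms
  proof induction
    case (const c)
    show ?case by (rule exI[of _ "[:c:]"]) (simp add: fun_eq_iff)
  next
    case (base f)
    then show ?case by (intro exI[of _ "[:0, 1:]"]) (auto simp: fun_eq_iff)
  next
    case (add f g)
    then obtain p q where "f = poly p" "g = poly q" by blast
    then show ?case by (intro exI[of _ "p + q"]) (auto simp: fun_eq_iff)
  next
    case (mult f g)
    then obtain p q where "f = poly p" "g = poly q" by blast
    then show ?case by (intro exI[of _ "p * q"]) (auto simp: fun_eq_iff)
  qed
  then show ?thesis using that by blast
qed

lemma pair_coords_poly:
  fixes i j :: "'n::finite"
  shows "(\<lambda>z. fst z $ i $ j) \<in> generated_algebra pair_coords"
    and "(\<lambda>z. snd z $ i $ j) \<in> generated_algebra pair_coords"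
proof -
  have X: "(\<lambda>X. X $ i $ j) \<in> mat_coords" by (auto simp: mat_coords_def)
  have "(\<lambda>X. X $ i $ j) \<circ> fst \<in> generated_algebra pair_coords"
    unfolding pair_coords_def using X by (intro generated_algebra.base UnI1 imageI)
  then show "(\<lambda>z. fst z $ i $ j) \<in> generated_algebra pair_coords" by (simp add: o_def)
  have "(\<lambda>X. X $ i $ j) \<circ> snd \<in> generated_algebra pair_coords"
    unfolding pair_coords_def using X by (intro generated_algebra.base UnI2 imageI)
  then show "(\<lambda>z. snd z $ i $ j) \<in> generated_algebra pair_coords" by (simp add: o_def)
qed

lemma matrix_mult_entry: "(A ** B) $ i $ j = (\<Sum>k\<in>UNIV. A $ i $ k * B $ k $ j)"
  by (simp add: matrix_matrix_mult_def)

definition diagonal :: "('n \<Rightarrow> 'a::comm_ring_1) \<Rightarrow> 'a^'n^'n" where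
  "diagonal d = (\<chi> i j. if i = j then d i else 0)"

lemma diagonal_mult:
  "(diagonal d ** A) $ i $ j = d i * A $ i $ j" "(A ** diagonal d) $ i $ j = A $ i $ j * d j"
  by (simp_all add: diagonal_def matrix_mult_entry if_distrib[of "\<lambda>x. x * _"]
      if_distrib[of "\<lambda>x. _ * x"] cong: if_cong)

lemma det_diagonal_prod: "det (diagonal d) = (\<Prod>i\<in>UNIV. d i)"
  by (subst det_diagonal) (auto simp: diagonal_def)

section \<open>Triangular matrices, the slice, and descent of invariants\<close>

context ranking
begin

definition upper :: "complex^'n^'n \<Rightarrow> bool" where
  "upper A \<longleftrightarrow> (\<forall>i j. r j < r i \<longrightarrow> A $ i $ j = 0)"

definition slice :: "('n \<Rightarrow> complex) \<Rightarrow> (complex^'n^'n) set" where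
  "slice l = {Y. upper Y \<and> (\<forall>i. Y $ i $ i = l i)}"

lemma rank_cases: obtains "i = j" | "r i < r j" | "r j < r i"
proof (cases "r i" "r j" rule: linorder_cases)
  case equal
  then have "i = j" by simp
  then show ?thesis by (rule that(1))
qed (rule that(2) that(3), assumption)+

lemma upper_mult:
  assumes "upper A" "upper B" shows "upper (A ** B)"
  unfolding upper_def
proof (intro allI impI)
  fix i j assume ij: "r j < r i"
  have "A $ i $ k * B $ k $ j = 0" for k
    using assms ij by (cases rule: rank_cases[of i k]) (auto simp: upper_def)
  then show "(A ** B) $ i $ j = 0" unfolding matrix_mult_entry by (intro sum.neutral ballI)
qed

lemma upper_mult_diag:
  assumes "upper A" "upper B" shows "(A ** B) $ i $ i = A $ i $ i * B $ i $ i"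
proof -
  have "A $ i $ k * B $ k $ i = (if k = i then A $ i $ i * B $ i $ i else 0)" for k
    using assms by (cases rule: rank_cases[of i k]) (auto simp: upper_def)
  then have "(A ** B) $ i $ i = (\<Sum>k\<in>UNIV. if k = i then A $ i $ i * B $ i $ i else 0)"
    unfolding matrix_mult_entry by (intro sum.cong refl)
  then show ?thesis by simp
qed

lemma upper_det: "upper A \<Longrightarrow> det A = (\<Prod>i\<in>UNIV. A $ i $ i)"
  by (rule det_upper_triangular[OF inj_r]) (simp add: upper_def)

text \<open>Back substitution in \<open>A ** matrix_inv A = mat 1\<close>, from the last row
  upwards; the diagonal entries of \<open>A\<close> are nonzero because their product is the
  determinant.\<close>

lemma upper_inverse:
  assumes "upper A" "det A \<noteq> 0" shows "upper (matrix_inv A)"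
proof -
  have diag: "A $ i $ i \<noteq> 0" for i using assms by (simp add: upper_det)
  have "matrix_inv A $ i $ j = 0" if "r j < r i" for i j
    using that
  proof (induction "CARD('n) - r i" arbitrary: i rule: less_induct)
    case less
    have "(A ** matrix_inv A) $ i $ j = (\<Sum>k\<in>UNIV. if k = i then A $ i $ i * matrix_inv A $ i $ j else 0)"
      unfolding matrix_mult_entry
    proof (intro sum.cong refl)
      fix k
      show "A $ i $ k * matrix_inv A $ k $ j = (if k = i then A $ i $ i * matrix_inv A $ i $ j else 0)"
      proof (cases "r i < r k")
        case True
        then have "matrix_inv A $ k $ j = 0"
          using less.prems r_less[of k] by (intro less.hyps) auto
        then show ?thesis using True by auto
      next
        case False
        then show ?thesis using assms(1) by (cases rule: rank_cases[of i k]) (auto simp: upper_def)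
      qed
    qed
    moreover have "(A ** matrix_inv A) $ i $ j = 0"
      using less.prems assms(2) by (auto simp: matrix_inv_det mat_def)
    ultimately show ?case using diag by simp
  qed
  then show ?thesis by (simp add: upper_def)
qed

lemma bidiagonal_slice: "bidiagonal l \<in> slice l"
  by (auto simp: slice_def upper_def bidiagonal_def)

lemma char_fps_slice:
  assumes "Y \<in> slice l" shows "char_fps Y = spread l"
proof -
  have "det (char_matrix Y) = (\<Prod>i\<in>UNIV. char_matrix Y $ i $ i)"
    by (rule det_upper_triangular[OF inj_r])
      (use assms in \<open>auto simp: char_matrix_def slice_def upper_def\<close>)
  then show ?thesis using assms by (simp add: char_fps_def spread_def char_matrix_def slice_def)
qed

lemma char_fps_conj_slice:
  "Y \<in> slice l \<Longrightarrow> det g \<noteq> 0 \<Longrightarrow> char_fps (g ** Y ** matrix_inv g) = spread l"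
  by (simp add: char_fps_conj char_fps_slice)

text \<open>After \<open>k\<close> steps the highest possibly nonzero coordinate has rank
  \<open>n - 1 - k\<close>, and the value subtracted next is the diagonal entry there, so each step
  removes one more coordinate.\<close>

lemma kry_slice:
  assumes "Y \<in> slice l" "k < CARD('n)" "CARD('n) - 1 - k < r i"
  shows "kry (step_value l) w Y k $ i = 0"
  using assms(2,3)
proof (induction k arbitrary: i)
  case 0
  then show ?case using r_less[of i] by simp
next
  case (Suc k)
  let ?u = "kry (step_value l) w Y k"
  have IH: "CARD('n) - 1 - k < r j \<Longrightarrow> ?u $ j = 0" for j using Suc by simp
  have "Y $ i $ j * ?u $ j = (if j = i then step_value l k * ?u $ i else 0)" for j
  proof (cases "j = i")
    case True
    show ?thesis
    proof (cases "CARD('n) - 1 - k < r i")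
      case False
      then have "r i = CARD('n) - 1 - k" using Suc.prems by linarith
      then have "step_value l k = l i" unfolding step_value_def by (metis at_rank_r)
      then show ?thesis using True assms(1) by (simp add: slice_def)
    qed (use IH True in simp)
  next
    case False
    then consider "r j < r i" | "r i < r j" by (metis linorder_neqE_nat r_eq_iff)
    then show ?thesis
    proof cases
      case 1
      then show ?thesis using assms(1) False by (simp add: slice_def upper_def)
    next
      case 2
      then have "?u $ j = 0" using Suc.prems by (intro IH) linarith
      then show ?thesis using False by simp
    qed
  qed
  then have "(Y *v ?u) $ i = step_value l k * ?u $ i"
    by (simp add: matrix_vector_mult_def)
  then show ?case by simp
qed

lemma krylov_slice:
  assumes "Y \<in> slice l" shows "upper (krylov l w Y)"
  unfolding upper_def
proof (intro allI impI)
  fix i j assume "r j < r i"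
  then have "CARD('n) - 1 - r j < CARD('n)" "CARD('n) - 1 - (CARD('n) - 1 - r j) < r i"
    using r_less[of j] by linarith+
  from kry_slice[OF assms this] show "krylov l w Y $ i $ j = 0" by (simp add: krylov_def)
qed

lemma krylov_equivariant:
  assumes "det g \<noteq> 0"
  shows "krylov l (g *v w) (g ** Y ** matrix_inv g) = g ** krylov l w Y"
proof -
  have "kry \<mu> (g *v w) (g ** Y ** matrix_inv g) k = g *v kry \<mu> w Y k" for \<mu> k
  proof (induction k)
    case (Suc k)
    have "(g ** Y ** matrix_inv g) *v (g *v kry \<mu> w Y k) = (g ** Y ** (matrix_inv g ** g)) *v kry \<mu> w Y k"
      by (simp add: matrix_vector_mul_assoc matrix_mul_assoc)
    then show ?case using assms
      by (simp add: Suc matrix_inv_det matrix_vector_mult_diff_distrib vector_scalar_commute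
          matrix_vector_mul_assoc)
  qed simp
  then show ?thesis
    by (simp add: krylov_def vec_eq_iff matrix_matrix_mult_def matrix_vector_mult_def)
qed

text \<open>
  Over a matrix with a cyclic vector the Borel subgroup acts simply transitively: the columns of
  \<open>krylov\<close> are adapted to the flag, so an element intertwining two matrices of the slice
  preserves the flag.
\<close>

lemma cyclic_transitive:
  assumes "det g = 1" "det g' = 1" "Y \<in> slice l" "Y' \<in> slice l"
    and eq: "g ** Y ** matrix_inv g = g' ** Y' ** matrix_inv g'"
    and cyclic: "det (krylov l v (g ** Y ** matrix_inv g)) \<noteq> 0"
  obtains b where "det b = 1" "upper b" "g' = g ** matrix_inv b" "Y' = b ** Y ** matrix_inv b"
proof -
  let ?X = "g ** Y ** matrix_inv g"
  have transport: "matrix_inv h ** krylov l v ?X = krylov l (matrix_inv h *v v) Z"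
    if "det h = 1" "?X = h ** Z ** matrix_inv h" for h Z
  proof -
    have "krylov l (h *v (matrix_inv h *v v)) (h ** Z ** matrix_inv h) = h ** krylov l (matrix_inv h *v v) Z"
      by (rule krylov_equivariant) (simp add: that)
    moreover have "h *v (matrix_inv h *v v) = v"
      by (simp add: matrix_vector_mul_assoc matrix_inv_det that)
    ultimately have "matrix_inv h ** krylov l v ?X = matrix_inv h ** h ** krylov l (matrix_inv h *v v) Z"
      unfolding that(2) by (simp add: matrix_mul_assoc)
    then show ?thesis by (simp add: matrix_inv_det that)
  qed
  define b where "b = matrix_inv g' ** g"
  \<comment> \<open>\<open>U\<close> and \<open>b ** U\<close> are the Krylov matrices of
    \<open>Y\<close> and \<open>Y'\<close> for transported vectors, hence both triangular, and
    \<open>b\<close> is their quotient.\<close>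
  define U where "U = matrix_inv g ** krylov l v ?X"
  have det_b: "det b = 1" by (simp add: b_def det_mul det_matrix_inv assms)
  have U: "upper U" unfolding U_def using transport[OF assms(1) refl] krylov_slice[OF assms(3)] by simp
  have "b ** U = matrix_inv g' ** (g ** matrix_inv g) ** krylov l v ?X"
    by (simp add: b_def U_def matrix_mul_assoc)
  then have "b ** U = matrix_inv g' ** krylov l v ?X" by (simp add: matrix_inv_det assms)
  then have bU: "upper (b ** U)" using transport[OF assms(2) eq] krylov_slice[OF assms(4)] by simp
  have "det U \<noteq> 0" using cyclic by (simp add: U_def det_mul det_matrix_inv assms)
  then have "upper (b ** U ** matrix_inv U)" by (intro upper_mult bU upper_inverse U)
  then have "upper b"
    using \<open>det U \<noteq> 0\<close> by (simp add: matrix_inv_det flip: matrix_mul_assoc)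
  have inv_b: "matrix_inv b = matrix_inv g ** g'"
    by (simp add: b_def matrix_inv_mult det_matrix_inv assms matrix_inv_matrix_inv)
  have "g ** matrix_inv b = (g ** matrix_inv g) ** g'" by (simp add: inv_b matrix_mul_assoc)
  then have 1: "g' = g ** matrix_inv b" by (simp add: matrix_inv_det assms)
  have "b ** Y ** matrix_inv b = matrix_inv g' ** (g ** Y ** matrix_inv g) ** g'"
    by (simp add: b_def inv_b matrix_mul_assoc) (simp add: b_def inv_b[unfolded b_def] matrix_mul_assoc)
  also have "\<dots> = (matrix_inv g' ** g') ** Y' ** (matrix_inv g' ** g')"
    unfolding eq by (simp add: matrix_mul_assoc)
  finally have 2: "Y' = b ** Y ** matrix_inv b" by (simp add: matrix_inv_det assms)
  show ?thesis using that[OF det_b \<open>upper b\<close> 1 2] .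
qed

text \<open>In contrast to a root of the determinant, rescaling one column is rational in the entries.\<close>

definition unimod :: "complex^'n^'n \<Rightarrow> complex^'n^'n" where
  "unimod M = (\<chi> i j. if j = first_index then M $ i $ j / det M else M $ i $ j)"

text \<open>\<open>bidiagonal l\<close> conjugated by the inverse of the rescaling in
  \<open>unimod\<close>. The column of rank 0 has no off-diagonal entry, so only the entry to the
  right of the first diagonal entry changes; it becomes \<open>D\<close> and not its inverse, hence
  stays polynomial.\<close>

definition unimod_bidiagonal :: "('n \<Rightarrow> complex) \<Rightarrow> complex \<Rightarrow> complex^'n^'n" where
  "unimod_bidiagonal l D = (\<chi> i j. if i = j then l i
     else if r j = Suc (r i) then (if i = first_index then D else 1) else 0)"

lemma unimod_eq: "unimod M = M ** diagonal (\<lambda>j. if j = first_index then 1 / det M else 1)"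
  by (simp add: unimod_def vec_eq_iff diagonal_mult)

lemma det_unimod:
  assumes "det M \<noteq> 0" shows "det (unimod M) = 1"
  using assms by (simp add: unimod_eq det_mul det_diagonal_prod)

lemma unimod_id: "det M = 1 \<Longrightarrow> unimod M = M"
  by (simp add: unimod_def vec_eq_iff)

lemma unimod_bidiagonal_slice: "unimod_bidiagonal l D \<in> slice l"
  by (auto simp: slice_def upper_def unimod_bidiagonal_def)

lemma unimod_conj:
  assumes "det M \<noteq> 0"
  shows "unimod M ** unimod_bidiagonal l (det M) ** matrix_inv (unimod M) =
    M ** bidiagonal l ** matrix_inv M"
proof -
  let ?E = "diagonal (\<lambda>j. if j = first_index then 1 / det M else 1) :: complex^'n^'n"
  have "?E ** unimod_bidiagonal l (det M) = bidiagonal l ** ?E"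
    using assms by (auto simp: vec_eq_iff diagonal_mult unimod_bidiagonal_def bidiagonal_def r_first)
  then have "unimod M ** unimod_bidiagonal l (det M) = M ** bidiagonal l ** ?E"
    by (simp add: unimod_eq flip: matrix_mul_assoc)
  also have "\<dots> = M ** bidiagonal l ** (matrix_inv M ** M) ** ?E"
    using assms by (simp add: matrix_inv_det)
  also have "\<dots> = M ** bidiagonal l ** matrix_inv M ** unimod M"
    by (simp add: unimod_eq matrix_mul_assoc)
  finally have "unimod M ** unimod_bidiagonal l (det M) ** matrix_inv (unimod M) =
      M ** bidiagonal l ** matrix_inv M ** (unimod M ** matrix_inv (unimod M))"
    by (simp add: matrix_mul_assoc)
  then show ?thesis using det_unimod[OF assms] by (simp add: matrix_inv_det)
qed

text \<open>Denominators occur only in the rescaled column and are equal to \<open>det M\<close>, so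
  one power of it clears them all.\<close>

lemma unimod_poly:
  fixes M Y :: "'a \<Rightarrow> complex^'n^'n"
  assumes "f \<in> generated_algebra pair_coords"
    and M: "\<And>i j. (\<lambda>x. M x $ i $ j) \<in> generated_algebra C"
    and Y: "\<And>i j. (\<lambda>x. Y x $ i $ j) \<in> generated_algebra C"
  shows "\<exists>m. \<exists>q\<in>generated_algebra C. \<forall>x. det (M x) \<noteq> 0 \<longrightarrow>
    q x = det (M x) ^ m * f (unimod (M x), Y x)"
  using assms(1)
proof induction
  case (const c)
  show ?case by (rule exI[of _ 0], rule bexI[of _ "\<lambda>_. c"]) (auto intro: generated_algebra.const)
next
  case (base f)
  then obtain i j where "f = (\<lambda>X. X $ i $ j) \<circ> fst \<or> f = (\<lambda>X. X $ i $ j) \<circ> snd"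
    by (auto simp: pair_coords_def mat_coords_def)
  then show ?case
  proof
    assume 1: "f = (\<lambda>X. X $ i $ j) \<circ> fst"
    show ?thesis
    proof (cases "j = first_index")
      case True
      then show ?thesis using 1 M
        by (intro exI[of _ 1] bexI[of _ "\<lambda>x. M x $ i $ j"]) (auto simp: unimod_def)
    next
      case False
      then show ?thesis using 1 M
        by (intro exI[of _ 0] bexI[of _ "\<lambda>x. M x $ i $ j"]) (auto simp: unimod_def)
    qed
  next
    assume 2: "f = (\<lambda>X. X $ i $ j) \<circ> snd"
    then show ?thesis using Y
      by (intro exI[of _ 0] bexI[of _ "\<lambda>x. Y x $ i $ j"]) auto
  qed
next
  case (add f g)
  obtain m q where q: "q \<in> generated_algebra C"
    "\<forall>x. det (M x) \<noteq> 0 \<longrightarrow> q x = det (M x) ^ m * f (unimod (M x), Y x)" using add.IH(1) by blast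
  obtain k p where p: "p \<in> generated_algebra C"
    "\<forall>x. det (M x) \<noteq> 0 \<longrightarrow> p x = det (M x) ^ k * g (unimod (M x), Y x)" using add.IH(2) by blast
  show ?case
    by (intro exI[of _ "m + k"] bexI[of _ "\<lambda>x. det (M x) ^ k * q x + det (M x) ^ m * p x"]
        generated_algebra_intros generated_algebra_det M q(1) p(1))
      (use p q in \<open>auto simp: power_add algebra_simps\<close>)
next
  case (mult f g)
  obtain m q where q: "q \<in> generated_algebra C"
    "\<forall>x. det (M x) \<noteq> 0 \<longrightarrow> q x = det (M x) ^ m * f (unimod (M x), Y x)" using mult.IH(1) by blast
  obtain k p where p: "p \<in> generated_algebra C"
    "\<forall>x. det (M x) \<noteq> 0 \<longrightarrow> p x = det (M x) ^ k * g (unimod (M x), Y x)" using mult.IH(2) by blast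
  show ?case
    by (intro exI[of _ "m + k"] bexI[of _ "\<lambda>x. q x * p x"] generated_algebra_intros q(1) p(1))
      (use p q in \<open>auto simp: power_add algebra_simps\<close>)
qed

lemma unimod_bidiagonal_poly:
  assumes "D \<in> generated_algebra C"
  shows "(\<lambda>x. unimod_bidiagonal l (D x) $ i $ j) \<in> generated_algebra C"
  by (cases "i = j"; cases "r j = Suc (r i)"; cases "i = first_index")
    (auto simp: unimod_bidiagonal_def intro: assms generated_algebra.const)

text \<open>The bidiagonal matrix moves the last basis vector step by step through the whole basis.
  This supplies the point at which the minor does not vanish on the slice.\<close>

lemma minor_bidiagonal: "minor l False (bidiagonal l) = 1"
proof -
  have kry: "kry (step_value l) (axis last_index 1) (bidiagonal l) k = axis (at_rank (CARD('n) - 1 - k)) 1"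
    if "k < CARD('n)" for k
    using that
  proof (induction k)
    case (Suc k)
    let ?j = "at_rank (CARD('n) - 1 - k)"
    have j: "r ?j = CARD('n) - 1 - k" "r (at_rank (CARD('n) - 1 - Suc k)) = CARD('n) - 1 - Suc k"
      by (rule r_at_rank, simp)+
    then have adj: "r ?j = Suc (r i) \<longleftrightarrow> i = at_rank (CARD('n) - 1 - Suc k)" for i
      using Suc.prems r_eq_iff[of i "at_rank (CARD('n) - 1 - Suc k)"] by auto
    have "(bidiagonal l *v axis ?j 1) $ i - step_value l k * axis ?j 1 $ i =
        (if i = at_rank (CARD('n) - 1 - Suc k) then 1 else 0)" for i
    proof (cases "i = ?j")
      case True
      then have "i \<noteq> at_rank (CARD('n) - 1 - Suc k)" using adj[of i] by auto
      then show ?thesis using True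
        by (simp add: matrix_vector_mult_def axis_def bidiagonal_def step_value_def
            if_distrib[of "\<lambda>x. _ * x"] cong: if_cong)
    next
      case False
      then show ?thesis using adj[of i]
        by (auto simp: matrix_vector_mult_def axis_def bidiagonal_def
            if_distrib[of "\<lambda>x. _ * x"] cong: if_cong)
    qed
    moreover have "kry (step_value l) (axis last_index 1) (bidiagonal l) k = axis ?j 1"
      using Suc by simp
    ultimately have "kry (step_value l) (axis last_index 1) (bidiagonal l) (Suc k) $ i =
        (if i = at_rank (CARD('n) - 1 - Suc k) then 1 else 0)" for i by simp
    then show ?case by (simp only: vec_eq_iff) (simp add: axis_def)
  qed (simp add: last_index_def)
  have "minor l False (bidiagonal l) = det (mat 1 :: complex^'n^'n)"
    unfolding minor_def krylov_det_def[OF height_cases]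
  proof (rule arg_cong[where f = det])
    have "kry (step_value l) (axis last_index 1) (bidiagonal l) (CARD('n) - 1 - r j) = axis j 1" for j
    proof -
      have "CARD('n) - 1 - (CARD('n) - 1 - r j) = r j" using r_less[of j] by linarith
      moreover have "CARD('n) - 1 - r j < CARD('n)" by (simp add: less_imp_diff_less)
      ultimately show ?thesis using kry by simp
    qed
    then show "(\<chi> i j. kry (step_value l) (axis (start False) 1) (bidiagonal l) (height False j) $ i) = mat 1"
      by (simp add: vec_eq_iff height_def start_def mat_def axis_def)
  qed
  then show ?thesis by simp
qed

text \<open>
  Any two points are joined by a line in the space of all pairs of an invertible matrix and an
  element of the slice; on it everything is a polynomial in one variable.
\<close>

lemma slice_no_zero_divisors:
  assumes "F \<in> generated_algebra pair_coords" "G \<in> generated_algebra pair_coords"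
    and FG: "\<And>g Y. det g = 1 \<Longrightarrow> Y \<in> slice l \<Longrightarrow> F (g, Y) * G (g, Y) = 0"
    and G: "det g\<^sub>0 = 1" "Y\<^sub>0 \<in> slice l" "G (g\<^sub>0, Y\<^sub>0) \<noteq> 0"
    and g: "det g = 1" "Y \<in> slice l"
  shows "F (g, Y) = 0"
proof -
  let ?C = "{\<lambda>s :: complex. s}"
  define M :: "complex \<Rightarrow> complex^'n^'n" where "M = (\<lambda>s. \<chi> i j. (1 - s) * g\<^sub>0 $ i $ j + s * g $ i $ j)"
  define N :: "complex \<Rightarrow> complex^'n^'n" where "N = (\<lambda>s. \<chi> i j. (1 - s) * Y\<^sub>0 $ i $ j + s * Y $ i $ j)"
  have id: "(\<lambda>s. s) \<in> generated_algebra ?C" by (rule generated_algebra.base) simp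
  have M: "(\<lambda>s. M s $ i $ j) \<in> generated_algebra ?C" for i j
    unfolding M_def by (simp, intro generated_algebra_intros id)
  have N: "(\<lambda>s. N s $ i $ j) \<in> generated_algebra ?C" for i j
    unfolding N_def by (simp, intro generated_algebra_intros id)
  have N_slice: "N s \<in> slice l" for s
    using G(2) g(2) by (auto simp: slice_def upper_def N_def algebra_simps)
  have ends: "M 0 = g\<^sub>0" "M 1 = g" "N 0 = Y\<^sub>0" "N 1 = Y" by (simp_all add: M_def N_def vec_eq_iff)
  obtain m p where p: "p \<in> generated_algebra ?C"
    "\<forall>s. det (M s) \<noteq> 0 \<longrightarrow> p s = det (M s) ^ m * F (unimod (M s), N s)"
    using unimod_poly[OF assms(1) M N] by blast
  obtain k q where q: "q \<in> generated_algebra ?C"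
    "\<forall>s. det (M s) \<noteq> 0 \<longrightarrow> q s = det (M s) ^ k * G (unimod (M s), N s)"
    using unimod_poly[OF assms(2) M N] by blast
  \<comment> \<open>The factor \<open>det (M s)\<close> covers the parameters where the line leaves
    the invertible matrices and nothing is known about \<open>p\<close> and
    \<open>q\<close>.\<close>
  have "p s * q s * det (M s) = 0" for s
  proof (cases "det (M s) = 0")
    case False
    then have "F (unimod (M s), N s) * G (unimod (M s), N s) = 0"
      by (intro FG det_unimod N_slice)
    then show ?thesis using p q False by auto
  qed simp
  moreover obtain P where P: "p = poly P" using p(1) by (rule generated_algebra_univariate)
  moreover obtain Q where Q: "q = poly Q" using q(1) by (rule generated_algebra_univariate)
  moreover obtain R where R: "(\<lambda>s. det (M s)) = poly R"
    using generated_algebra_det[OF M] by (rule generated_algebra_univariate)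
  ultimately have "poly (P * Q * R) s = 0" for s by (metis poly_mult)
  then have "P * Q * R = 0" using poly_all_0_iff_0 by blast
  moreover have "poly R 0 = 1" using fun_cong[OF R, of 0] by (simp add: ends G)
  then have "R \<noteq> 0" by auto
  moreover have "poly Q 0 \<noteq> 0" using q(2)[rule_format, of 0] G(3) by (simp add: ends G(1) unimod_id Q)
  then have "Q \<noteq> 0" by auto
  ultimately have "P = 0" by simp
  then have "p 1 = 0" using P by simp
  then show ?thesis using p(2)[rule_format, of 1] by (simp add: ends g(1) unimod_id)
qed

lemma conj_pair_poly:
  assumes "h \<in> matrix_polys"
  obtains h' where "h' \<in> generated_algebra pair_coords"
    "\<And>g Y. det g = 1 \<Longrightarrow> h' (g, Y) = h (g ** Y ** matrix_inv g)"
proof -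
  have "(\<lambda>z. h (fst z ** snd z ** adjugate (fst z))) \<in> generated_algebra pair_coords"
    by (intro matrix_poly_compose'[OF assms] generated_algebra_matrix_mult generated_algebra_adjugate
        pair_coords_poly)
  then show ?thesis using that by (force simp: adjugate_eq_matrix_inv)
qed

theorem invariant_polynomial:
  assumes f: "f \<in> generated_algebra pair_coords"
    and invariant: "\<And>b g Y. det b = 1 \<Longrightarrow> upper b \<Longrightarrow> det g = 1 \<Longrightarrow> Y \<in> slice l \<Longrightarrow>
      f (g ** matrix_inv b, b ** Y ** matrix_inv b) = f (g, Y)"
  shows "\<exists>h\<in>matrix_polys. \<forall>g Y. det g = 1 \<longrightarrow> Y \<in> slice l \<longrightarrow>
      f (g, Y) = h (g ** Y ** matrix_inv g)"
proof -
  define U where "U b = krylov l (axis (start b) 1)" for b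
  \<comment> \<open>The value of \<open>f\<close> at the pair over \<open>X\<close> built from its
    Krylov matrix. By simple transitivity, every pair over \<open>X\<close> gives the same
    value.\<close>
  define val where "val b X = f (unimod (U b X), unimod_bidiagonal l (det (U b X)))" for b X
  have val: "f (g, Y) = val b (g ** Y ** matrix_inv g)"
    if "det g = 1" "Y \<in> slice l" "det (U b (g ** Y ** matrix_inv g)) \<noteq> 0" for b g Y
  proof -
    let ?X = "g ** Y ** matrix_inv g"
    have "char_fps ?X = spread l" by (rule char_fps_conj_slice) (use that in auto)
    then have "?X ** U b ?X = U b ?X ** bidiagonal l" unfolding U_def by (rule krylov_conj)
    then have "?X ** (U b ?X ** matrix_inv (U b ?X)) = U b ?X ** bidiagonal l ** matrix_inv (U b ?X)"
      by (simp add: matrix_mul_assoc)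
    then have "?X = unimod (U b ?X) ** unimod_bidiagonal l (det (U b ?X)) ** matrix_inv (unimod (U b ?X))"
      using that(3) by (simp add: unimod_conj matrix_inv_det)
    note * = this
    obtain c where "det c = 1" "upper c" "unimod (U b ?X) = g ** matrix_inv c"
      "unimod_bidiagonal l (det (U b ?X)) = c ** Y ** matrix_inv c"
      by (rule cyclic_transitive[OF \<open>det g = 1\<close> det_unimod[OF \<open>det (U b ?X) \<noteq> 0\<close>] \<open>Y \<in> slice l\<close>
          unimod_bidiagonal_slice * \<open>det (U b ?X) \<noteq> 0\<close>[unfolded U_def]])
    then show ?thesis unfolding val_def using invariant[of c g Y] that(1,2) by simp
  qed
  have "\<exists>m. \<exists>q\<in>matrix_polys. \<forall>X. minor l b X \<noteq> 0 \<longrightarrow> q X = minor l b X ^ m * val b X" for b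
  proof -
    obtain \<sigma> where \<sigma>: "\<sigma> \<noteq> 0" "\<And>X. det (U b X) = \<sigma> * minor l b X"
      unfolding U_def using det_krylov_minor[of l b] by metis
    obtain m q where q: "q \<in> matrix_polys"
      "\<forall>X. det (U b X) \<noteq> 0 \<longrightarrow> q X = det (U b X) ^ m * f (unimod (U b X), unimod_bidiagonal l (det (U b X)))"
      using unimod_poly[OF f, of "U b" mat_coords "\<lambda>X. unimod_bidiagonal l (det (U b X))"]
        krylov_poly det_krylov_poly unimod_bidiagonal_poly unfolding U_def by blast
    show ?thesis
      by (intro exI[of _ m] bexI[of _ "\<lambda>X. inverse \<sigma> ^ m * q X"] generated_algebra_cmult q(1))
        (use q(2) \<sigma> in \<open>auto simp: val_def power_mult_distrib field_simps\<close>)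
  qed
  then obtain mm qq where qq: "\<And>b. qq b \<in> matrix_polys"
    "\<And>b X. minor l b X \<noteq> 0 \<Longrightarrow> qq b X = minor l b X ^ mm b * val b X" by metis
  define m where "m = mm True + mm False"
  define Q where "Q b X = minor l b X ^ mm (\<not> b) * qq b X" for b X
  have Q_poly: "Q b \<in> matrix_polys" for b
    unfolding Q_def by (intro generated_algebra_intros minor_poly qq)
  have Q: "Q b X = minor l b X ^ m * val b X" if "minor l b X \<noteq> 0" for b X
    unfolding Q_def m_def using qq(2)[OF that] by (cases b) (simp_all add: power_add)
  have U_minor: "det (U b X) \<noteq> 0 \<longleftrightarrow> minor l b X \<noteq> 0" for b X
    unfolding U_def using det_krylov_minor[of l b] by (metis mult_eq_0_iff)
  let ?d = "\<lambda>X. minor l True X ^ m * Q False X - minor l False X ^ m * Q True X"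
  have d_poly: "?d \<in> matrix_polys" by (intro generated_algebra_intros minor_poly Q_poly)
  \<comment> \<open>The two extra factors make the product vanish also at points of the orbit where
    a minor is zero. Both are cancelled afterwards as nonzerodivisors modulo the ideal.\<close>
  have "(\<lambda>X. minor l True X * (minor l False X * ?d X)) \<in> kostant_ideal l"
  proof (rule vanish_on_orbit)
    show "(\<lambda>X. minor l True X * (minor l False X * ?d X)) \<in> matrix_polys"
      by (intro generated_algebra_intros minor_poly Q_poly)
    fix g :: "complex^'n^'n" assume g: "det g = 1"
    let ?X = "g ** bidiagonal l ** matrix_inv g"
    show "minor l True ?X * (minor l False ?X * ?d ?X) = 0"
    proof (cases "minor l True ?X = 0 \<or> minor l False ?X = 0")
      case False
      then have "val True ?X = val False ?X"
        using val[OF g bidiagonal_slice] U_minor by metis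
      then show ?thesis using False Q by simp
    qed auto
  qed
  then have "(\<lambda>X. minor l True X ^ 1 * (minor l False X * ?d X)) \<in> kostant_ideal l"
    by (simp only: power_one_right)
  from minor_nonzerodivisor[OF generated_algebra.mult[OF minor_poly d_poly] this]
  have "(\<lambda>X. minor l False X ^ 1 * ?d X) \<in> kostant_ideal l"
    by (simp only: power_one_right)
  from minor_nonzerodivisor[OF d_poly this]
  have "(\<lambda>X. minor l (\<not> False) X ^ m * Q False X - minor l False X ^ m * Q True X) \<in> kostant_ideal l"
    by simp
  from minor_regular[OF Q_poly Q_poly this]
  have "\<exists>h\<in>matrix_polys. (\<lambda>X. Q False X - minor l False X ^ m * h X) \<in> kostant_ideal l" .
  then obtain h where h: "h \<in> matrix_polys" "(\<lambda>X. Q False X - minor l False X ^ m * h X) \<in> kostant_ideal l"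
    by blast
  have generic: "f (g, Y) = h (g ** Y ** matrix_inv g)"
    if "det g = 1" "Y \<in> slice l" "minor l False (g ** Y ** matrix_inv g) \<noteq> 0" for g Y
  proof -
    let ?X = "g ** Y ** matrix_inv g"
    have "char_fps ?X = spread l" by (rule char_fps_conj_slice) (use that in auto)
    from kostant_ideal_vanish[OF h(2) this] have "Q False ?X = minor l False ?X ^ m * h ?X" by simp
    then have "val False ?X = h ?X" using Q[OF that(3)] that(3) by simp
    then show ?thesis using val[OF that(1,2), of False] that(3) U_minor by metis
  qed
  obtain h' where h': "h' \<in> generated_algebra pair_coords"
    "\<And>g Y. det g = 1 \<Longrightarrow> h' (g, Y) = h (g ** Y ** matrix_inv g)" using conj_pair_poly[OF h(1)] by metis
  obtain d where d: "d \<in> generated_algebra pair_coords"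
    "\<And>g Y. det g = 1 \<Longrightarrow> d (g, Y) = minor l False (g ** Y ** matrix_inv g)"
    using conj_pair_poly[OF minor_poly[of l False]] by metis
  \<comment> \<open>The identity is known where the minor is nonzero; it extends to all pairs
    because their coordinate ring has no zero divisors.\<close>
  have "f (g, Y) - h' (g, Y) = 0" if "det g = 1" "Y \<in> slice l" for g Y
  proof (rule slice_no_zero_divisors[where F = "\<lambda>z. f z - h' z" and G = d])
    show "(\<lambda>z. f z - h' z) \<in> generated_algebra pair_coords"
      by (intro generated_algebra_intros f h'(1))
    show "(f (g, Y) - h' (g, Y)) * d (g, Y) = 0" if "det g = 1" "Y \<in> slice l" for g Y
      using generic[OF that] h'(2)[OF that(1)] d(2)[OF that(1)] by auto
    have "matrix_inv (mat 1) = (mat 1 :: complex^'n^'n)" by (rule matrix_inv_unique) simp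
    then show "d (mat 1, bidiagonal l) \<noteq> 0" by (simp add: d(2) minor_bidiagonal)
  qed (use d that bidiagonal_slice in auto)
  then show ?thesis using h(1) h'(2) by auto
qed

end


section \<open>The Lie--Kolchin theorem\<close>

lemma zariski_affine_variety:
  "zariski (affine_variety C S) = topology_generated_by ((\<lambda>f. {x \<in> S. f x \<noteq> 0}) ` generated_algebra C)"
proof -
  have "{x \<in> S. restrict f S x \<noteq> 0} = {x \<in> S. f x \<noteq> 0}" for f :: "'a \<Rightarrow> complex" by auto
  then show ?thesis by (simp add: zariski_def affine_variety_def image_image)
qed

lemma openin_zariski:
  "f \<in> generated_algebra C \<Longrightarrow> openin (zariski (affine_variety C S)) {x \<in> S. f x \<noteq> 0}"
  unfolding zariski_affine_variety by (rule topology_generated_by_Basis) blast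

lemma topspace_zariski [simp]: "topspace (zariski (affine_variety C S)) = S"
proof -
  have "S = {x \<in> S. (\<lambda>_. 1) x \<noteq> (0::complex)}" by simp
  then show ?thesis unfolding zariski_affine_variety topology_generated_by_topspace
    using generated_algebra.const[of 1 C] by blast
qed

lemma continuous_map_into_zariski:
  assumes "\<And>x. x \<in> topspace T \<Longrightarrow> \<phi> x \<in> S"
    and "\<And>f. f \<in> generated_algebra C \<Longrightarrow> openin T {x \<in> topspace T. f (\<phi> x) \<noteq> 0}"
  shows "continuous_map T (zariski (affine_variety C S)) \<phi>"
  unfolding zariski_affine_variety
proof (rule continuous_on_generated_topo)
  fix U assume "U \<in> (\<lambda>f. {x \<in> S. f x \<noteq> 0}) ` generated_algebra C"
  then obtain f where f: "f \<in> generated_algebra C" "U = {x \<in> S. f x \<noteq> 0}" by blast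
  have "\<phi> -` U \<inter> topspace T = {x \<in> topspace T. f (\<phi> x) \<noteq> 0}" using assms(1) f by auto
  then show "openin T (\<phi> -` U \<inter> topspace T)" using assms(2)[OF f(1)] by simp
next
  have "S = {x \<in> S. (\<lambda>_. 1) x \<noteq> (0::complex)}" by simp
  then have "S \<subseteq> \<Union> ((\<lambda>f. {x \<in> S. f x \<noteq> 0}) ` generated_algebra C)"
    using generated_algebra.const[of 1 C] by blast
  then show "\<phi> ` topspace T \<subseteq> \<Union> ((\<lambda>f. {x \<in> S. f x \<noteq> 0}) ` generated_algebra C)"
    using assms(1) by blast
qed

text \<open>If only finitely many values occur, a level set and its complement in \<open>H\<close>
  are both zero sets of polynomials and would separate \<open>H\<close>.\<close>

lemma connected_finite_constant:
  assumes "connectedin (zariski (affine_variety C S)) H" "q \<in> generated_algebra C" "finite (q ` H)"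
    and "a \<in> H" "b \<in> H"
  shows "q a = q b"
proof (rule ccontr)
  assume neq: "q a \<noteq> q b"
  define q' where "q' x = (\<Prod>c\<in>q ` H - {q a}. q x - c)" for x
  have H: "H \<subseteq> S" using connectedin_subset_topspace[OF assms(1)] by simp
  have "q' \<in> generated_algebra C" unfolding q'_def by (intro generated_algebra_intros assms(2))
  then have open1: "openin (zariski (affine_variety C S)) {x \<in> S. q' x \<noteq> 0}" by (rule openin_zariski)
  have "(\<lambda>x. q x - q a) \<in> generated_algebra C" by (intro generated_algebra_intros assms(2))
  then have open2: "openin (zariski (affine_variety C S)) {x \<in> S. q x - q a \<noteq> 0}" by (rule openin_zariski)
  have zero: "q' x = 0 \<longleftrightarrow> q x \<noteq> q a" if "x \<in> H" for x
    using that assms(3) by (auto simp: q'_def)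
  have "H \<subseteq> {x \<in> S. q' x \<noteq> 0} \<union> {x \<in> S. q x - q a \<noteq> 0}" using H zero by auto
  moreover have "{x \<in> S. q' x \<noteq> 0} \<inter> {x \<in> S. q x - q a \<noteq> 0} \<inter> H = {}" using zero by auto
  moreover have "a \<in> {x \<in> S. q' x \<noteq> 0} \<inter> H" using zero assms(4) H by auto
  moreover have "b \<in> {x \<in> S. q x - q a \<noteq> 0} \<inter> H" using neq assms(5) H by auto
  ultimately show False using assms(1) open1 open2 unfolding connectedin by blast
qed

section \<open>The special linear group with its Zariski topology\<close>

abbreviation zariski_SL :: "(complex^'n^'n) topology" where
  "zariski_SL \<equiv> zariski (affine_variety mat_coords (carrier SL))"

lemma carrier_SL: "g \<in> carrier SL \<longleftrightarrow> det g = 1" and mult_SL [simp]: "g \<otimes>\<^bsub>SL\<^esub> h = g ** h"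
  and one_SL [simp]: "\<one>\<^bsub>SL\<^esub> = mat 1"
  by (simp_all add: SL_def)

lemma group_SL: "group (SL :: (complex^'n^'n) monoid)"
proof (rule groupI)
  fix g :: "complex^'n^'n" assume "g \<in> carrier SL"
  then show "\<exists>h\<in>carrier SL. h \<otimes>\<^bsub>SL\<^esub> g = \<one>\<^bsub>SL\<^esub>"
    by (intro bexI[of _ "matrix_inv g"]) (auto simp: carrier_SL matrix_inv_det det_matrix_inv)
qed (auto simp: carrier_SL det_mul matrix_mul_assoc)

interpretation SL: group "SL :: (complex^'n^'n) monoid" by (rule group_SL)

lemma inv_SL: "g \<in> carrier SL \<Longrightarrow> inv\<^bsub>SL\<^esub> g = matrix_inv g"
  by (rule SL.inv_equality) (auto simp: carrier_SL matrix_inv_det det_matrix_inv)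

lemma SL_poly_continuous:
  fixes \<phi> :: "complex^'n^'n \<Rightarrow> complex^'n^'n"
  assumes "\<And>x. x \<in> carrier SL \<Longrightarrow> \<phi> x \<in> carrier SL"
    and "\<And>i j. \<exists>h\<in>matrix_polys. \<forall>x\<in>carrier SL. h x = \<phi> x $ i $ j"
  shows "continuous_map zariski_SL zariski_SL \<phi>"
proof (rule continuous_map_into_zariski)
  fix f :: "complex^'n^'n \<Rightarrow> complex" assume "f \<in> matrix_polys"
  from matrix_poly_compose[OF this assms(2)]
  obtain h where h: "h \<in> matrix_polys" "\<forall>x\<in>carrier SL. h x = f (\<phi> x)" by blast
  have "{x \<in> topspace zariski_SL. f (\<phi> x) \<noteq> 0} = {x \<in> carrier SL. h x \<noteq> 0}" using h by auto
  then show "openin zariski_SL {x \<in> topspace zariski_SL. f (\<phi> x) \<noteq> 0}"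
    using openin_zariski[OF h(1)] by simp
qed (use assms in simp)

lemma SL_conj_poly:
  fixes c d e :: "complex^'n^'n"
  shows "\<exists>h\<in>matrix_polys. \<forall>x\<in>carrier SL. h x = (c ** x ** d ** matrix_inv x ** e) $ i $ j"
    and "\<exists>h\<in>matrix_polys. \<forall>x\<in>carrier SL. h x = (c ** matrix_inv x ** d ** x ** e) $ i $ j"
proof -
  have *: "x \<in> carrier SL \<Longrightarrow> matrix_inv x = adjugate x" for x :: "complex^'n^'n"
    by (simp add: adjugate_eq_matrix_inv carrier_SL)
  have "(\<lambda>x. (c ** x ** d ** adjugate x ** e) $ i $ j) \<in> matrix_polys"
    "(\<lambda>x. (c ** adjugate x ** d ** x ** e) $ i $ j) \<in> matrix_polys"
    by (intro generated_algebra_matrix_mult generated_algebra_adjugate generated_algebra.const entry_poly)+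
  then show "\<exists>h\<in>matrix_polys. \<forall>x\<in>carrier SL. h x = (c ** x ** d ** matrix_inv x ** e) $ i $ j"
    "\<exists>h\<in>matrix_polys. \<forall>x\<in>carrier SL. h x = (c ** matrix_inv x ** d ** x ** e) $ i $ j"
    using * by (intro bexI; simp)+
qed

lemma commutator_in_derived:
  assumes "H \<subseteq> carrier SL" "a \<in> H" "b \<in> H"
  shows "a ** b ** matrix_inv a ** matrix_inv b \<in> derived SL H"
proof -
  have "a \<otimes>\<^bsub>SL\<^esub> b \<otimes>\<^bsub>SL\<^esub> (inv\<^bsub>SL\<^esub> a) \<otimes>\<^bsub>SL\<^esub> (inv\<^bsub>SL\<^esub> b) \<in> derived SL H"
    unfolding derived_def by (rule generate.incl) (use assms in blast)
  moreover have "a \<in> carrier SL" "b \<in> carrier SL" using assms by auto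
  ultimately show ?thesis by (simp add: inv_SL)
qed

text \<open>Varying one argument of a commutator traces a connected set through 1, and translation
  joins such sets along products. Only one factor moves at a time, so no topology on a product of
  groups enters.\<close>

lemma derived_SL_connected:
  fixes H :: "(complex^'n^'n) set"
  assumes H: "subgroup H SL" "connectedin zariski_SL H"
  shows "connectedin zariski_SL (derived SL H)"
proof -
  let ?D = "derived SL H"
  have HC: "H \<subseteq> carrier SL" using H(1) by (rule subgroup.subset)
  have D: "subgroup ?D SL" by (rule SL.derived_is_subgroup[OF HC])
  then have D1: "mat 1 \<in> ?D" using subgroup.one_closed[OF D] by simp
  have "\<exists>P. connectedin zariski_SL P \<and> mat 1 \<in> P \<and> x \<in> P \<and> P \<subseteq> ?D" if "x \<in> ?D" for x
    using that unfolding derived_def[of SL H]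
  proof (induction rule: generate.induct)
    case one
    have "connectedin zariski_SL {mat 1}" by (simp add: connectedin_sing carrier_SL)
    moreover have "{mat 1} \<subseteq> generate SL (derived_set SL H)" using D1 by (simp add: derived_def)
    ultimately show ?case unfolding one_SL by blast
  next
    case (incl x)
    then obtain a b where ab: "a \<in> H" "b \<in> H" "x = a ** b ** matrix_inv a ** matrix_inv b"
      using HC by (auto simp: inv_SL subset_iff)
    define P where "P = (\<lambda>a. a ** b ** matrix_inv a ** matrix_inv b) ` H"
    have b: "det b = 1" using ab HC by (auto simp: carrier_SL)
    have "continuous_map zariski_SL zariski_SL (\<lambda>a. a ** b ** matrix_inv a ** matrix_inv b)"
      by (rule SL_poly_continuous)
        (use SL_conj_poly(1)[of "mat 1" b "matrix_inv b"] b in \<open>auto simp: carrier_SL det_mul det_matrix_inv\<close>)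
    then have 1: "connectedin zariski_SL P"
      unfolding P_def using H(2) by (rule connectedin_continuous_map_image)
    have "mat 1 = mat 1 ** b ** matrix_inv (mat 1) ** matrix_inv b"
      using b matrix_inv_unique[of "mat 1" "mat 1 :: complex^'n^'n"] by (simp add: matrix_inv_det)
    then have 2: "mat 1 \<in> P" unfolding P_def
      using subgroup.one_closed[OF H(1)] by (intro image_eqI[of _ _ "mat 1"]) simp_all
    have "P \<subseteq> generate SL (derived_set SL H)"
      unfolding P_def using commutator_in_derived[OF HC] ab by (auto simp: derived_def)
    moreover have "x \<in> P" unfolding P_def using ab by blast
    ultimately show ?case using 1 2 by blast
  next
    case (inv x)
    then obtain a b where ab: "a \<in> H" "b \<in> H" "x = a ** b ** matrix_inv a ** matrix_inv b"
      using HC by (auto simp: inv_SL subset_iff)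
    \<comment> \<open>The inverse of a commutator is the commutator of the exchanged pair; here the
      moving argument stands second.\<close>
    define P where "P = (\<lambda>a. b ** a ** matrix_inv b ** matrix_inv a) ` H"
    have dets: "det b = 1" "det a = 1" using ab HC by (auto simp: carrier_SL)
    have "continuous_map zariski_SL zariski_SL (\<lambda>a. b ** a ** matrix_inv b ** matrix_inv a)"
      by (rule SL_poly_continuous)
        (use SL_conj_poly(1)[of b "matrix_inv b" "mat 1"] dets in \<open>auto simp: carrier_SL det_mul det_matrix_inv\<close>)
    then have 1: "connectedin zariski_SL P"
      unfolding P_def using H(2) by (rule connectedin_continuous_map_image)
    have "mat 1 = b ** mat 1 ** matrix_inv b ** matrix_inv (mat 1)"
      using dets matrix_inv_unique[of "mat 1" "mat 1 :: complex^'n^'n"] by (simp add: matrix_inv_det)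
    then have 2: "mat 1 \<in> P" unfolding P_def
      using subgroup.one_closed[OF H(1)] by (intro image_eqI[of _ _ "mat 1"]) simp_all
    have "P \<subseteq> generate SL (derived_set SL H)"
      unfolding P_def using commutator_in_derived[OF HC] ab by (auto simp: derived_def)
    moreover have "x \<in> carrier SL" unfolding ab(3) by (simp add: carrier_SL det_mul det_matrix_inv dets)
    then have "inv\<^bsub>SL\<^esub> x = b ** a ** matrix_inv b ** matrix_inv a"
      unfolding ab(3) using dets
      by (simp add: inv_SL matrix_inv_mult det_mul det_matrix_inv matrix_inv_matrix_inv matrix_mul_assoc)
    then have "inv\<^bsub>SL\<^esub> x \<in> P" unfolding P_def using ab by blast
    ultimately show ?case using 1 2 by blast
  next
    case (eng x y)
    then obtain P Q where P: "connectedin zariski_SL P" "mat 1 \<in> P" "x \<in> P" "P \<subseteq> ?D"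
      and Q: "connectedin zariski_SL Q" "mat 1 \<in> Q" "y \<in> Q" "Q \<subseteq> ?D"
      unfolding derived_def by blast
    have x: "x \<in> ?D" "det x = 1" using P subgroup.subset[OF D] by (auto simp: carrier_SL)
    have entry: "(\<lambda>z. (x ** z) $ i $ j) \<in> matrix_polys" for i j
      by (intro generated_algebra_matrix_mult generated_algebra.const entry_poly)
    have "continuous_map zariski_SL zariski_SL (\<lambda>z. x ** z)"
      by (rule SL_poly_continuous) (use x entry in \<open>auto simp: carrier_SL det_mul\<close>)
    from connectedin_continuous_map_image[OF this Q(1)]
    have "connectedin zariski_SL ((\<lambda>z. x ** z) ` Q)" .
    moreover have "x \<in> (\<lambda>z. x ** z) ` Q" using Q(2) by (force simp: image_iff)
    ultimately have "connectedin zariski_SL (P \<union> (\<lambda>z. x ** z) ` Q)"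
      using P by (intro connectedin_Un) auto
    moreover have "(\<lambda>z. x ** z) ` Q \<subseteq> ?D"
      using subgroup.m_closed[OF D x(1)] Q(4) by auto
    ultimately show ?case
      using P Q by (intro exI[of _ "P \<union> (\<lambda>z. x ** z) ` Q"]) (auto simp: derived_def)
  qed
  then have "?D = \<Union>{P. connectedin zariski_SL P \<and> mat 1 \<in> P \<and> P \<subseteq> ?D}" by blast
  moreover have "connectedin zariski_SL (\<Union>{P. connectedin zariski_SL P \<and> mat 1 \<in> P \<and> P \<subseteq> ?D})"
    by (rule connectedin_Union) auto
  ultimately show ?thesis by simp
qed

section \<open>Eigenvectors modulo a stable subspace\<close>

definition stable :: "(complex^'n^'n) set \<Rightarrow> (complex^'n) set \<Rightarrow> bool" where
  "stable H U \<longleftrightarrow> (\<forall>h\<in>H. \<forall>u\<in>U. h *v u \<in> U)"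

lemma stableD: "stable H U \<Longrightarrow> h \<in> H \<Longrightarrow> u \<in> U \<Longrightarrow> h *v u \<in> U"
  by (simp add: stable_def)

definition char_poly_of :: "complex^'n^'n \<Rightarrow> complex poly" where
  "char_poly_of A = (\<Sum>k\<le>CARD('n). monom (fps_nth (char_fps A) (CARD('n) - k)) k)"

lemma coeff_char_poly_of:
  "coeff (char_poly_of (A :: complex^'n^'n)) k =
     (if k \<le> CARD('n) then fps_nth (char_fps A) (CARD('n) - k) else 0)"
  by (simp add: char_poly_of_def coeff_sum coeff_monom if_distrib sum.delta cong: if_cong)

lemma char_poly_of_nonzero: "char_poly_of (A :: complex^'n^'n) \<noteq> 0"
  using coeff_char_poly_of[of A "CARD('n)"] by (auto simp: char_fps_zero)

text \<open>The vector \<open>p(A) v\<close> for degree at most n. Higher coefficients are cut off,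
  which explains the degree bound in \<open>eigenvector_mod\<close>.\<close>

definition poly_apply :: "complex^'n^'n \<Rightarrow> complex^'n \<Rightarrow> complex poly \<Rightarrow> complex^'n" where
  "poly_apply A v p = (\<Sum>k\<le>CARD('n). coeff p k *s (matpow A k *v v))"

lemma poly_apply_char_poly: "poly_apply (A :: complex^'n^'n) v (char_poly_of A) = 0"
proof -
  let ?n = "CARD('n)"
  have "poly_apply A v (char_poly_of A) $ i = 0" for i
  proof -
    have "poly_apply A v (char_poly_of A) $ i =
        (\<Sum>k\<le>?n. \<Sum>j\<in>UNIV. fps_nth (char_fps A) (?n - k) * matpow A k $ i $ j * v $ j)"
      by (simp add: poly_apply_def coeff_char_poly_of matrix_vector_mult_def sum_distrib_left mult.assoc)
    also have "\<dots> = (\<Sum>k\<le>?n. \<Sum>j\<in>UNIV. fps_nth (char_fps A) k * matpow A (?n - k) $ i $ j * v $ j)"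
      by (rule sum.reindex_bij_witness[of _ "\<lambda>k. ?n - k" "\<lambda>k. ?n - k"]) auto
    also have "\<dots> = (\<Sum>j\<in>UNIV. (\<Sum>k\<le>?n. fps_nth (char_fps A) k * matpow A (?n - k) $ i $ j) * v $ j)"
      unfolding sum_distrib_right by (rule sum.swap)
    finally show ?thesis by (simp add: cayley_hamilton)
  qed
  then show ?thesis by (simp add: vec_eq_iff)
qed

lemma subspace_cmult_iff:
  assumes "vec.subspace U" "c \<noteq> 0" shows "c *s v \<in> U \<longleftrightarrow> (v :: complex^'n) \<in> U"
proof
  assume "c *s v \<in> U"
  then have "inverse c *s (c *s v) \<in> U" by (rule vec.subspace_scale[OF assms(1)])
  then show "v \<in> U" using assms(2) by simp
qed (rule vec.subspace_scale[OF assms(1)])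

text \<open>If \<open>A v\<close> is congruent to \<open>c v\<close> modulo a stable
  \<open>U\<close>, then \<open>p(A) v\<close> is congruent to \<open>p(c) v\<close> for every
  polynomial; for the characteristic polynomial the left side is 0, so \<open>c\<close> is a
  root.\<close>

lemma eigenvalues_mod_finite:
  fixes A :: "complex^'n^'n"
  assumes U: "vec.subspace U" "\<And>u. u \<in> U \<Longrightarrow> A *v u \<in> U"
  shows "finite {c. \<exists>v. v \<notin> U \<and> A *v v - c *s v \<in> U}"
proof (rule finite_subset)
  show "{c. \<exists>v. v \<notin> U \<and> A *v v - c *s v \<in> U} \<subseteq> {c. poly (char_poly_of A) c = 0}"
  proof clarify
    fix c v assume v: "v \<notin> U" "A *v v - c *s v \<in> U"
    have pow: "matpow A k *v v - c ^ k *s v \<in> U" for k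
    proof (induction k)
      case 0
      then show ?case using vec.subspace_0[OF U(1)] by simp
    next
      case (Suc k)
      have "A *v (matpow A k *v v - c ^ k *s v) + c ^ k *s (A *v v - c *s v) \<in> U"
        by (intro vec.subspace_add vec.subspace_scale U Suc v)
      also have "A *v (matpow A k *v v - c ^ k *s v) + c ^ k *s (A *v v - c *s v) =
          matpow A (Suc k) *v v - c ^ Suc k *s v"
        by (simp add: matrix_vector_mult_diff_distrib vector_scalar_commute matrix_vector_mul_assoc
            matpow_commute vec.scale_right_diff_distrib mult.commute)
      finally show ?case .
    qed
    have "(\<Sum>k\<le>CARD('n). coeff (char_poly_of A) k *s (matpow A k *v v - c ^ k *s v)) \<in> U"
      by (intro vec.subspace_sum vec.subspace_scale U pow)
    also have "(\<Sum>k\<le>CARD('n). coeff (char_poly_of A) k *s (matpow A k *v v - c ^ k *s v)) =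
        poly_apply A v (char_poly_of A) - (\<Sum>k\<le>CARD('n). coeff (char_poly_of A) k * c ^ k) *s v"
      by (simp add: poly_apply_def vec.scale_right_diff_distrib sum_subtractf vec.scale_sum_left)
    also have "(\<Sum>k\<le>CARD('n). coeff (char_poly_of A) k * c ^ k) = poly (char_poly_of A) c"
      unfolding coeff_char_poly_of by (simp add: char_poly_of_def poly_sum poly_monom)
    finally have "- poly (char_poly_of A) c *s v \<in> U" by (simp add: poly_apply_char_poly)
    then show "poly (char_poly_of A) c = 0" 
      using v(1) subspace_cmult_iff[OF U(1), of "- poly (char_poly_of A) c" v] by auto
  qed
  show "finite {c. poly (char_poly_of A) c = 0}" by (rule poly_roots_finite[OF char_poly_of_nonzero])
qed

text \<open>Start from a nonzero polynomial sending \<open>w\<close> into \<open>U\<close>, such as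
  the characteristic one, and split off linear factors. The first quotient that no longer sends
  \<open>w\<close> into \<open>U\<close> produces the eigenvector.\<close>

lemma eigenvector_mod:
  fixes A :: "complex^'n^'n"
  assumes U: "vec.subspace U" and W: "vec.subspace W" "\<And>w. w \<in> W \<Longrightarrow> A *v w \<in> W"
    and w: "w \<in> W" "w \<notin> U"
  shows "\<exists>c. \<exists>v\<in>W. v \<notin> U \<and> A *v v - c *s v \<in> U"
proof -
  have "\<exists>c. \<exists>v\<in>W. v \<notin> U \<and> A *v v - c *s v \<in> U"
    if "p \<noteq> 0" "degree p \<le> CARD('n)" "poly_apply A w p \<in> U" for p
    using that
  proof (induction "degree p" arbitrary: p rule: less_induct)
    case less
    show ?case
    proof (cases "degree p = 0")
      case True
      then obtain c where c: "p = [:c:]" by (rule degree_eq_zeroE)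
      have "poly_apply A w p = (\<Sum>k\<le>CARD('n). if k = 0 then c *s w else 0)"
        unfolding poly_apply_def c by (intro sum.cong) (auto simp: coeff_pCons split: nat.splits)
      then have "c *s w \<in> U" using less.prems(3) by simp
      moreover have "c \<noteq> 0" using less.prems(1) c by simp
      ultimately show ?thesis using w(2) subspace_cmult_iff[OF U] by blast
    next
      case False
      then have "\<not> constant (poly p)" by (simp add: constant_degree)
      then obtain \<beta> where "poly p \<beta> = 0" using fundamental_theorem_of_algebra by blast
      then have "[:- \<beta>, 1:] dvd p" using poly_eq_0_iff_dvd by blast
      then obtain q where q: "p = [:- \<beta>, 1:] * q" unfolding dvd_def by blast
      have "q \<noteq> 0" using less.prems(1) q by auto
      then have deg: "degree p = Suc (degree q)" unfolding q by (subst degree_mult_eq) auto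
      let ?v = "poly_apply A w q"
      have coeff: "coeff p k = (if k = 0 then 0 else coeff q (k - 1)) - \<beta> * coeff q k" for k
        unfolding q by (cases k) (simp_all add: coeff_pCons)
      obtain m where m: "CARD('n) = Suc m" using zero_less_card_finite[where 'a = 'n] gr0_implies_Suc by blast
      have "coeff q (Suc m) = 0" using deg less.prems(2) m by (intro coeff_eq_0) simp
      then have v: "?v = (\<Sum>k\<le>m. coeff q k *s (matpow A k *v w))"
        unfolding poly_apply_def m by simp
      have "A *v ?v = (\<Sum>k\<le>m. coeff q k *s (matpow A (Suc k) *v w))"
        unfolding v matrix_vector_mult_combination
        by (simp add: matrix_vector_mul_assoc matpow_commute)
      also have "\<dots> = (\<Sum>k\<le>CARD('n). (if k = 0 then 0 else coeff q (k - 1)) *s (matpow A k *v w))"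
        unfolding m by (simp add: sum.atMost_Suc_shift del: sum.atMost_Suc matpow.simps)
      finally have "A *v ?v - \<beta> *s ?v = poly_apply A w p"
        unfolding poly_apply_def
        by (simp add: coeff vec.scale_left_diff_distrib sum_subtractf vec.scale_sum_right)
      then have Av: "A *v ?v - \<beta> *s ?v \<in> U" using less.prems(3) by simp
      show ?thesis
      proof (cases "?v \<in> U")
        case True
        then show ?thesis using less.hyps[of q] deg less.prems(2) \<open>q \<noteq> 0\<close> by simp
      next
        case False
        have "matpow A k *v w \<in> W" for k
          by (induction k) (use w(1) W(2) in \<open>auto simp flip: matpow_commute matrix_vector_mul_assoc\<close>)
        then have "?v \<in> W" unfolding poly_apply_def
          by (intro vec.subspace_sum vec.subspace_scale W(1))
        then show ?thesis using False Av by blast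
      qed
    qed
  qed
  moreover have "degree (char_poly_of A) \<le> CARD('n)" by (rule degree_le) (simp add: coeff_char_poly_of)
  ultimately show ?thesis
    using char_poly_of_nonzero poly_apply_char_poly vec.subspace_0[OF U] by metis
qed

text \<open>Reads off an eigenvalue modulo \<open>U\<close> linearly from the image vector, so that
  it becomes a polynomial in the group element.\<close>

lemma separating_functional:
  fixes U :: "(complex^'n) set"
  assumes "vec.subspace U" "w \<notin> U"
  obtains l :: "complex^'n" where "\<And>u. u \<in> U \<Longrightarrow> (\<Sum>i\<in>UNIV. l $ i * u $ i) = 0" "(\<Sum>i\<in>UNIV. l $ i * w $ i) = 1"
proof -
  obtain B where B: "B \<subseteq> U" "vec.independent B" "U \<subseteq> vec.span B"
    using vec.maximal_independent_subset[of U] by blast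
  have "vec.span B \<subseteq> U" using B(1) assms(1) by (rule vec.span_minimal)
  then have "vec.independent (insert w B)" using B assms(2) by (intro vec.independent_insertI) auto
  then obtain g :: "complex^'n \<Rightarrow> complex^'n" where g: "Vector_Spaces.linear (*s) (*s) g"
    "\<forall>x\<in>insert w B. g x = (if x = w then w else 0)"
    using vec.linear_independent_extend[of "insert w B" "\<lambda>x. if x = w then w else 0"] by blast
  have "w \<noteq> 0" using assms vec.subspace_0 by blast
  then obtain a where a: "w $ a \<noteq> 0" by (auto simp: vec_eq_iff)
  define l where "l = (\<chi> i. matrix g $ a $ i / w $ a)"
  have l: "(\<Sum>i\<in>UNIV. l $ i * x $ i) = g x $ a / w $ a" for x
  proof -
    have "g x $ a = (matrix g *v x) $ a" using matrix_works[OF g(1)] by simp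
    then show ?thesis by (simp add: l_def matrix_vector_mult_def sum_divide_distrib)
  qed
  have "g u = 0" if "u \<in> U" for u
  proof -
    have "u \<in> vec.span B" using that B(3) by blast
    then show ?thesis
    proof (induction rule: vec.span_induct_alt)
      case base
      then show ?case using vec.linear_0[OF g(1)] by simp
    next
      case (step c x y)
      have "x \<noteq> w" using step.hyps B(1) assms(2) by blast
      then have "g x = 0" using g(2) step.hyps by simp
      then show ?case using step vec.linear_add[OF g(1)] vec.linear_scale[OF g(1)] by simp
    qed
  qed
  moreover have "g w = w" using g(2) by simp
  ultimately show ?thesis using that[of l] l a by simp
qed

text \<open>
  The eigenvalue on a fixed vector of the conjugates of a fixed element is a polynomial function
  on the group; it takes finitely many values, so it is constant.
\<close>

lemma conjugate_eigenvalue_constant: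
  fixes H :: "(complex^'n^'n) set"
  assumes H: "subgroup H SL" "connectedin zariski_SL H" and U: "vec.subspace U" "stable H U"
    and b: "b \<in> H" and v: "v \<notin> U"
    and eig: "\<And>a. a \<in> H \<Longrightarrow> (matrix_inv a ** b ** a) *v v - \<tau> a *s v \<in> U"
    and a: "a \<in> H"
  shows "\<tau> a = \<tau> (mat 1)"
proof -
  have HC: "h \<in> H \<Longrightarrow> det h = 1" for h using subgroup.subset[OF H(1)] by (auto simp: carrier_SL)
  obtain l :: "complex^'n" where l: "\<And>u. u \<in> U \<Longrightarrow> (\<Sum>i\<in>UNIV. l $ i * u $ i) = 0"
    "(\<Sum>i\<in>UNIV. l $ i * v $ i) = 1" using separating_functional[OF U(1) v] by metis
  define q where "q x = (\<Sum>i\<in>UNIV. l $ i * ((adjugate x ** b ** x) *v v) $ i)" for x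
  have q_poly: "q \<in> matrix_polys" unfolding q_def matrix_vector_mult_def
    by (simp, intro generated_algebra_intros generated_algebra_matrix_mult generated_algebra_adjugate entry_poly)
  have q: "q a = \<tau> a" if "a \<in> H" for a
  proof -
    let ?y = "(matrix_inv a ** b ** a) *v v"
    have "(\<Sum>i\<in>UNIV. l $ i * (?y - \<tau> a *s v) $ i) = 0" by (rule l(1)[OF eig[OF that]])
    then have "(\<Sum>i\<in>UNIV. l $ i * ?y $ i) = \<tau> a * (\<Sum>i\<in>UNIV. l $ i * v $ i)"
      by (simp add: right_diff_distrib sum_subtractf sum_distrib_left mult.left_commute)
    then show ?thesis using l(2) HC[OF that] by (simp add: q_def adjugate_eq_matrix_inv)
  qed
  have "q ` H \<subseteq> {c. \<exists>v. v \<notin> U \<and> b *v v - c *s v \<in> U}"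
  proof clarify
    fix a assume "a \<in> H"
    have "a \<in> carrier SL" using HC \<open>a \<in> H\<close> by (simp add: carrier_SL)
    then have ia: "matrix_inv a \<in> H" using subgroup.m_inv_closed[OF H(1) \<open>a \<in> H\<close>] by (simp add: inv_SL)
    have inv_act: "matrix_inv a *v (a *v x) = x" for x
      using HC[OF \<open>a \<in> H\<close>] by (simp add: matrix_vector_mul_assoc matrix_inv_det)
    have "a *v v \<notin> U" using stableD[OF U(2) ia, of "a *v v"] v by (auto simp: inv_act)
    moreover have "a *v ((matrix_inv a ** b ** a) *v v - \<tau> a *s v) \<in> U"
      by (rule stableD[OF U(2) \<open>a \<in> H\<close> eig[OF \<open>a \<in> H\<close>]])
    then have "b *v (a *v v) - \<tau> a *s (a *v v) \<in> U"
      using HC[OF \<open>a \<in> H\<close>]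
      by (simp add: matrix_vector_mult_diff_distrib vector_scalar_commute matrix_vector_mul_assoc
          matrix_mul_assoc matrix_inv_det)
    ultimately show "\<exists>v. v \<notin> U \<and> b *v v - q a *s v \<in> U" using q[OF \<open>a \<in> H\<close>] by metis
  qed
  moreover have "finite {c. \<exists>v. v \<notin> U \<and> b *v v - c *s v \<in> U}"
    by (rule eigenvalues_mod_finite[OF U(1)]) (rule stableD[OF U(2) b])
  ultimately have "finite (q ` H)" by (rule finite_subset)
  moreover have one: "mat 1 \<in> H" using subgroup.one_closed[OF H(1)] by simp
  ultimately have "q a = q (mat 1)"
    using connected_finite_constant[OF H(2) q_poly] a by blast
  then show ?thesis using q a one by simp
qed

text \<open>Induction along the derived series, with the pair \<open>U\<close>, \<open>W\<close> in
  place of the module \<open>W/U\<close>. The derived group has a weight vector; its weight space is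
  stable, and on a minimal stable piece of it every group element acts as a scalar.\<close>

lemma common_eigenvector_mod:
  fixes H :: "(complex^'n^'n) set"
  assumes "subgroup H SL" "connectedin zariski_SL H" "(derived SL ^^ k) H = {mat 1}"
    and "vec.subspace U" "stable H U" "vec.subspace W" "stable H W" "U \<subset> W"
  shows "\<exists>w\<in>W - U. \<forall>h\<in>H. \<exists>c. h *v w - c *s w \<in> U"
  using assms(1-3,5,7)
proof (induction k arbitrary: H)
  case 0
  obtain w where "w \<in> W - U" using assms(8) by blast
  moreover have "h *v w - 1 *s w \<in> U" if "h \<in> H" for h
    using that 0 vec.subspace_0[OF assms(4)] by simp
  ultimately show ?case by blast
next
  case (Suc k)
  note H = Suc.prems(1,2) and U = assms(4) Suc.prems(4)
  let ?D = "derived SL H"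
  have HC: "H \<subseteq> carrier SL" using H(1) by (rule subgroup.subset)
  have det: "h \<in> H \<Longrightarrow> det h = 1" for h using HC by (auto simp: carrier_SL)
  have H_inv: "matrix_inv h \<in> H" if "h \<in> H" for h
    using subgroup.m_inv_closed[OF H(1) that] inv_SL[of h] HC that by auto
  have H_mult: "g ** h \<in> H" if "g \<in> H" "h \<in> H" for g h
    using subgroup.m_closed[OF H(1) that] by simp
  have one: "mat 1 \<in> H" using subgroup.one_closed[OF H(1)] by simp
  have inv_one: "matrix_inv (mat 1) = (mat 1 :: complex^'n^'n)" by (rule matrix_inv_unique) simp
  have DH: "?D \<subseteq> H" by (rule SL.derived_incl[OF order_refl H(1)])
  note comm = commutator_in_derived[OF HC]
  have D: "subgroup ?D SL" by (rule SL.derived_is_subgroup[OF HC])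
  have "(derived SL ^^ k) ?D = {mat 1}" using Suc.prems(3) by (simp add: funpow_swap1)
  moreover have "stable ?D U" "stable ?D W" using Suc.prems(4,5) DH by (auto simp: stable_def)
  ultimately obtain w where w: "w \<in> W - U" "\<forall>y\<in>?D. \<exists>c. y *v w - c *s w \<in> U"
    using Suc.IH[OF D derived_SL_connected[OF H]] by blast
  then obtain \<tau> where \<tau>: "\<And>y. y \<in> ?D \<Longrightarrow> y *v w - \<tau> y *s w \<in> U" by metis
  define W1 where "W1 = {x \<in> W. \<forall>y\<in>?D. y *v x - \<tau> y *s x \<in> U}"
  have conj_D: "matrix_inv h ** y ** h \<in> ?D" if "h \<in> H" "y \<in> ?D" for h y
  proof -
    have "(matrix_inv h ** y ** matrix_inv (matrix_inv h) ** matrix_inv y) ** y \<in> ?D"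
      using subgroup.m_closed[OF D comm[OF H_inv[OF that(1)] subsetD[OF DH that(2)]] that(2)] by simp
    then show ?thesis using that det DH
      by (simp add: matrix_inv_matrix_inv matrix_inv_det subset_iff flip: matrix_mul_assoc)
  qed
  \<comment> \<open>Connectedness of \<open>H\<close> enters: the eigenvalue on \<open>w\<close> of
    a conjugate of \<open>y\<close> cannot vary with the conjugating element. Therefore
    \<open>H\<close> preserves \<open>W1\<close>.\<close>
  have weight: "\<tau> (matrix_inv h ** y ** h) = \<tau> y" if "h \<in> H" "y \<in> ?D" for h y
  proof -
    have "\<tau> (matrix_inv h ** y ** h) = \<tau> (matrix_inv (mat 1) ** y ** mat 1)"
      by (rule conjugate_eigenvalue_constant[OF H U subsetD[OF DH that(2)], of w "\<lambda>a. \<tau> (matrix_inv a ** y ** a)"])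
        (use w \<tau> conj_D that in auto)
    then show ?thesis by (simp add: inv_one)
  qed
  have W1: "vec.subspace W1"
    unfolding vec.subspace_def W1_def
  proof (intro conjI ballI allI CollectI)
    fix x y c assume x: "x \<in> {x \<in> W. \<forall>y\<in>?D. y *v x - \<tau> y *s x \<in> U}"
    show "c *s x \<in> W" using x vec.subspace_scale[OF assms(6)] by blast
    fix d assume d: "d \<in> ?D"
    have "c *s (d *v x - \<tau> d *s x) \<in> U" using x d vec.subspace_scale[OF U(1)] by blast
    then show "d *v (c *s x) - \<tau> d *s (c *s x) \<in> U"
      by (simp add: vector_scalar_commute vec.scale_right_diff_distrib mult.commute)
  next
    fix x y assume x: "x \<in> {x \<in> W. \<forall>y\<in>?D. y *v x - \<tau> y *s x \<in> U}"
      and y: "y \<in> {x \<in> W. \<forall>y\<in>?D. y *v x - \<tau> y *s x \<in> U}"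
    show "x + y \<in> W" using x y vec.subspace_add[OF assms(6)] by blast
    fix d assume d: "d \<in> ?D"
    have "(d *v x - \<tau> d *s x) + (d *v y - \<tau> d *s y) \<in> U" using x y d vec.subspace_add[OF U(1)] by blast
    then show "d *v (x + y) - \<tau> d *s (x + y) \<in> U"
      by (simp add: matrix_vector_right_distrib vec.scale_right_distrib algebra_simps)
  qed (use vec.subspace_0[OF assms(6)] vec.subspace_0[OF U(1)] in auto)
  have W1_stable: "stable H W1"
    unfolding stable_def
  proof (intro ballI)
    fix h x assume h: "h \<in> H" and x: "x \<in> W1"
    have "y *v (h *v x) - \<tau> y *s (h *v x) \<in> U" if y: "y \<in> ?D" for y
    proof -
      have "(matrix_inv h ** y ** h) *v x - \<tau> y *s x \<in> U"
        using x conj_D[OF h y] weight[OF h y] by (auto simp: W1_def)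
      from stableD[OF U(2) h this] show ?thesis using det[OF h]
        by (simp add: matrix_vector_mult_diff_distrib vector_scalar_commute matrix_vector_mul_assoc
            matrix_mul_assoc matrix_inv_det)
    qed
    moreover have "h *v x \<in> W" using x stableD[OF Suc.prems(5) h] by (auto simp: W1_def)
    ultimately show "h *v x \<in> W1" by (simp add: W1_def)
  qed
  have UW1: "U \<subseteq> W1" "w \<in> W1"
  proof
    fix u assume u: "u \<in> U"
    have "y *v u - \<tau> y *s u \<in> U" if "y \<in> ?D" for y
      by (intro vec.subspace_diff vec.subspace_scale U(1) u stableD[OF U(2)]) (use that DH in blast)
    then show "u \<in> W1" using u assms(8) by (auto simp: W1_def)
  next
    show "w \<in> W1" using w \<tau> by (auto simp: W1_def)
  qed
  \<comment> \<open>A stable subspace of least dimension above \<open>U\<close> stands in for an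
    irreducible module.\<close>
  let ?good = "\<lambda>Z. vec.subspace Z \<and> stable H Z \<and> U \<subseteq> Z \<and> Z \<subseteq> W1 \<and> Z \<noteq> U"
  have "?good W1" using W1 W1_stable UW1 w by blast
  then obtain Z where Z: "?good Z" and least: "\<And>Z'. ?good Z' \<Longrightarrow> vec.dim Z \<le> vec.dim Z'"
    using ex_has_least_nat[of ?good W1 vec.dim] by blast
  have scalar: "\<exists>\<beta>. \<forall>x\<in>Z. b *v x - \<beta> *s x \<in> U" if b: "b \<in> H" for b
  proof -
    obtain z where "z \<in> Z" "z \<notin> U" using Z by blast
    then obtain \<beta> v where v: "v \<in> Z" "v \<notin> U" "b *v v - \<beta> *s v \<in> U"
      using eigenvector_mod[OF U(1), of Z b z] Z stableD[of H Z b] b by blast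
    \<comment> \<open>A conjugate of \<open>b\<close> is a commutator times \<open>b\<close>, so on
      \<open>E\<close> it acts modulo \<open>U\<close> by \<open>\<beta>\<close> times a value of
      \<open>\<tau>\<close>. This product does not depend on the conjugating element and equals
      \<open>\<beta>\<close> at 1; thus \<open>E\<close> is stable and minimality gives
      \<open>E = Z\<close>.\<close>
    define E where "E = {x \<in> Z. b *v x - \<beta> *s x \<in> U}"
    let ?y = "\<lambda>a. matrix_inv a ** b ** a ** matrix_inv b"
    have yD: "?y a \<in> ?D" if "a \<in> H" for a
      using comm[OF H_inv[OF that] b] det[OF that] by (simp add: matrix_inv_matrix_inv)
    have conj_E: "(matrix_inv a ** b ** a) *v x - (\<beta> * \<tau> (?y a)) *s x \<in> U" if a: "a \<in> H" and x: "x \<in> E" for a x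
    proof -
      have xW: "x \<in> W1" and xb: "b *v x - \<beta> *s x \<in> U" using x Z by (auto simp: E_def)
      have "?y a *v (b *v x - \<beta> *s x) + \<beta> *s (?y a *v x - \<tau> (?y a) *s x) \<in> U"
        using xW yD[OF a] DH
        by (intro vec.subspace_add vec.subspace_scale U(1) stableD[OF U(2)] xb) (auto simp: W1_def)
      also have "?y a *v (b *v x - \<beta> *s x) + \<beta> *s (?y a *v x - \<tau> (?y a) *s x) =
          (?y a ** b) *v x - (\<beta> * \<tau> (?y a)) *s x"
        by (simp add: matrix_vector_mult_diff_distrib vector_scalar_commute matrix_vector_mul_assoc
            vec.scale_right_diff_distrib)
      also have "?y a ** b = matrix_inv a ** b ** a"
        using det[OF b] by (simp add: matrix_inv_det flip: matrix_mul_assoc)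
      finally show ?thesis .
    qed
    have vE: "v \<in> E" using v by (simp add: E_def)
    have \<beta>: "\<beta> * \<tau> (?y a) = \<beta>" if a: "a \<in> H" for a
    proof -
      have "\<beta> * \<tau> (?y a) = \<beta> * \<tau> (?y (mat 1))"
        by (rule conjugate_eigenvalue_constant[OF H U b v(2), of "\<lambda>a. \<beta> * \<tau> (?y a)"])
          (use conj_E vE a in auto)
      moreover have "\<beta> * \<tau> (?y (mat 1)) = \<beta>"
      proof -
        let ?c = "\<beta> * \<tau> (?y (mat 1))"
        have "b *v v - ?c *s v \<in> U" using conj_E[OF one vE] by (simp add: inv_one)
        from vec.subspace_diff[OF U(1) v(3) this] have "(?c - \<beta>) *s v \<in> U"
          by (simp add: vec.scale_left_diff_distrib)
        then show ?thesis using v(2) subspace_cmult_iff[OF U(1), of "?c - \<beta>" v] by auto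
      qed
      ultimately show ?thesis by (rule trans)
    qed
    have "vec.subspace E"
      unfolding vec.subspace_def E_def
    proof (intro conjI ballI allI CollectI)
      fix x c assume x: "x \<in> {x \<in> Z. b *v x - \<beta> *s x \<in> U}"
      show "c *s x \<in> Z" using x Z vec.subspace_scale by blast
      have "c *s (b *v x - \<beta> *s x) \<in> U" using x vec.subspace_scale[OF U(1)] by blast
      then show "b *v (c *s x) - \<beta> *s (c *s x) \<in> U"
        by (simp add: vector_scalar_commute vec.scale_right_diff_distrib mult.commute)
    next
      fix x y assume x: "x \<in> {x \<in> Z. b *v x - \<beta> *s x \<in> U}" and y: "y \<in> {x \<in> Z. b *v x - \<beta> *s x \<in> U}"
      show "x + y \<in> Z" using x y Z vec.subspace_add by blast
      have "(b *v x - \<beta> *s x) + (b *v y - \<beta> *s y) \<in> U" using x y vec.subspace_add[OF U(1)] by blast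
      then show "b *v (x + y) - \<beta> *s (x + y) \<in> U"
        by (simp add: matrix_vector_right_distrib vec.scale_right_distrib algebra_simps)
    qed (use Z vec.subspace_0 vec.subspace_0[OF U(1)] in auto)
    moreover have "stable H E"
      unfolding stable_def
    proof (intro ballI)
      fix a x assume a: "a \<in> H" and x: "x \<in> E"
      have "(matrix_inv a ** b ** a) *v x - \<beta> *s x \<in> U" using conj_E[OF a x] \<beta>[OF a] by simp
      from stableD[OF U(2) a this] have "b *v (a *v x) - \<beta> *s (a *v x) \<in> U" using det[OF a]
        by (simp add: matrix_vector_mult_diff_distrib vector_scalar_commute matrix_vector_mul_assoc
            matrix_mul_assoc matrix_inv_det)
      then show "a *v x \<in> E" using x Z stableD[of H Z a x] a by (auto simp: E_def)
    qed
    moreover have "U \<subseteq> E"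
    proof
      fix u assume u: "u \<in> U"
      have "b *v u - \<beta> *s u \<in> U" by (intro vec.subspace_diff vec.subspace_scale U(1) u stableD[OF U(2) b])
      then show "u \<in> E" using u Z by (auto simp: E_def)
    qed
    moreover have "E \<subseteq> Z" "E \<noteq> U" using vE v(2) by (auto simp: E_def)
    ultimately have "vec.dim Z \<le> vec.dim E" using Z by (intro least) auto
    then have "E = Z" using vec.subspace_dim_equal[of E Z] \<open>vec.subspace E\<close> Z \<open>E \<subseteq> Z\<close> by blast
    then show ?thesis by (auto simp: E_def)
  qed
  obtain z where z: "z \<in> Z" "z \<notin> U" using Z by blast
  then have "z \<in> W - U" using Z by (auto simp: W1_def)
  then show ?case using scalar z by blast
qed


section \<open>Borel subgroups of the special linear group\<close>

lemma matrix_inv_one [simp]: "matrix_inv (mat 1) = (mat 1 :: complex^'n^'n)"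
  by (rule matrix_inv_unique) simp

lemma conj_mult:
  fixes g a b :: "complex^'n^'n"
  assumes "det g \<noteq> 0"
  shows "matrix_inv g ** (a ** b) ** g = (matrix_inv g ** a ** g) ** (matrix_inv g ** b ** g)"
proof -
  have "(matrix_inv g ** a ** g) ** (matrix_inv g ** b ** g) = matrix_inv g ** a ** (g ** matrix_inv g) ** b ** g"
    by (simp add: matrix_mul_assoc)
  then show ?thesis using assms by (simp add: matrix_inv_det matrix_mul_assoc)
qed

lemma conj_inv:
  fixes g a :: "complex^'n^'n"
  assumes "det g = 1" "det a = 1"
  shows "matrix_inv g ** matrix_inv a ** g = matrix_inv (matrix_inv g ** a ** g)"
  using assms
  by (simp add: matrix_inv_mult det_mul det_matrix_inv matrix_inv_matrix_inv matrix_mul_assoc)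

lemma det_conj: "det g = 1 \<Longrightarrow> det (matrix_inv g ** a ** g) = det (a :: complex^'n^'n)"
  by (simp add: det_mul det_matrix_inv)

lemma conj_cancel:
  fixes g a :: "complex^'n^'n"
  assumes "det g = 1"
  shows "matrix_inv g ** (g ** a ** matrix_inv g) ** g = a"
    and "g ** (matrix_inv g ** a ** g) ** matrix_inv g = a"
proof -
  have "matrix_inv g ** (g ** a ** matrix_inv g) ** g = (matrix_inv g ** g) ** a ** (matrix_inv g ** g)"
    by (simp add: matrix_mul_assoc)
  then show "matrix_inv g ** (g ** a ** matrix_inv g) ** g = a" using assms by (simp add: matrix_inv_det)
  have "g ** (matrix_inv g ** a ** g) ** matrix_inv g = (g ** matrix_inv g) ** a ** (g ** matrix_inv g)"
    by (simp add: matrix_mul_assoc)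
  then show "g ** (matrix_inv g ** a ** g) ** matrix_inv g = a" using assms by (simp add: matrix_inv_det)
qed

lemma iterated_derived_subgroup:
  fixes H :: "(complex^'n^'n) set"
  assumes "subgroup H SL"
  shows "(derived (SL\<lparr>carrier := H\<rparr>) ^^ k) H = (derived SL ^^ k) H \<and> (derived SL ^^ k) H \<subseteq> H"
proof (induction k)
  case (Suc k)
  then have sub: "(derived SL ^^ k) H \<subseteq> H" by blast
  show ?case using Suc SL.derived_consistent[OF sub assms] SL.derived_incl[OF sub assms] by simp
qed simp

lemma solvable_SL_iff:
  fixes H :: "(complex^'n^'n) set"
  assumes "subgroup H SL"
  shows "solvable (SL\<lparr>carrier := H\<rparr>) \<longleftrightarrow> (\<exists>k. (derived SL ^^ k) H = {mat 1})"
proof -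
  have "group (SL\<lparr>carrier := H\<rparr>)" by (rule SL.subgroup_imp_group[OF assms])
  from group.solvable_iff_trivial_derived_seq[OF this] show ?thesis
    using iterated_derived_subgroup[OF assms] by simp
qed

section \<open>Triangular groups are closed, connected and solvable\<close>

context ranking
begin

definition level :: "nat \<Rightarrow> complex^'n^'n \<Rightarrow> bool" where
  "level k A \<longleftrightarrow> (\<forall>i j. r j < r i + k \<longrightarrow> A $ i $ j = 0)"

lemma level_zero: "level 0 A \<longleftrightarrow> upper A"
  by (simp add: level_def upper_def)

lemma level_mult:
  assumes "level k A" "level m B" shows "level (k + m) (A ** B)"
  unfolding level_def
proof (intro allI impI)
  fix i j assume ij: "r j < r i + (k + m)"
  have "A $ i $ a * B $ a $ j = 0" for a
  proof (cases "r a < r i + k")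
    case True then show ?thesis using assms(1) by (simp add: level_def)
  next
    case False
    then have "r j < r a + m" using ij by simp
    then show ?thesis using assms(2) by (simp add: level_def)
  qed
  then show "(A ** B) $ i $ j = 0" unfolding matrix_mult_entry by (intro sum.neutral ballI)
qed

lemma level_add: "level k A \<Longrightarrow> level k B \<Longrightarrow> level k (A + B)"
  and level_diff: "level k A \<Longrightarrow> level k B \<Longrightarrow> level k (A - B)"
  by (simp_all add: level_def)

lemma level_mono: "level k A \<Longrightarrow> m \<le> k \<Longrightarrow> level m A"
  unfolding level_def by (metis add_le_cancel_left order_less_le_trans)

lemma upper_one: "upper (mat 1)" by (simp add: upper_def mat_def)

text \<open>A filtration of the triangular group by distance from the diagonal. Index 0 gives the
  Borel subgroup, index 1 its unipotent radical, and index n the trivial group.\<close>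

definition filt :: "complex^'n^'n \<Rightarrow> nat \<Rightarrow> (complex^'n^'n) set" where
  "filt g k = {b. det b = 1 \<and> upper (matrix_inv g ** b ** g) \<and> level k (matrix_inv g ** b ** g - mat 1)}"

abbreviation borel :: "complex^'n^'n \<Rightarrow> (complex^'n^'n) set" where "borel g \<equiv> filt g 0"

lemma borel_iff: "b \<in> borel g \<longleftrightarrow> det b = 1 \<and> upper (matrix_inv g ** b ** g)"
  using upper_one by (auto simp: filt_def level_zero intro: level_diff[of 0, unfolded level_zero])

lemma subgroup_filt:
  assumes g: "det g = 1" shows "subgroup (filt g k) SL"
proof (rule SL.subgroupI)
  show "filt g k \<subseteq> carrier SL" by (auto simp: filt_def carrier_SL)
  have "matrix_inv g ** mat 1 ** g = mat 1" using g by (simp add: matrix_inv_det)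
  then have "mat 1 \<in> filt g k" by (simp add: filt_def upper_one level_def)
  then show "filt g k \<noteq> {}" by blast
  fix a assume a: "a \<in> filt g k"
  let ?A = "matrix_inv g ** a ** g"
  have A: "det a = 1" "det ?A = 1" "upper ?A" "level k (?A - mat 1)" using a g by (auto simp: filt_def det_conj)
  then have iA: "upper (matrix_inv ?A)" by (intro upper_inverse) auto
  have "level (k + 0) ((?A - mat 1) ** matrix_inv ?A)" using A iA by (intro level_mult) (auto simp: level_zero)
  then have "level k (mat 1 - matrix_inv ?A)" using A by (simp add: matrix_diff_rdistrib matrix_inv_det)
  then have "level k (matrix_inv ?A - mat 1)" by (auto simp: level_def)
  then show "inv\<^bsub>SL\<^esub> a \<in> filt g k"
    using A iA g by (simp add: inv_SL carrier_SL filt_def det_matrix_inv conj_inv)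
  fix b assume b: "b \<in> filt g k"
  let ?B = "matrix_inv g ** b ** g"
  have B: "det b = 1" "upper ?B" "level k (?B - mat 1)" using b by (auto simp: filt_def)
  have "level (k + 0) ((?A - mat 1) ** ?B)" using A B by (intro level_mult) (auto simp: level_zero)
  then have "level k ((?A - mat 1) ** ?B + (?B - mat 1))" using B by (intro level_add) auto
  then have "level k (?A ** ?B - mat 1)" by (simp add: matrix_diff_rdistrib)
  then show "a \<otimes>\<^bsub>SL\<^esub> b \<in> filt g k"
    using A B g upper_mult[OF A(3) B(2)] by (simp add: filt_def det_mul conj_mult)
qed

text \<open>A commutator minus 1 is \<open>AB - BA\<close> times a triangular matrix. For
  \<open>k = 0\<close> the diagonals of the two products agree; for \<open>k > 0\<close> the
  difference equals that of the products of \<open>A - 1\<close> and \<open>B - 1\<close>, which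
  lies in level \<open>2 k\<close>.\<close>

lemma derived_filt:
  assumes g: "det g = 1" shows "derived SL (filt g k) \<subseteq> filt g (Suc k)"
  unfolding derived_def
proof (rule SL.generate_subgroup_incl[OF _ subgroup_filt[OF g]])
  show "derived_set SL (filt g k) \<subseteq> filt g (Suc k)"
  proof clarify
    fix a b assume a: "a \<in> filt g k" and b: "b \<in> filt g k"
    let ?A = "matrix_inv g ** a ** g" and ?B = "matrix_inv g ** b ** g"
    have A: "det a = 1" "det ?A = 1" "upper ?A" "level k (?A - mat 1)" using a g by (auto simp: filt_def det_conj)
    have B: "det b = 1" "det ?B = 1" "upper ?B" "level k (?B - mat 1)" using b g by (auto simp: filt_def det_conj)
    have iA: "upper (matrix_inv ?A)" and iB: "upper (matrix_inv ?B)"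
      using A B by (auto intro!: upper_inverse)
    have comm: "level (Suc k) (?A ** ?B - ?B ** ?A)"
    proof (cases k)
      case 0
      have "upper (?A ** ?B - ?B ** ?A)"
        using level_diff[of 0] upper_mult A B by (simp add: level_zero)
      moreover have "(?A ** ?B - ?B ** ?A) $ i $ i = 0" for i
        using A B by (simp add: upper_mult_diag)
      ultimately show ?thesis using 0 unfolding level_def upper_def
        by (metis Suc_eq_plus1 add.right_neutral less_Suc_eq r_eq_iff add_Suc_right)
    next
      case (Suc m)
      have "?A ** ?B - ?B ** ?A = (?A - mat 1) ** (?B - mat 1) - (?B - mat 1) ** (?A - mat 1)"
        by (simp add: matrix_diff_ldistrib matrix_diff_rdistrib)
      moreover have "level (k + k) ((?A - mat 1) ** (?B - mat 1) - (?B - mat 1) ** (?A - mat 1))"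
        by (rule level_diff[OF level_mult[OF A(4) B(4)] level_mult[OF B(4) A(4)]])
      ultimately show ?thesis using Suc by (auto intro: level_mono)
    qed
    let ?C = "matrix_inv ?A ** matrix_inv ?B"
    have "?B ** ?A ** ?C = ?B ** (?A ** matrix_inv ?A) ** matrix_inv ?B" by (simp only: matrix_mul_assoc)
    then have one: "?B ** ?A ** ?C = mat 1" using A(2) B(2) by (simp add: matrix_inv_det)
    have "level (Suc k + 0) ((?A ** ?B - ?B ** ?A) ** ?C)"
      using comm upper_mult[OF iA iB] by (intro level_mult) (auto simp: level_zero)
    then have lev: "level (Suc k) (?A ** ?B ** ?C - mat 1)"
      by (simp only: matrix_diff_rdistrib one add_0_right)
    let ?c = "a ** b ** matrix_inv a ** matrix_inv b"
    have "matrix_inv g ** ?c ** g = ?A ** ?B ** matrix_inv ?A ** matrix_inv ?B"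
      using g A(1) B(1) by (simp only: conj_mult conj_inv[symmetric] zero_neq_one[symmetric] not_False_eq_True simp_thms)
    then have c: "matrix_inv g ** ?c ** g = ?A ** ?B ** ?C" by (simp only: matrix_mul_assoc)
    have "upper (?A ** ?B ** ?C)" by (intro upper_mult A B iA iB)
    then have "?c \<in> filt g (Suc k)"
      using lev A(1) B(1) unfolding filt_def mem_Collect_eq c by (simp add: det_mul det_matrix_inv)
    then show "a \<otimes>\<^bsub>SL\<^esub> b \<otimes>\<^bsub>SL\<^esub> inv\<^bsub>SL\<^esub> a \<otimes>\<^bsub>SL\<^esub> inv\<^bsub>SL\<^esub> b \<in> filt g (Suc k)"
      using A(1) B(1) by (simp add: inv_SL carrier_SL)
  qed
qed

lemma solvable_borel:
  assumes g: "det g = 1" shows "solvable (SL\<lparr>carrier := borel g\<rparr>)"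
proof -
  have sub: "(derived SL ^^ k) (borel g) \<subseteq> filt g k" for k
  proof (induction k)
    case (Suc k)
    then show ?case using SL.mono_derived[OF Suc] derived_filt[OF g, of k] by simp
  qed simp
  have "filt g CARD('n) \<subseteq> {mat 1}"
  proof
    fix b assume b: "b \<in> filt g CARD('n)"
    have "matrix_inv g ** b ** g = mat 1"
      using b r_less by (auto simp: filt_def level_def vec_eq_iff trans_less_add2)
    then have "g ** (matrix_inv g ** b ** g) ** matrix_inv g = mat 1" using g by (simp add: matrix_inv_det)
    then show "b \<in> {mat 1}" using conj_cancel(2)[OF g] by simp
  qed
  moreover have "mat 1 \<in> (derived SL ^^ CARD('n)) (borel g)"
    using subgroup.one_closed[OF SL.exp_of_derived_is_subgroup[OF subgroup_filt[OF g]]] by simp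
  ultimately have "(derived SL ^^ CARD('n)) (borel g) = {mat 1}" using sub[of "CARD('n)"] by blast
  then show ?thesis using solvable_SL_iff[OF subgroup_filt[OF g]] by blast
qed

lemma closed_borel:
  shows "closedin zariski_SL (borel g)"
proof -
  let ?S = "{(i, j). r j < r i}"
  have "carrier SL - borel g = (\<Union>(i, j)\<in>?S. {x \<in> carrier SL. (matrix_inv g ** x ** g) $ i $ j \<noteq> 0})"
    by (auto simp: borel_iff upper_def carrier_SL)
  moreover have "openin zariski_SL {x \<in> carrier SL. (matrix_inv g ** x ** g) $ i $ j \<noteq> 0}" for i j
    by (rule openin_zariski) (intro generated_algebra_matrix_mult generated_algebra.const entry_poly)
  ultimately have "openin zariski_SL (carrier SL - borel g)" by auto
  then show ?thesis by (auto simp: closedin_def borel_iff carrier_SL)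
qed

text \<open>Each element is joined to 1 by a path continuous in the classical sense. Polynomials are
  classically continuous, so the path is also continuous for the Zariski topology.\<close>

lemma connected_borel:
  assumes g: "det g = 1" shows "connectedin zariski_SL (borel g)"
proof -
  have "\<exists>P. connectedin zariski_SL P \<and> mat 1 \<in> P \<and> b \<in> P \<and> P \<subseteq> borel g" if b: "b \<in> borel g" for b
  proof -
    define A where "A = matrix_inv g ** b ** g"
    have A: "upper A" "det A = 1" using b g by (auto simp: borel_iff A_def det_conj)
    then have prod1: "(\<Prod>i\<in>UNIV. A $ i $ i) = 1" by (simp add: upper_det)
    then have nz: "A $ i $ i \<noteq> 0" for i using prod_zero[of UNIV "\<lambda>i. A $ i $ i"] by force
    \<comment> \<open>Logarithms of the diagonal entries, adjusted at the first index so that they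
      sum to 0 exactly; the determinant is then 1 along the whole path.\<close>
    define z where "z i = (if i = first_index then - (\<Sum>k\<in>UNIV - {first_index}. Ln (A $ k $ k)) else Ln (A $ i $ i))" for i
    have sum_z: "(\<Sum>i\<in>UNIV. z i) = 0"
      by (subst sum.remove[of UNIV first_index]) (auto simp: z_def)
    have exp_z: "exp (z i) = A $ i $ i" for i
    proof (cases "i = first_index")
      case True
      have "A $ first_index $ first_index * (\<Prod>k\<in>UNIV - {first_index}. A $ k $ k) = 1"
        using prod1 by (subst (asm) prod.remove[of UNIV first_index]) auto
      moreover have "exp (z first_index) * (\<Prod>k\<in>UNIV - {first_index}. A $ k $ k) = 1"
        by (simp add: z_def exp_minus exp_sum nz)
      ultimately show ?thesis using True nz
        by (metis (no_types, lifting) mult_right_cancel mult_zero_right zero_neq_one)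
    qed (simp add: z_def nz)
    define \<Gamma> where "\<Gamma> s = (\<chi> i j. if i = j then exp (of_real s * z i) else of_real s * A $ i $ j)" for s :: real
    have upper_\<Gamma>: "upper (\<Gamma> s)" for s using A(1) by (auto simp: upper_def \<Gamma>_def)
    have "det (\<Gamma> s) = exp (\<Sum>i\<in>UNIV. of_real s * z i)" for s
      using upper_det[OF upper_\<Gamma>, of s] by (simp add: \<Gamma>_def exp_sum)
    then have det_\<Gamma>: "det (\<Gamma> s) = 1" for s using sum_z by (simp flip: sum_distrib_left)
    have ends: "\<Gamma> 0 = mat 1" "\<Gamma> 1 = A" by (auto simp: \<Gamma>_def vec_eq_iff mat_def exp_z)
    define \<gamma> where "\<gamma> s = g ** \<Gamma> s ** matrix_inv g" for s
    have \<gamma>: "\<gamma> s \<in> borel g" for s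
      using upper_\<Gamma> det_\<Gamma> g by (simp add: borel_iff \<gamma>_def conj_cancel det_mul det_matrix_inv)
    have "continuous_map (top_of_set {0..1}) zariski_SL \<gamma>"
    proof (rule continuous_map_into_zariski)
      fix s show "\<gamma> s \<in> carrier SL" using \<gamma>[of s] by (simp add: borel_iff carrier_SL)
    next
      fix f :: "complex^'n^'n \<Rightarrow> complex" assume f: "f \<in> matrix_polys"
      have "(\<lambda>Y. f (g ** Y ** matrix_inv g)) \<in> matrix_polys"
        by (intro matrix_poly_compose'[OF f] generated_algebra_matrix_mult generated_algebra.const entry_poly)
      then have "continuous_on UNIV (\<lambda>Y. f (g ** Y ** matrix_inv g))" by (rule continuous_matrix_poly)
      moreover have "continuous_on {0..1} \<Gamma>"
        unfolding \<Gamma>_def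
      proof (intro continuous_on_vec_lambda)
        fix i j show "continuous_on {0..1} (\<lambda>s. if i = j then exp (of_real s * z i) else of_real s * A $ i $ j)"
          by (cases "i = j") (auto intro!: continuous_intros)
      qed
      ultimately have "continuous_on {0..1} (\<lambda>s. f (\<gamma> s))"
        unfolding \<gamma>_def by (rule continuous_on_compose2) simp
      from continuous_openin_preimage_gen[OF this, of "- {0}"]
      have "openin (top_of_set {0..1}) ({0..1} \<inter> (\<lambda>s. f (\<gamma> s)) -` (- {0}))" by (simp add: open_Compl)
      also have "{0..1} \<inter> (\<lambda>s. f (\<gamma> s)) -` (- {0}) = {s \<in> topspace (top_of_set {0..1}). f (\<gamma> s) \<noteq> 0}"
        by auto
      finally show "openin (top_of_set {0..1}) {s \<in> topspace (top_of_set {0..1}). f (\<gamma> s) \<noteq> 0}" .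
    qed
    moreover have "connectedin (top_of_set {0..1}) {0..1::real}"
      by (simp add: connectedin_subtopology)
    ultimately have "connectedin zariski_SL (\<gamma> ` {0..1})" by (rule connectedin_continuous_map_image)
    moreover have "mat 1 = \<gamma> 0" using g by (simp add: \<gamma>_def ends matrix_inv_det)
    moreover have "b = \<gamma> 1" using conj_cancel(2)[OF g] by (simp add: \<gamma>_def ends A_def)
    ultimately show ?thesis using \<gamma> by (intro exI[of _ "\<gamma> ` {0..1}"]) auto
  qed
  then have "borel g = \<Union>{P. connectedin zariski_SL P \<and> mat 1 \<in> P \<and> P \<subseteq> borel g}" by blast
  moreover have "connectedin zariski_SL (\<Union>{P. connectedin zariski_SL P \<and> mat 1 \<in> P \<and> P \<subseteq> borel g})"
    by (rule connectedin_Union) auto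
  ultimately show ?thesis by simp
qed

lemma closed_connected_solvable_borel: "det g = 1 \<Longrightarrow> closed_connected_solvable (borel g)"
  unfolding closed_connected_solvable_def
  using subgroup_filt closed_borel connected_borel solvable_borel by blast

text \<open>Each new vector is a common eigenvector modulo the span of the preceding ones, which is
  a proper subspace as long as there are fewer than n of them.\<close>

lemma stable_flag:
  fixes H :: "(complex^'n^'n) set"
  assumes H: "subgroup H SL" "connectedin zariski_SL H" "(derived SL ^^ d) H = {mat 1}"
    and "m \<le> CARD('n)"
  shows "\<exists>v :: nat \<Rightarrow> complex^'n. \<forall>k<m. v k \<notin> vec.span (v ` {..<k}) \<and>
    (\<forall>h\<in>H. h *v v k \<in> vec.span (v ` {..k}))"
  using assms(4)
proof (induction m)
  case (Suc m)
  then obtain v :: "nat \<Rightarrow> complex^'n" where v: "\<And>k. k < m \<Longrightarrow> v k \<notin> vec.span (v ` {..<k})"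
    "\<And>k h. k < m \<Longrightarrow> h \<in> H \<Longrightarrow> h *v v k \<in> vec.span (v ` {..k})" by (auto simp: Suc_le_lessD)
  let ?U = "vec.span (v ` {..<m})"
  have "stable H ?U"
    unfolding stable_def
  proof (intro ballI)
    fix h u assume h: "h \<in> H" and u: "u \<in> ?U"
    from u show "h *v u \<in> ?U"
    proof (induction rule: vec.span_induct_alt)
      case base
      then show ?case by (simp add: vec.span_zero)
    next
      case (step c x y)
      then obtain k where k: "k < m" "x = v k" by blast
      have "vec.span (v ` {..k}) \<subseteq> ?U" using k(1) by (intro vec.span_mono image_mono) auto
      then have "h *v x \<in> ?U" using v(2)[OF k(1) h] k(2) by blast
      then show ?case using step.IH
        by (simp add: matrix_vector_right_distrib vector_scalar_commute vec.span_add vec.span_scale)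
    qed
  qed
  moreover have "?U \<subset> UNIV"
  proof -
    have "vec.dim ?U \<le> card (v ` {..<m})" by (rule vec.dim_le_card) auto
    also have "\<dots> \<le> card {..<m}" by (rule card_image_le) simp
    also have "\<dots> < vec.dim (UNIV :: (complex^'n) set)"
      using Suc.prems by (simp add: vec.dim_UNIV card_cart_basis)
    finally have "?U \<noteq> UNIV" by (metis less_irrefl)
    then show ?thesis by blast
  qed
  ultimately obtain w where w: "w \<in> UNIV - ?U" "\<forall>h\<in>H. \<exists>c. h *v w - c *s w \<in> ?U"
    using common_eigenvector_mod[OF H vec.subspace_span, of "v ` {..<m}" UNIV] vec.subspace_UNIV
    by (auto simp: stable_def)
  let ?v = "v(m := w)"
  have img: "?v ` {..<k} = v ` {..<k}" if "k \<le> m" for k using that by auto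
  have "?v k \<notin> vec.span (?v ` {..<k}) \<and> (\<forall>h\<in>H. h *v ?v k \<in> vec.span (?v ` {..k}))" if k: "k < Suc m" for k
  proof (cases "k = m")
    case True
    have "h *v w \<in> vec.span (insert w (v ` {..<m}))" if h: "h \<in> H" for h
    proof -
      obtain c where c: "h *v w - c *s w \<in> ?U" using w(2) h by blast
      have "h *v w - c *s w \<in> vec.span (insert w (v ` {..<m}))"
        using c vec.span_mono[of "v ` {..<m}" "insert w (v ` {..<m})"] by blast
      from vec.span_add[OF this vec.span_scale[OF vec.span_base[of w], of "insert w (v ` {..<m})" c]]
      show ?thesis by simp
    qed
    moreover have "?v ` {..m} = insert w (v ` {..<m})" by (auto simp: le_less)
    ultimately show ?thesis using True w(1) img[of m] by simp
  next
    case False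
    then have "k < m" using k by simp
    then have "?v ` {..k} = v ` {..k}" by auto
    then show ?thesis using \<open>k < m\<close> v img[of k] by simp
  qed
  then show ?case by blast
qed simp

text \<open>In a basis adapted to a stable flag all elements are triangular;
  \<open>scale_det\<close> then makes the change of basis unimodular.\<close>

lemma lie_kolchin:
  fixes H :: "(complex^'n^'n) set"
  assumes H: "subgroup H SL" "connectedin zariski_SL H" "solvable (SL\<lparr>carrier := H\<rparr>)"
  obtains g where "det g = 1" "H \<subseteq> borel g"
proof -
  obtain d where "(derived SL ^^ d) H = {mat 1}" using H(3) solvable_SL_iff[OF H(1)] by blast
  from stable_flag[OF H(1,2) this order_refl]
  obtain v :: "nat \<Rightarrow> complex^'n" where v: "\<And>k. k < CARD('n) \<Longrightarrow> v k \<notin> vec.span (v ` {..<k})"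
    "\<And>k h. k < CARD('n) \<Longrightarrow> h \<in> H \<Longrightarrow> h *v v k \<in> vec.span (v ` {..k})" by blast
  define f where "f = (\<chi> i j. v (r j) $ i)"
  have fx: "f *v x = (\<Sum>j\<in>UNIV. x $ j *s v (r j))" for x
    by (simp add: f_def vec_eq_iff matrix_vector_mult_def mult.commute)
  \<comment> \<open>In a nontrivial relation, the vector of highest rank would lie in the span of
    its predecessors.\<close>
  have "x = 0" if "f *v x = 0" for x
  proof (rule ccontr)
    assume "x \<noteq> 0"
    then have ne: "{j. x $ j \<noteq> 0} \<noteq> {}" by (auto simp: vec_eq_iff)
    have "Max (r ` {j. x $ j \<noteq> 0}) \<in> r ` {j. x $ j \<noteq> 0}" using ne by (intro Max_in) auto
    then obtain j where j: "x $ j \<noteq> 0" "r j = Max (r ` {j. x $ j \<noteq> 0})" by auto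
    have max: "r i \<le> r j" if "x $ i \<noteq> 0" for i using that unfolding j(2) by (intro Max_ge) auto
    have "x $ j *s v (r j) = - (\<Sum>i\<in>UNIV - {j}. x $ i *s v (r i))"
      using that unfolding fx by (subst (asm) sum.remove[of UNIV j]) (auto simp: eq_neg_iff_add_eq_0)
    moreover have "(\<Sum>i\<in>UNIV - {j}. x $ i *s v (r i)) \<in> vec.span (v ` {..<r j})"
    proof (rule vec.span_sum)
      fix i assume i: "i \<in> UNIV - {j}"
      show "x $ i *s v (r i) \<in> vec.span (v ` {..<r j})"
      proof (cases "x $ i = 0")
        case False
        then have "r i < r j" using max[of i] i by (metis DiffD2 insertI1 le_neq_implies_less r_eq_iff)
        then show ?thesis by (intro vec.span_scale vec.span_base) auto
      qed (simp add: vec.span_zero)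
    qed
    ultimately have "x $ j *s v (r j) \<in> vec.span (v ` {..<r j})" using vec.span_neg by metis
    then have "v (r j) \<in> vec.span (v ` {..<r j})"
      using subspace_cmult_iff[OF vec.subspace_span j(1)] by blast
    then show False using v(1) r_less by blast
  qed
  then have "\<exists>B. B ** f = mat 1" by (simp add: matrix_left_invertible_ker)
  then have det_f: "det f \<noteq> 0" by (metis det_I det_mul mult_zero_right zero_neq_one)
  have comb: "\<exists>x. (\<forall>i. k < r i \<longrightarrow> x $ i = 0) \<and> y = f *v x" if "y \<in> vec.span (v ` {..k})" "k < CARD('n)" for y k
    using that(1)
  proof (induction rule: vec.span_induct_alt)
    case base
    show ?case by (rule exI[of _ 0]) simp
  next
    case (step c z y)
    then obtain a x where a: "a \<le> k" "z = v a" and x: "\<forall>i. k < r i \<longrightarrow> x $ i = 0" "y = f *v x" by auto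
    have ra: "r (at_rank a) = a" using a(1) that(2) by (intro r_at_rank) simp
    have "f *v axis (at_rank a) 1 = (\<Sum>j\<in>UNIV. if j = at_rank a then v a else 0)"
      unfolding fx by (rule sum.cong) (auto simp: axis_def ra)
    then have "f *v axis (at_rank a) 1 = z" using a by simp
    then have "c *s z + y = f *v (c *s axis (at_rank a) 1 + x)"
      by (simp add: matrix_vector_right_distrib vector_scalar_commute x)
    moreover have "\<forall>i. k < r i \<longrightarrow> (c *s axis (at_rank a) 1 + x) $ i = 0"
      using x a ra by (auto simp: axis_def)
    ultimately show ?case by blast
  qed
  have upper: "upper (matrix_inv f ** h ** f)" if h: "h \<in> H" for h
    unfolding upper_def
  proof (intro allI impI)
    fix i j assume ij: "r j < r i"
    obtain x where x: "\<forall>i. r j < r i \<longrightarrow> x $ i = 0" "h *v v (r j) = f *v x"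
      using comb[OF v(2)[OF r_less h] r_less] by blast
    have "f *v axis j 1 = (\<Sum>l\<in>UNIV. if l = j then v (r j) else 0)"
      unfolding fx by (rule sum.cong) (auto simp: axis_def)
    then have "(matrix_inv f ** h ** f) *v axis j 1 = matrix_inv f *v (h *v v (r j))"
      by (simp flip: matrix_vector_mul_assoc)
    also have "\<dots> = x" using det_f by (simp add: x(2) matrix_vector_mul_assoc matrix_inv_det)
    finally have "((matrix_inv f ** h ** f) *v axis j 1) $ i = 0" using x(1) ij by simp
    then show "(matrix_inv f ** h ** f) $ i $ j = 0"
      by (simp add: matrix_vector_mult_def axis_def if_distrib[of "\<lambda>x. _ * x"] cong: if_cong)
  qed
  obtain g where g: "det g = 1" "\<And>X. matrix_inv g ** X ** g = matrix_inv f ** X ** f"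
    using scale_det[OF det_f] by metis
  have "H \<subseteq> borel g"
    using upper subgroup.subset[OF H(1)] by (auto simp: borel_iff g(2) carrier_SL)
  then show ?thesis using that g(1) by blast
qed

text \<open>Lie-Kolchin places \<open>B\<close> in a triangular group, which is itself closed,
  connected and solvable; maximality of \<open>B\<close> gives equality.\<close>

theorem borel_subgroup_conjugate:
  assumes "borel_subgroup B"
  obtains g where "det g = 1" "B = borel g"
proof -
  have "closed_connected_solvable B" using assms by (simp add: borel_subgroup_def)
  then obtain g where g: "det g = 1" "B \<subseteq> borel g"
    unfolding closed_connected_solvable_def using lie_kolchin by metis
  then have "borel g = B"
    using assms closed_connected_solvable_borel[OF g(1)] unfolding borel_subgroup_def by blast
  then show ?thesis using that g(1) by blast
qed

end


section \<open>Lie algebras of Borel subgroups\<close>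

lemma matrix_scaleR_left: "(c *\<^sub>R A) ** B = c *\<^sub>R (A ** (B :: complex^'n^'n))"
  and matrix_scaleR_right: "A ** (c *\<^sub>R B) = c *\<^sub>R (A ** (B :: complex^'n^'n))"
  by (simp_all add: vec_eq_iff matrix_mult_entry scaleR_sum_right)

lemma matrix_add_rdistrib: "(A + B) ** C = A ** C + B ** (C :: complex^'n^'n)"
  by (simp add: vec_eq_iff matrix_mult_entry distrib_right sum.distrib)

lemma bounded_bilinear_matrix_mult:
  "bounded_bilinear ((**) :: complex^'n^'n \<Rightarrow> complex^'n^'n \<Rightarrow> complex^'n^'n)"
proof -
  have "bilinear ((**) :: complex^'n^'n \<Rightarrow> complex^'n^'n \<Rightarrow> complex^'n^'n)"
    unfolding bilinear_def
    by (auto intro!: linearI simp: matrix_add_ldistrib matrix_add_rdistrib matrix_scaleR_left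
        matrix_scaleR_right)
  then show ?thesis by (simp add: bilinear_conv_bounded_bilinear)
qed

lemma lie_algebra_line:
  assumes "\<And>s :: real. mat 1 + s *\<^sub>R V \<in> G" shows "V \<in> lie_algebra G"
proof -
  have deriv: "((\<lambda>s :: real. mat 1 + s *\<^sub>R V) has_vector_derivative V) (at s)" for s
    by (auto intro!: derivative_eq_intros)
  then have "(\<lambda>s :: real. mat 1 + s *\<^sub>R V) differentiable_on UNIV"
    unfolding differentiable_on_def using differentiableI_vector by auto
  then show ?thesis unfolding lie_algebra_def
    using assms deriv[of 0] by (intro CollectI exI[of _ "\<lambda>s :: real. mat 1 + s *\<^sub>R V"]) auto
qed

text \<open>The pointwise product of two curves through 1 has the sum of their velocities, by the
  Leibniz rule.\<close>

lemma lie_algebra_add: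
  fixes G :: "(complex^'n^'n) set"
  assumes G: "subgroup G SL" and X: "X \<in> lie_algebra G" and Y: "Y \<in> lie_algebra G"
  shows "X + Y \<in> lie_algebra G"
proof -
  obtain \<gamma> :: "real \<Rightarrow> complex^'n^'n" where \<gamma>: "\<gamma> differentiable_on UNIV" "range \<gamma> \<subseteq> G" "\<gamma> 0 = mat 1"
    "(\<gamma> has_vector_derivative X) (at 0)" using X by (auto simp: lie_algebra_def)
  obtain \<delta> :: "real \<Rightarrow> complex^'n^'n" where \<delta>: "\<delta> differentiable_on UNIV" "range \<delta> \<subseteq> G" "\<delta> 0 = mat 1"
    "(\<delta> has_vector_derivative Y) (at 0)" using Y by (auto simp: lie_algebra_def)
  have prod: "((\<lambda>s. \<gamma> s ** \<delta> s) has_vector_derivative (\<gamma> s ** D' + C' ** \<delta> s)) (at s)"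
    if "(\<gamma> has_vector_derivative C') (at s)" "(\<delta> has_vector_derivative D') (at s)" for s C' D'
    by (rule bounded_bilinear.has_vector_derivative[OF bounded_bilinear_matrix_mult that])
  have "(\<lambda>s. \<gamma> s ** \<delta> s) differentiable_on UNIV"
    unfolding differentiable_on_def
  proof
    fix s
    have "\<gamma> differentiable (at s)" "\<delta> differentiable (at s)"
      using \<gamma>(1) \<delta>(1) by (auto simp: differentiable_on_def)
    then show "(\<lambda>s. \<gamma> s ** \<delta> s) differentiable (at s)"
      using prod differentiableI_vector unfolding vector_derivative_works by blast
  qed
  moreover have "range (\<lambda>s. \<gamma> s ** \<delta> s) \<subseteq> G"
    using subgroup.m_closed[OF G] \<gamma>(2) \<delta>(2) by (auto simp: image_subset_iff)
  moreover have "((\<lambda>s. \<gamma> s ** \<delta> s) has_vector_derivative (X + Y)) (at 0)"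
    using prod[OF \<gamma>(4) \<delta>(4)] by (simp add: \<gamma>(3) \<delta>(3) add.commute)
  ultimately show ?thesis unfolding lie_algebra_def
    by (intro CollectI exI[of _ "\<lambda>s. \<gamma> s ** \<delta> s"]) (simp add: \<gamma>(3) \<delta>(3))
qed

lemma lie_algebra_zero: "subgroup G SL \<Longrightarrow> 0 \<in> lie_algebra G"
  using subgroup.one_closed[of G SL] by (intro lie_algebra_line) simp

lemma lie_algebra_sum:
  assumes "subgroup G SL" "\<And>p. p \<in> P \<Longrightarrow> f p \<in> lie_algebra G"
  shows "(\<Sum>p\<in>P. f p) \<in> lie_algebra G"
  using assms(2)
  by (induction P rule: infinite_finite_induct)
    (auto intro: lie_algebra_zero lie_algebra_add assms(1))

text \<open>A linear function constant on the group has derivative zero along every curve in it.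
  This bounds the Lie algebra from above without any closedness of the group.\<close>

lemma lie_algebra_constant_entry:
  fixes A C :: "complex^'n^'n"
  assumes X: "X \<in> lie_algebra G" and const: "\<And>b. b \<in> G \<Longrightarrow> (A ** b ** C) $ i $ j = c"
  shows "(A ** X ** C) $ i $ j = 0"
proof -
  obtain \<gamma> :: "real \<Rightarrow> complex^'n^'n" where \<gamma>: "range \<gamma> \<subseteq> G" "(\<gamma> has_vector_derivative X) (at 0)"
    using X by (auto simp: lie_algebra_def)
  have "bounded_linear (\<lambda>Y :: complex^'n^'n. A ** Y ** C)"
    unfolding linear_conv_bounded_linear[symmetric]
    by (intro linearI)
      (simp_all add: matrix_add_ldistrib matrix_add_rdistrib matrix_scaleR_left matrix_scaleR_right)
  from bounded_linear.has_vector_derivative[OF this \<gamma>(2)]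
  have "((\<lambda>s. A ** \<gamma> s ** C) has_vector_derivative (A ** X ** C)) (at 0)" .
  from bounded_linear.has_vector_derivative[OF bounded_linear_vec_nth this, of i]
  have "((\<lambda>s. (A ** \<gamma> s ** C) $ i) has_vector_derivative (A ** X ** C) $ i) (at 0)" .
  from bounded_linear.has_vector_derivative[OF bounded_linear_vec_nth this, of j]
  have "((\<lambda>s. (A ** \<gamma> s ** C) $ i $ j) has_vector_derivative (A ** X ** C) $ i $ j) (at 0)" .
  moreover have "(\<lambda>s. (A ** \<gamma> s ** C) $ i $ j) = (\<lambda>s. c)" using const \<gamma>(1) by (auto simp: fun_eq_iff)
  ultimately have "((\<lambda>s :: real. c) has_vector_derivative (A ** X ** C) $ i $ j) (at 0)" by simp
  moreover have "((\<lambda>s :: real. c) has_vector_derivative 0) (at 0)" by simp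
  ultimately show ?thesis by (rule vector_derivative_unique_at)
qed

context ranking
begin

lemma lie_algebra_borel_upper:
  assumes "X \<in> lie_algebra (borel g)" shows "upper (matrix_inv g ** X ** g)"
  unfolding upper_def
proof (intro allI impI)
  fix i j assume "r j < r i"
  then show "(matrix_inv g ** X ** g) $ i $ j = 0"
    by (intro lie_algebra_constant_entry[OF assms, of _ _ _ _ 0]) (auto simp: borel_iff upper_def)
qed

definition unit_entry :: "'n \<Rightarrow> 'n \<Rightarrow> complex \<Rightarrow> complex^'n^'n" where
  "unit_entry i j x = (\<chi> a b. if a = i \<and> b = j then x else 0)"

lemma unit_entry_mult:
  assumes "i \<noteq> j"
  shows "(mat 1 + unit_entry i j x) ** (mat 1 + unit_entry i j y) = mat 1 + unit_entry i j (x + y)"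
proof -
  have "unit_entry i j x ** unit_entry i j y = 0"
    using assms by (auto simp: vec_eq_iff matrix_mult_entry unit_entry_def intro!: sum.neutral)
  moreover have "unit_entry i j x + unit_entry i j y = unit_entry i j (x + y)"
    by (simp add: vec_eq_iff unit_entry_def)
  ultimately show ?thesis by (simp add: matrix_add_ldistrib matrix_add_rdistrib add.assoc)
qed

lemma upper_elementary: "r i < r j \<Longrightarrow> upper (mat 1 + unit_entry i j x)"
  by (auto simp: upper_def mat_def unit_entry_def)

lemma det_elementary:
  assumes "r i < r j" shows "det (mat 1 + unit_entry i j x) = 1"
proof -
  have "(mat 1 + unit_entry i j x) $ k $ k = 1" for k using assms by (auto simp: mat_def unit_entry_def)
  then show ?thesis using upper_det[OF upper_elementary[OF assms]] by simp
qed

text \<open>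
  An elementary matrix is the commutator of a diagonal matrix with distinct entries and an
  elementary matrix.
\<close>

lemma elementary_in_derived:
  assumes g: "det g = 1" and ij: "r i < r j"
  shows "g ** (mat 1 + unit_entry i j x) ** matrix_inv g \<in> derived SL (borel g)"
proof -
  \<comment> \<open>Exponents that are pairwise distinct and sum to 0, so that the diagonal matrix
    with entries \<open>exp (e k)\<close> is unimodular with distinct entries.\<close>
  define e where "e k = real CARD('n) - 1 - 2 * real (r k)" for k
  define t :: "complex^'n^'n" where "t = diagonal (\<lambda>k. of_real (exp (e k)))"
  have "(\<Sum>k\<in>UNIV. real (r k)) = (\<Sum>m<CARD('n). real m)"
    using sum.reindex_bij_betw[OF bij_r, of real] by simp
  also have "\<dots> = real CARD('n) * (real CARD('n) - 1) / 2"
  proof -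
    have "(\<Sum>m<N. real m) = real N * (real N - 1) / 2" for N
      by (induction N) (simp_all add: field_simps)
    then show ?thesis .
  qed
  finally have "(\<Sum>k\<in>UNIV. e k) = 0" by (simp add: e_def sum_subtractf flip: sum_distrib_left)
  then have "(\<Prod>k\<in>UNIV. exp (e k)) = 1" using exp_sum[of UNIV e] by simp
  then have det_t: "det t = 1" by (simp add: t_def det_diagonal_prod flip: of_real_prod)
  have "upper t" by (auto simp: t_def diagonal_def upper_def)
  let ?d = "exp (e i) / exp (e j) - 1"
  have "e i \<noteq> e j" using ij by (auto simp: e_def)
  then have "?d \<noteq> 0" by simp
  \<comment> \<open>Commutation with the diagonal matrix multiplies the off-diagonal entry by
    \<open>?d\<close>; dividing beforehand produces exactly \<open>x\<close>.\<close>
  define y where "y = x / of_real ?d"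
  let ?u = "mat 1 + unit_entry i j y" and ?x = "mat 1 + unit_entry i j x"
  have ne: "i \<noteq> j" using ij by auto
  have inv_u: "matrix_inv ?u = mat 1 + unit_entry i j (- y)"
    by (rule matrix_inv_unique) (simp add: unit_entry_mult[OF ne], simp add: unit_entry_def vec_eq_iff)
  have "of_real (exp (e i)) * y = (x + y) * of_real (exp (e j))"
  proof -
    have "x = y * of_real ?d" using \<open>?d \<noteq> 0\<close> by (simp add: y_def)
    then show ?thesis by (simp add: algebra_simps)
  qed
  then have "t ** ?u = (mat 1 + unit_entry i j (x + y)) ** t"
    by (auto simp: vec_eq_iff t_def diagonal_mult mat_def unit_entry_def)
  then have "t ** ?u ** matrix_inv t = (mat 1 + unit_entry i j (x + y)) ** (t ** matrix_inv t)"
    by (simp add: matrix_mul_assoc)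
  then have "t ** ?u ** matrix_inv t ** matrix_inv ?u = ?x"
    using det_t by (simp add: matrix_inv_det inv_u unit_entry_mult[OF ne])
  moreover
  let ?c = "\<lambda>a. g ** a ** matrix_inv g"
  have hom: "?c (a ** b) = ?c a ** ?c b" for a b
  proof -
    have "?c a ** ?c b = g ** a ** (matrix_inv g ** g) ** b ** matrix_inv g" by (simp only: matrix_mul_assoc)
    then show ?thesis using g by (simp add: matrix_inv_det matrix_mul_assoc)
  qed
  have inv_c: "matrix_inv (?c a) = ?c (matrix_inv a)" if "det a = 1" for a
    using that g by (simp add: matrix_inv_mult det_mul det_matrix_inv matrix_inv_matrix_inv matrix_mul_assoc)
  have borel_c: "?c a \<in> borel g" if "upper a" "det a = 1" for a
    using that g by (simp add: borel_iff conj_cancel det_mul det_matrix_inv)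
  have "?c t ** ?c ?u ** matrix_inv (?c t) ** matrix_inv (?c ?u) \<in> derived SL (borel g)"
    using subgroup.subset[OF subgroup_filt[OF g]] \<open>upper t\<close> det_t upper_elementary[OF ij] det_elementary[OF ij]
    by (intro commutator_in_derived borel_c) auto
  moreover have "?c t ** ?c ?u ** matrix_inv (?c t) ** matrix_inv (?c ?u) =
      ?c (t ** ?u ** matrix_inv t ** matrix_inv ?u)"
    by (simp only: hom inv_c[OF det_t] inv_c[OF det_elementary[OF ij]])
  ultimately show ?thesis by simp
qed

lemma conj_sum:
  fixes f :: "'p \<Rightarrow> complex^'n^'n" and A C :: "complex^'n^'n"
  shows "A ** (\<Sum>p\<in>P. f p) ** C = (\<Sum>p\<in>P. A ** f p ** C)"
  by (induction P rule: infinite_finite_induct)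
    (auto simp: matrix_add_ldistrib matrix_add_rdistrib)

text \<open>Commutators have unit diagonal after conjugation, which bounds the Lie algebra from
  above. Conversely, lines of elementary matrices lie in the derived group, and their velocities add
  up to every strictly triangular matrix.\<close>

theorem lie_algebra_derived_borel:
  assumes g: "det g = 1"
  shows "lie_algebra (derived SL (borel g)) = (\<lambda>Y. g ** Y ** matrix_inv g) ` {Y. level 1 Y}"
proof
  have D: "subgroup (derived SL (borel g)) SL"
    by (rule SL.derived_is_subgroup[OF subgroup.subset[OF subgroup_filt[OF g]]])
  show "lie_algebra (derived SL (borel g)) \<subseteq> (\<lambda>Y. g ** Y ** matrix_inv g) ` {Y. level 1 Y}"
  proof
    fix X assume X: "X \<in> lie_algebra (derived SL (borel g))"
    have "level 1 (matrix_inv g ** X ** g)"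
      unfolding level_def
    proof (intro allI impI)
      fix i j assume ij: "r j < r i + 1"
      show "(matrix_inv g ** X ** g) $ i $ j = 0"
      proof (rule lie_algebra_constant_entry[OF X])
        fix b assume "b \<in> derived SL (borel g)"
        then have "level 1 (matrix_inv g ** b ** g - mat 1)" using derived_filt[OF g, of 0] by (auto simp: filt_def)
        then show "(matrix_inv g ** b ** g) $ i $ j = mat 1 $ i $ j" using ij by (simp add: level_def)
      qed
    qed
    then show "X \<in> (\<lambda>Y. g ** Y ** matrix_inv g) ` {Y. level 1 Y}"
      using conj_cancel(2)[OF g, of X] by (intro image_eqI[of _ _ "matrix_inv g ** X ** g"]) auto
  qed
  show "(\<lambda>Y. g ** Y ** matrix_inv g) ` {Y. level 1 Y} \<subseteq> lie_algebra (derived SL (borel g))"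
  proof clarify
    fix Y assume Y: "level 1 Y"
    have "g ** unit_entry i j (Y $ i $ j) ** matrix_inv g \<in> lie_algebra (derived SL (borel g))" for i j
    proof (cases "r i < r j")
      case True
      show ?thesis
      proof (rule lie_algebra_line)
        fix s :: real
        have "s *\<^sub>R unit_entry i j (Y $ i $ j) = unit_entry i j (of_real s * Y $ i $ j)"
          by (simp add: vec_eq_iff unit_entry_def) (simp add: scaleR_conv_of_real)
        moreover have "mat 1 + s *\<^sub>R (g ** unit_entry i j (Y $ i $ j) ** matrix_inv g) =
            g ** (mat 1 + s *\<^sub>R unit_entry i j (Y $ i $ j)) ** matrix_inv g"
          using g by (simp add: matrix_add_ldistrib matrix_add_rdistrib matrix_inv_det
              matrix_scaleR_left matrix_scaleR_right)
        ultimately have "mat 1 + s *\<^sub>R (g ** unit_entry i j (Y $ i $ j) ** matrix_inv g) =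
            g ** (mat 1 + unit_entry i j (of_real s * Y $ i $ j)) ** matrix_inv g" by simp
        then show "mat 1 + s *\<^sub>R (g ** unit_entry i j (Y $ i $ j) ** matrix_inv g) \<in> derived SL (borel g)"
          using elementary_in_derived[OF g True] by simp
      qed
    next
      case False
      then have "unit_entry i j (Y $ i $ j) = 0" using Y by (simp add: level_def unit_entry_def vec_eq_iff)
      then show ?thesis using lie_algebra_zero[OF D] by simp
    qed
    then have "(\<Sum>p\<in>UNIV. g ** unit_entry (fst p) (snd p) (Y $ fst p $ snd p) ** matrix_inv g)
        \<in> lie_algebra (derived SL (borel g))" by (intro lie_algebra_sum[OF D])
    moreover have "(\<Sum>p\<in>UNIV. unit_entry (fst p) (snd p) (Y $ fst p $ snd p)) = Y"
    proof -
      have "(\<Sum>p\<in>UNIV. unit_entry (fst p) (snd p) (Y $ fst p $ snd p) $ a $ b) =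
          (\<Sum>p\<in>UNIV. if p = (a, b) then Y $ a $ b else 0)" for a b
        by (rule sum.cong) (auto simp: unit_entry_def)
      then show ?thesis by (simp add: vec_eq_iff)
    qed
    ultimately show "g ** Y ** matrix_inv g \<in> lie_algebra (derived SL (borel g))"
      by (simp add: conj_sum[symmetric])
  qed
qed

text \<open>\<open>X0\<close> is triangular for the same flag, so adding all strictly triangular
  matrices retains only its diagonal.\<close>

lemma points_level_variety:
  assumes g: "det g = 1" and X0: "X0 \<in> lie_algebra (borel g)"
  shows "points (level_variety (borel g) X0) = carrier SL \<times>
    (\<lambda>Y. g ** Y ** matrix_inv g) ` slice (\<lambda>i. (matrix_inv g ** X0 ** g) $ i $ i)"
proof -
  let ?X = "matrix_inv g ** X0 ** g" and ?c = "\<lambda>Y. g ** Y ** matrix_inv g"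
  have upper: "upper ?X" by (rule lie_algebra_borel_upper[OF X0])
  have "slice (\<lambda>i. ?X $ i $ i) = (\<lambda>Y. ?X + Y) ` {Y. level 1 Y}"
  proof
    show "slice (\<lambda>i. ?X $ i $ i) \<subseteq> (\<lambda>Y. ?X + Y) ` {Y. level 1 Y}"
    proof
      fix Z assume Z: "Z \<in> slice (\<lambda>i. ?X $ i $ i)"
      have "level 1 (Z - ?X)"
        using Z upper by (auto simp: level_def slice_def upper_def less_Suc_eq)
      then show "Z \<in> (\<lambda>Y. ?X + Y) ` {Y. level 1 Y}" by (intro image_eqI[of _ _ "Z - ?X"]) auto
    qed
    show "(\<lambda>Y. ?X + Y) ` {Y. level 1 Y} \<subseteq> slice (\<lambda>i. ?X $ i $ i)"
      using upper by (auto simp: level_def slice_def upper_def)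
  qed
  then have "?c ` slice (\<lambda>i. ?X $ i $ i) = (\<lambda>Y. ?c (?X + Y)) ` {Y. level 1 Y}" by (simp add: image_image)
  also have "\<dots> = (\<lambda>Y. X0 + Y) ` (?c ` {Y. level 1 Y})"
    by (simp add: image_image matrix_add_ldistrib matrix_add_rdistrib conj_cancel(2)[OF g])
  finally show ?thesis
    by (simp add: level_variety_def affine_variety_def lie_algebra_derived_borel[OF g])
qed

end


section \<open>Spectra and isomorphisms of varieties\<close>

lemma topspace_zariski_space:
  assumes "(\<lambda>x\<in>points V. 1) \<in> coord V" shows "topspace (zariski V) = points V"
proof -
  have "points V = {x \<in> points V. (\<lambda>x\<in>points V. 1) x \<noteq> (0::complex)}" by auto
  then show ?thesis using assms unfolding zariski_def topology_generated_by_topspace by blast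
qed

lemma continuous_map_zariski:
  assumes one: "(\<lambda>x\<in>points V. 1) \<in> coord V" "(\<lambda>x\<in>points W. 1) \<in> coord W"
    and F: "F ` points V \<subseteq> points W"
    and pull: "\<And>h. h \<in> coord W \<Longrightarrow> \<exists>f\<in>coord V. \<forall>x\<in>points V. f x = h (F x)"
  shows "continuous_map (zariski V) (zariski W) F"
  unfolding zariski_def[of W]
proof (rule continuous_on_generated_topo)
  fix U assume "U \<in> (\<lambda>f. {x \<in> points W. f x \<noteq> 0}) ` coord W"
  then obtain h where h: "h \<in> coord W" "U = {x \<in> points W. h x \<noteq> 0}" by blast
  obtain f where f: "f \<in> coord V" "\<forall>x\<in>points V. f x = h (F x)" using pull[OF h(1)] by blast
  have "F -` U \<inter> topspace (zariski V) = {x \<in> points V. f x \<noteq> 0}"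
    using F f h(2) by (auto simp: topspace_zariski_space[OF one(1)])
  then show "openin (zariski V) (F -` U \<inter> topspace (zariski V))"
    using f(1) unfolding zariski_def by (auto intro: topology_generated_by_Basis)
next
  have "\<Union> ((\<lambda>f. {x \<in> points W. f x \<noteq> 0}) ` coord W) = points W"
    using topspace_zariski_space[OF one(2)] unfolding zariski_def by simp
  then show "F ` topspace (zariski V) \<subseteq> \<Union> ((\<lambda>f. {x \<in> points W. f x \<noteq> 0}) ` coord W)"
    using F by (simp add: topspace_zariski_space[OF one(1)])
qed

text \<open>Both the topology and the local fractions are built from \<open>coord\<close>, so a
  bijection matching the global coordinate algebras matches the sheaves of regular functions as
  well.\<close>

lemma variety_iso_of_coord_iso:
  assumes bij: "bij_betw F (points V) (points W)"
    and coord: "coord V = (\<lambda>h. \<lambda>x\<in>points V. h (F x)) ` coord W"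
    and oneW: "(\<lambda>x\<in>points W. 1) \<in> coord W"
  shows "variety_iso V W F"
proof -
  define G where "G = inv_into (points V) F"
  have F: "F x \<in> points W" if "x \<in> points V" for x using bij that by (auto simp: bij_betw_def)
  have G: "G y \<in> points V" "F (G y) = y" if "y \<in> points W" for y
    using bij that by (auto simp: G_def bij_betw_def inv_into_into f_inv_into_f)
  have GF: "G (F x) = x" if "x \<in> points V" for x
    using bij that by (auto simp: G_def bij_betw_def)
  have "(\<lambda>x\<in>points V. (\<lambda>x\<in>points W. 1) (F x)) \<in> coord V" unfolding coord using oneW by blast
  moreover have "(\<lambda>x\<in>points V. (\<lambda>x\<in>points W. 1) (F x)) = (\<lambda>x\<in>points V. 1 :: complex)"
    using F by (auto simp: restrict_def fun_eq_iff)
  ultimately have oneV: "(\<lambda>x\<in>points V. 1) \<in> coord V" by simp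
  have pull: "(\<lambda>x\<in>points V. h (F x)) \<in> coord V" if "h \<in> coord W" for h
    unfolding coord using that by blast
  have contF: "continuous_map (zariski V) (zariski W) F"
  proof (rule continuous_map_zariski[OF oneV oneW])
    fix h assume "h \<in> coord W"
    then show "\<exists>f\<in>coord V. \<forall>x\<in>points V. f x = h (F x)" by (intro bexI[OF _ pull]) auto
  qed (use F in blast)
  have contG: "continuous_map (zariski W) (zariski V) G"
  proof (rule continuous_map_zariski[OF oneW oneV])
    fix f assume "f \<in> coord V"
    then obtain h where h: "h \<in> coord W" "f = (\<lambda>x\<in>points V. h (F x))" unfolding coord by blast
    then show "\<exists>h\<in>coord W. \<forall>y\<in>points W. h y = f (G y)"
      using G by (intro bexI[OF _ h(1)]) simp
  qed (use G in blast)
  have homeo: "homeomorphic_map (zariski V) (zariski W) F"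
    unfolding homeomorphic_map_maps homeomorphic_maps_def
      topspace_zariski_space[OF oneV] topspace_zariski_space[OF oneW]
    using contF contG G(2) GF by blast
  have "regular_on W U h \<longleftrightarrow> regular_on V {x \<in> points V. F x \<in> U} (\<lambda>x. h (F x))"
    if U: "openin (zariski W) U" for U h
  proof
    assume reg: "regular_on W U h"
    show "regular_on V {x \<in> points V. F x \<in> U} (\<lambda>x. h (F x))"
      unfolding regular_on_def
    proof
      fix x assume "x \<in> {x \<in> points V. F x \<in> U}"
      then have x: "x \<in> points V" "F x \<in> U" by auto
      obtain W' where W'_ex: "openin (zariski W) W'" "F x \<in> W'" "W' \<subseteq> U"
        "\<exists>a\<in>coord W. \<exists>b\<in>coord W. \<forall>y\<in>W'. b y \<noteq> 0 \<and> h y = a y / b y"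
        using bspec[OF reg[unfolded regular_on_def] x(2)] by (elim exE conjE)
      then obtain a b where "a \<in> coord W" "b \<in> coord W" "\<forall>y\<in>W'. b y \<noteq> 0 \<and> h y = a y / b y" by blast
      note W' = W'_ex(1-3) this
      have "openin (zariski V) {x \<in> points V. F x \<in> W'}"
        using openin_continuous_map_preimage[OF contF W'(1)] by (simp add: topspace_zariski_space[OF oneV])
      then show "\<exists>W. openin (zariski V) W \<and> x \<in> W \<and> W \<subseteq> {x \<in> points V. F x \<in> U} \<and>
          (\<exists>a\<in>coord V. \<exists>b\<in>coord V. \<forall>y\<in>W. b y \<noteq> 0 \<and> h (F y) = a y / b y)"
        using W' x
        by (intro exI[of _ "{x \<in> points V. F x \<in> W'}"] conjI bexI[OF _ pull[OF W'(4)]]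
            bexI[OF _ pull[OF W'(5)]]) auto
    qed
  next
    assume reg: "regular_on V {x \<in> points V. F x \<in> U} (\<lambda>x. h (F x))"
    show "regular_on W U h"
      unfolding regular_on_def
    proof
      fix y assume y: "y \<in> U"
      then have yW: "y \<in> points W" using openin_subset[OF U] topspace_zariski_space[OF oneW] by auto
      then have "G y \<in> {x \<in> points V. F x \<in> U}" using G y by simp
      from bspec[OF reg[unfolded regular_on_def] this]
      obtain V' where V'_ex: "openin (zariski V) V'" "G y \<in> V'" "V' \<subseteq> {x \<in> points V. F x \<in> U}"
        "\<exists>a\<in>coord V. \<exists>b\<in>coord V. \<forall>x\<in>V'. b x \<noteq> 0 \<and> h (F x) = a x / b x"
        by (elim exE conjE)
      then obtain a b where "a \<in> coord V" "b \<in> coord V" "\<forall>x\<in>V'. b x \<noteq> 0 \<and> h (F x) = a x / b x" by blast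
      note V' = V'_ex(1-3) this
      obtain a' b' where ab: "a' \<in> coord W" "a = (\<lambda>x\<in>points V. a' (F x))"
        "b' \<in> coord W" "b = (\<lambda>x\<in>points V. b' (F x))" using V'(4,5) unfolding coord by blast
      have op: "openin (zariski W) {y \<in> points W. G y \<in> V'}"
        using openin_continuous_map_preimage[OF contG V'(1)] by (simp add: topspace_zariski_space[OF oneW])
      have "b' z \<noteq> 0 \<and> h z = a' z / b' z" if "z \<in> points W" "G z \<in> V'" for z
        using V'(6)[rule_format, OF that(2)] G[OF that(1)] ab by simp
      moreover have "{y \<in> points W. G y \<in> V'} \<subseteq> U" using V'(3) G by auto
      ultimately show "\<exists>W'. openin (zariski W) W' \<and> y \<in> W' \<and> W' \<subseteq> U \<and>
          (\<exists>a\<in>coord W. \<exists>b\<in>coord W. \<forall>y\<in>W'. b y \<noteq> 0 \<and> h y = a y / b y)"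
        using op V'(2) yW ab(1,3)
        by (intro exI[of _ "{y \<in> points W. G y \<in> V'}"] conjI bexI[OF _ ab(1)] bexI[OF _ ab(3)]) auto
    qed
  qed
  then show ?thesis unfolding variety_iso_def using bij homeo by blast
qed

text \<open>A character of a coordinate ring is determined by its values on the matrix entries, and
  these form a matrix satisfying the equations \<open>S\<close>. Hence characters are points of
  \<open>Q\<close>, with no appeal to the Nullstellensatz.\<close>

lemma Spec_iso:
  fixes R :: "'a function_space" and S :: "(complex^'n^'n \<Rightarrow> complex) set"
  assumes Q: "Q = {X. \<forall>f\<in>S. f X = 0}" and S: "S \<subseteq> matrix_polys"
    and \<psi>: "\<psi> ` points R \<subseteq> Q"
    and bij: "bij_betw (pullback R \<psi>) (coord (affine_variety mat_coords Q)) (coord R)"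
  shows "\<exists>F. variety_iso (Spec R) (affine_variety mat_coords Q) F \<and>
     (\<forall>z\<in>points R. F (\<lambda>f\<in>coord R. f z) = \<psi> z)"
proof -
  let ?K = "affine_variety mat_coords Q"
  define e where "e f = pullback R \<psi> (restrict f Q)" for f
  have coordK: "coord ?K = (\<lambda>f. restrict f Q) ` matrix_polys" and pointsK: "points ?K = Q"
    by (simp_all add: affine_variety_def)
  have eR: "e f \<in> coord R" if "f \<in> matrix_polys" for f
    using bij that unfolding e_def bij_betw_def coordK by blast
  have eR': "\<exists>f\<in>matrix_polys. g = e f" if "g \<in> coord R" for g
    using bij that unfolding e_def bij_betw_def coordK by blast
  have e: "e f = (\<lambda>z\<in>points R. f (\<psi> z))" for f
    unfolding e_def pullback_def using \<psi> by (intro restrict_ext) auto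
  have e_eq: "e f = e f' \<longleftrightarrow> (\<forall>X\<in>Q. f X = f' X)" if "f \<in> matrix_polys" "f' \<in> matrix_polys" for f f'
  proof -
    have "e f = e f' \<longleftrightarrow> restrict f Q = restrict f' Q"
      using bij that unfolding e_def bij_betw_def coordK by (auto dest: inj_onD)
    then show ?thesis by (auto simp: restrict_def fun_eq_iff)
  qed
  have e_const: "e (\<lambda>_. c) = (\<lambda>x\<in>points R. c)" for c by (simp add: e)
  have e_add: "e (\<lambda>X. f X + f' X) = (\<lambda>x\<in>points R. e f x + e f' x)" for f f'
    unfolding e by (intro restrict_ext) auto
  have e_mult: "e (\<lambda>X. f X * f' X) = (\<lambda>x\<in>points R. e f x * e f' x)" for f f'
    unfolding e by (intro restrict_ext) auto
  define F where "F \<phi> = (\<chi> i j. \<phi> (e (\<lambda>X. X $ i $ j)))" for \<phi> :: "('a \<Rightarrow> complex) \<Rightarrow> complex"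
  have eval: "\<phi> (e f) = f (F \<phi>)" if \<phi>: "\<phi> \<in> algebra_chars R" and f: "f \<in> matrix_polys" for \<phi> f
    using f
  proof induction
    case (const c)
    have "\<phi> (\<lambda>x\<in>points R. c) = c" using \<phi> unfolding algebra_chars_def by blast
    then show ?case by (simp only: e_const)
  next
    case (base f)
    then show ?case by (auto simp: mat_coords_def F_def)
  next
    case (add f g)
    have "\<phi> (e (\<lambda>X. f X + g X)) = \<phi> (e f) + \<phi> (e g)"
      unfolding e_add using \<phi> eR[OF add.hyps(1)] eR[OF add.hyps(2)] unfolding algebra_chars_def by blast
    then show ?case using add by simp
  next
    case (mult f g)
    have "\<phi> (e (\<lambda>X. f X * g X)) = \<phi> (e f) * \<phi> (e g)"
      unfolding e_mult using \<phi> eR[OF mult.hyps(1)] eR[OF mult.hyps(2)] unfolding algebra_chars_def by blast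
    then show ?case using mult by simp
  qed
  have FQ: "F \<phi> \<in> Q" if \<phi>: "\<phi> \<in> algebra_chars R" for \<phi>
    unfolding Q
  proof (intro CollectI ballI)
    fix f assume f: "f \<in> S"
    then have fp: "f \<in> matrix_polys" using S by blast
    have "e f = e (\<lambda>_. 0)" using f Q by (subst e_eq) (auto intro: fp generated_algebra.const)
    then show "f (F \<phi>) = 0"
      using eval[OF \<phi> fp] eval[OF \<phi> generated_algebra.const[of 0]] by simp
  qed
  \<comment> \<open>Evaluation at \<open>X\<close> through a chosen polynomial preimage; by
    \<open>e_eq\<close> all preimages have the same value on \<open>Q\<close>.\<close>
  define char_at where "char_at X = (\<lambda>g\<in>coord R. (SOME f. f \<in> matrix_polys \<and> g = e f) X)" for X
  have char_at: "char_at X (e f) = f X" if "X \<in> Q" "f \<in> matrix_polys" for X f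
  proof -
    let ?f = "SOME f'. f' \<in> matrix_polys \<and> e f = e f'"
    have "?f \<in> matrix_polys \<and> e f = e ?f" by (rule someI[of _ f]) (use that in simp)
    then have "?f X = f X" using e_eq[OF that(2), of ?f] that(1) by simp
    then show ?thesis using eR[OF that(2)] by (simp add: char_at_def)
  qed
  have char_char: "char_at X \<in> algebra_chars R" if X: "X \<in> Q" for X
    unfolding algebra_chars_def
  proof (intro CollectI conjI allI ballI)
    show "char_at X \<in> extensional (coord R)" by (simp add: char_at_def)
    show "char_at X (\<lambda>x\<in>points R. c) = c" for c
      using char_at[OF X generated_algebra.const[of c]] by (simp add: e_const)
    fix f g assume "f \<in> coord R" "g \<in> coord R"
    then obtain f' g' where fg: "f' \<in> matrix_polys" "f = e f'" "g' \<in> matrix_polys" "g = e g'"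
      using eR' by metis
    show "char_at X (\<lambda>x\<in>points R. f x + g x) = char_at X f + char_at X g"
      unfolding fg(2,4) e_add[symmetric]
      by (simp add: char_at[OF X] fg(1,3) generated_algebra.add)
    show "char_at X (\<lambda>x\<in>points R. f x * g x) = char_at X f * char_at X g"
      unfolding fg(2,4) e_mult[symmetric]
      by (simp add: char_at[OF X] fg(1,3) generated_algebra.mult)
  qed
  have F_char: "F (char_at X) = X" if "X \<in> Q" for X
    using char_at[OF that entry_poly] by (simp add: F_def vec_eq_iff)
  have char_F: "char_at (F \<phi>) = \<phi>" if \<phi>: "\<phi> \<in> algebra_chars R" for \<phi>
  proof (rule extensionalityI[of _ "coord R"])
    fix g assume "g \<in> coord R"
    then obtain f where "f \<in> matrix_polys" "g = e f" using eR' by blast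
    then show "char_at (F \<phi>) g = \<phi> g" using char_at[OF FQ[OF \<phi>]] eval[OF \<phi>] by simp
  qed (use \<phi> in \<open>auto simp: char_at_def algebra_chars_def\<close>)
  have "variety_iso (Spec R) ?K F"
  proof (rule variety_iso_of_coord_iso)
    show "bij_betw F (points (Spec R)) (points ?K)"
      unfolding pointsK using FQ char_char F_char char_F
      by (intro bij_betwI[where g = char_at]) (auto simp: Spec_def)
    have "coord R = e ` matrix_polys" using eR eR' by blast
    moreover have "(\<lambda>\<phi>\<in>algebra_chars R. \<phi> (e f)) = (\<lambda>\<phi>\<in>algebra_chars R. restrict f Q (F \<phi>))"
      if "f \<in> matrix_polys" for f
      using eval FQ that by (intro restrict_ext) auto
    ultimately show "coord (Spec R) = (\<lambda>h. \<lambda>\<phi>\<in>points (Spec R). h (F \<phi>)) ` coord ?K"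
      unfolding coordK Spec_def by (simp add: image_image)
    show "(\<lambda>x\<in>points ?K. 1) \<in> coord ?K"
      unfolding coordK pointsK using generated_algebra.const[of 1 mat_coords] by blast
  qed
  moreover have "F (\<lambda>f\<in>coord R. f z) = \<psi> z" if "z \<in> points R" for z
    using that eR[OF entry_poly] by (simp add: F_def vec_eq_iff e)
  ultimately show ?thesis by blast
qed


section \<open>The reduction of the implosion\<close>

lemma trace_conj:
  fixes g X :: "complex^'n^'n"
  assumes "det g \<noteq> 0" shows "trace (g ** X ** matrix_inv g) = trace X"
  using assms trace_mul_sym[of "g ** X" "matrix_inv g"] by (simp add: matrix_mul_assoc matrix_inv_det)

lemma generated_algebra_agree:
  assumes "f \<in> generated_algebra C" "\<And>g. g \<in> C \<Longrightarrow> g x = g y" shows "f x = f y"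
  using assms by (induction) auto

context ranking
begin

text \<open>Conjugation by a diagonal one-parameter subgroup contracts the slice to its diagonal matrix.\<close>

lemma invariant_on_slice:
  assumes f: "f \<in> matrix_polys" and inv: "\<And>g. det g = 1 \<Longrightarrow> f (g ** Y ** matrix_inv g) = f Y"
    and Y: "Y \<in> slice l"
  shows "f Y = f (diagonal l)"
proof -
  \<comment> \<open>Below the diagonal the truncated exponent is 0, which is harmless because
    \<open>Y\<close> vanishes there.\<close>
  define M where "M s = (\<chi> i j. s ^ (r j - r i) * Y $ i $ j)" for s :: complex
  have "(\<lambda>s. s) \<in> generated_algebra {\<lambda>s :: complex. s}" by (rule generated_algebra.base) simp
  then have "(\<lambda>s. f (M s)) \<in> generated_algebra {\<lambda>s. s}"
    unfolding M_def by (intro matrix_poly_compose'[OF f]) (simp, intro generated_algebra_intros)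
  then obtain p where p: "(\<lambda>s. f (M s)) = poly p" by (rule generated_algebra_univariate)
  have "f (M s) = f Y" if "s \<noteq> 0" for s
  proof -
    define d :: "complex^'n^'n" where "d = diagonal (\<lambda>i. inverse s ^ r i)"
    have det_d: "det d \<noteq> 0" using that by (simp add: d_def det_diagonal_prod)
    have "inverse s ^ r i * Y $ i $ j = s ^ (r j - r i) * Y $ i $ j * inverse s ^ r j" for i j
    proof (cases "r j < r i")
      case True
      then show ?thesis using Y by (simp add: slice_def upper_def)
    next
      case False
      then have "s ^ r j = s ^ (r j - r i) * s ^ r i" by (simp flip: power_add)
      then show ?thesis using that by (simp add: field_simps)
    qed
    then have "d ** Y = M s ** d" by (simp add: vec_eq_iff d_def diagonal_mult M_def)
    then have "d ** Y ** matrix_inv d = M s ** (d ** matrix_inv d)" by (simp add: matrix_mul_assoc)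
    then have "M s = d ** Y ** matrix_inv d" using det_d by (simp add: matrix_inv_det)
    moreover obtain h where "det h = 1" "\<And>X. h ** X ** matrix_inv h = d ** X ** matrix_inv d"
      using scale_det[OF det_d] by metis
    ultimately show ?thesis using inv by metis
  qed
  \<comment> \<open>Equality is known only for nonzero \<open>s\<close>. The factor
    \<open>[:0, 1:]\<close> absorbs the value at 0, the one that is wanted, and is then
    cancelled.\<close>
  then have "poly ([:0, 1:] * (p - [:f Y:])) s = 0" for s using fun_cong[OF p, of s] by (cases "s = 0") auto
  then have "[:0, 1:] * (p - [:f Y:]) = 0" using poly_all_0_iff_0 by blast
  then have "p = [:f Y:]" by simp
  then have "f (M 0) = f Y" using fun_cong[OF p, of 0] by simp
  moreover have "M 0 = diagonal l"
  proof -
    have "0 ^ (r j - r i) * Y $ i $ j = (if i = j then l i else 0)" for i j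
      using Y by (cases rule: rank_cases[of i j]) (auto simp: slice_def upper_def)
    then show ?thesis by (simp add: M_def diagonal_def vec_eq_iff)
  qed
  ultimately show ?thesis by simp
qed

section \<open>The given Borel subgroup and level, moved to triangular form\<close>

context
  fixes g\<^sub>0 X0 :: "complex^'n^'n" and l :: "'n \<Rightarrow> complex"
    and p :: "nat \<Rightarrow> complex^'n^'n \<Rightarrow> complex" and c :: "nat \<Rightarrow> complex"
  assumes g0: "det g\<^sub>0 = 1" and X0: "X0 \<in> lie_algebra (borel g\<^sub>0)" and X0_sl: "X0 \<in> sl"
    and l_def: "l = (\<lambda>i. (matrix_inv g\<^sub>0 ** X0 ** g\<^sub>0) $ i $ i)"
    and generators: "generate_invariants p" and c: "c = rho p X0"
begin

abbreviation "conj0 Y \<equiv> g\<^sub>0 ** Y ** matrix_inv g\<^sub>0"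

lemma points_level: "points (level_variety (borel g\<^sub>0) X0) = carrier SL \<times> conj0 ` slice l"
  using points_level_variety[OF g0 X0] l_def by simp

lemma X0_slice: "matrix_inv g\<^sub>0 ** X0 ** g\<^sub>0 \<in> slice l"
  using lie_algebra_borel_upper[OF X0] by (simp add: slice_def l_def)

lemma trace_slice: "Y \<in> slice l \<Longrightarrow> trace Y = 0"
proof -
  assume "Y \<in> slice l"
  then have "trace Y = (\<Sum>i\<in>UNIV. l i)" by (simp add: trace_def slice_def)
  also have "\<dots> = trace (matrix_inv g\<^sub>0 ** X0 ** g\<^sub>0)" by (simp add: trace_def l_def)
  also have "\<dots> = trace X0"
    using trace_conj[of "matrix_inv g\<^sub>0" X0] g0 by (simp add: det_matrix_inv matrix_inv_matrix_inv)
  finally show ?thesis using X0_sl by (simp add: sl_def)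
qed

lemma conj_mult_assoc:
  assumes "det h = 1"
  shows "h ** conj0 Y ** matrix_inv h = (h ** g\<^sub>0) ** Y ** matrix_inv (h ** g\<^sub>0)"
  using assms g0 by (simp add: matrix_inv_mult matrix_mul_assoc)

text \<open>By contraction an invariant takes the same value on the whole slice as at its diagonal
  matrix. A conjugate of \<open>X0\<close> lies in the slice, so this value is
  \<open>c k\<close>.\<close>

lemma invariant_value:
  assumes k: "k \<in> {1..CARD('n) - 1}" and "det h = 1" "Y \<in> slice l"
  shows "p k (h ** Y ** matrix_inv h) = c k"
proof -
  have "p k \<in> coord invariant_polynomials"
    using generators k unfolding generate_invariants_def by blast
  then obtain f where f: "f \<in> matrix_polys" "p k = restrict f sl"
    and inv: "\<And>g X. det g = 1 \<Longrightarrow> X \<in> sl \<Longrightarrow> p k (g ** X ** matrix_inv g) = p k X"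
    by (auto simp: invariant_polynomials_def invariant_functions_def affine_variety_def carrier_SL conj_mat_def)
  have sl: "g ** Z ** matrix_inv g \<in> sl" if "det g = 1" "Z \<in> slice l" for g Z
    using trace_conj[of g Z] trace_slice[OF that(2)] that(1) by (simp add: sl_def)
  have pk: "p k (g ** Z ** matrix_inv g) = f (diagonal l)" if "det g = 1" "Z \<in> slice l" for g Z
  proof -
    have Z: "Z \<in> sl" using trace_slice[OF that(2)] by (simp add: sl_def)
    have "f Z = f (diagonal l)"
    proof (rule invariant_on_slice[OF f(1) _ that(2)])
      fix g :: "complex^'n^'n" assume "det g = 1"
      then show "f (g ** Z ** matrix_inv g) = f Z"
        using inv[of g Z] Z sl[OF _ that(2)] by (simp add: f(2))
    qed
    then show ?thesis using inv[OF that(1) Z] Z by (simp add: f(2))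
  qed
  have "p k X0 = f (diagonal l)"
    using pk[OF g0 X0_slice] by (simp add: conj_cancel(2)[OF g0])
  then show ?thesis using pk[OF assms(2,3)] k by (simp add: c rho_def)
qed

lemma orbit_in_kostant:
  assumes "det h = 1" "Y \<in> slice l"
  shows "h ** Y ** matrix_inv h \<in> points (kostant_variety p c)"
proof -
  have "h ** Y ** matrix_inv h \<in> sl"
    using trace_conj[of h Y] trace_slice[OF assms(2)] assms(1) by (simp add: sl_def)
  moreover have "rho p (h ** Y ** matrix_inv h) = rho p X0"
    unfolding rho_def using invariant_value[OF _ assms] c
    by (intro restrict_ext) (auto simp: rho_def)
  ultimately show ?thesis by (simp add: kostant_variety_def affine_variety_def c)
qed

text \<open>The coefficients of the characteristic series are invariant, hence polynomials in the
  generators \<open>p\<close>. Equal values of \<open>p\<close> thus give equal characteristic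
  series, and that of \<open>X0\<close> is \<open>spread l\<close>.\<close>

lemma kostant_char_fps:
  assumes X: "X \<in> points (kostant_variety p c)" shows "char_fps X = spread l"
proof (rule fps_ext)
  fix k
  have Xsl: "X \<in> sl" and rho: "rho p X = rho p X0"
    using X by (simp_all add: kostant_variety_def affine_variety_def c)
  let ?e = "\<lambda>X :: complex^'n^'n. fps_nth (char_fps X) k"
  have "restrict ?e sl \<in> coord invariant_polynomials"
  proof -
    have "?e (conj_mat g X) = ?e X" "conj_mat g X \<in> sl" if "g \<in> carrier SL" "X \<in> sl" for g X
      using that by (simp_all add: conj_mat_def char_fps_conj carrier_SL sl_def trace_conj)
    then show ?thesis using char_fps_poly[of k]
      by (auto simp: invariant_polynomials_def invariant_functions_def affine_variety_def)
  qed
  then obtain F where F: "F \<in> generated_algebra (p ` {1..CARD('n) - 1})" "restrict ?e sl = restrict F sl"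
    using generators unfolding generate_invariants_def by auto
  have eF: "?e Z = F Z" if "Z \<in> sl" for Z using fun_cong[OF F(2), of Z] that by simp
  have "F X = F X0"
  proof (rule generated_algebra_agree[OF F(1)])
    fix q assume "q \<in> p ` {1..CARD('n) - 1}"
    then obtain j where "j \<in> {1..CARD('n) - 1}" "q = p j" by blast
    then show "q X = q X0" using fun_cong[OF rho, of j] by (simp add: rho_def)
  qed
  then have "?e X = ?e X0" using eF Xsl X0_sl by simp
  also have "char_fps X0 = spread l"
    using char_fps_conj_slice[OF X0_slice, of g\<^sub>0] g0 by (simp add: conj_cancel(2)[OF g0])
  finally show "?e X = fps_nth (spread l) k" .
qed

lemma conj_map_level:
  assumes "z \<in> points (level_variety (borel g\<^sub>0) X0)"
  shows "conj_map z \<in> points (kostant_variety p c)"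
proof -
  obtain h Y where z: "z = (h, conj0 Y)" "det h = 1" "Y \<in> slice l"
    using assms unfolding points_level by (auto simp: carrier_SL)
  then show ?thesis using orbit_in_kostant[of "h ** g\<^sub>0" Y] g0
    by (simp add: conj_map_def conj_mat_def conj_mult_assoc det_mul)
qed

lemma slice_conj:
  assumes "upper b" "det b = 1" "Y \<in> slice l" shows "b ** Y ** matrix_inv b \<in> slice l"
proof -
  have ib: "upper (matrix_inv b)" using assms by (intro upper_inverse) auto
  have Y: "upper Y" "\<And>i. Y $ i $ i = l i" using assms(3) by (auto simp: slice_def)
  have "b $ i $ i * matrix_inv b $ i $ i = 1" for i
  proof -
    have "(b ** matrix_inv b) $ i $ i = 1" using assms(2) by (simp add: matrix_inv_det mat_def)
    then show ?thesis by (simp add: upper_mult_diag[OF assms(1) ib])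
  qed
  then have "(b ** Y ** matrix_inv b) $ i $ i = l i" for i
    by (simp add: upper_mult_diag upper_mult assms(1) ib Y mult.assoc mult.left_commute[of "b $ i $ i"])
  then show ?thesis using upper_mult[OF upper_mult[OF assms(1) Y(1)] ib] by (simp add: slice_def)
qed

lemma borel_act_level:
  assumes b: "b \<in> borel g\<^sub>0" and z: "z \<in> points (level_variety (borel g\<^sub>0) X0)"
  shows "borel_act b z \<in> points (level_variety (borel g\<^sub>0) X0)" "conj_map (borel_act b z) = conj_map z"
proof -
  obtain h Y where hY: "z = (h, conj0 Y)" "det h = 1" "Y \<in> slice l"
    using z unfolding points_level by (auto simp: carrier_SL)
  define \<beta> where "\<beta> = matrix_inv g\<^sub>0 ** b ** g\<^sub>0"
  have \<beta>: "upper \<beta>" "det \<beta> = 1" "det b = 1" using b g0 by (auto simp: borel_iff \<beta>_def det_conj)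
  have b_eq: "b = conj0 \<beta>" by (simp add: \<beta>_def conj_cancel(2)[OF g0])
  have "b ** conj0 Y ** matrix_inv b = conj0 (\<beta> ** Y ** matrix_inv \<beta>)"
  proof -
    have "conj0 (\<beta> ** Y ** matrix_inv \<beta>) =
        g\<^sub>0 ** (\<beta> ** (matrix_inv g\<^sub>0 ** conj0 Y ** g\<^sub>0) ** matrix_inv \<beta>) ** matrix_inv g\<^sub>0"
      by (simp add: conj_cancel(1)[OF g0])
    also have "\<dots> = (g\<^sub>0 ** \<beta> ** matrix_inv g\<^sub>0) ** conj0 Y ** (g\<^sub>0 ** matrix_inv \<beta> ** matrix_inv g\<^sub>0)"
      by (simp only: matrix_mul_assoc)
    also have "g\<^sub>0 ** matrix_inv \<beta> ** matrix_inv g\<^sub>0 = matrix_inv b"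
      unfolding b_eq using g0 \<beta>(2)
      by (simp add: matrix_inv_mult det_mul det_matrix_inv matrix_inv_matrix_inv matrix_mul_assoc)
    finally show ?thesis by (simp only: b_eq[symmetric])
  qed
  then have act: "borel_act b z = (h ** matrix_inv b, conj0 (\<beta> ** Y ** matrix_inv \<beta>))"
    by (simp add: borel_act_def hY(1) conj_mat_def)
  show "borel_act b z \<in> points (level_variety (borel g\<^sub>0) X0)"
    unfolding act points_level using hY slice_conj[OF \<beta>(1,2)] \<beta>(3)
    by (auto simp: carrier_SL det_mul det_matrix_inv)
  let ?Z = "conj0 Y"
  have "conj_map (borel_act b z) =
      h ** matrix_inv b ** (b ** ?Z ** matrix_inv b) ** matrix_inv (h ** matrix_inv b)"
    by (simp add: borel_act_def conj_map_def hY(1) conj_mat_def)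
  also have "\<dots> = h ** (matrix_inv b ** b) ** ?Z ** (matrix_inv b ** b) ** matrix_inv h"
    using hY(2) \<beta>(3) by (simp add: matrix_inv_mult det_matrix_inv matrix_inv_matrix_inv matrix_mul_assoc)
  also have "\<dots> = conj_map z" using \<beta>(3) by (simp add: matrix_inv_det conj_map_def conj_mat_def hY(1))
  finally show "conj_map (borel_act b z) = conj_map z" .
qed

abbreviation "level_space \<equiv> level_variety (borel g\<^sub>0) X0"

lemma coord_level: "coord level_space = (\<lambda>f. restrict f (points level_space)) ` generated_algebra pair_coords"
  and coord_kostant: "coord (kostant_variety p c) =
    (\<lambda>f. restrict f (points (kostant_variety p c))) ` matrix_polys"
  by (simp_all add: level_variety_def kostant_variety_def affine_variety_def)

lemma pullback_restrict:
  "pullback level_space conj_map (restrict f (points (kostant_variety p c))) =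
     (\<lambda>z\<in>points level_space. f (conj_map z))"
  unfolding pullback_def using conj_map_level by (intro restrict_ext) auto

text \<open>The change of variables that replaces the given Borel subgroup by the triangular one; it
  leaves the conjugate \<open>g ** Y ** matrix_inv g\<close> unchanged.\<close>

lemma translate_poly:
  assumes "f \<in> generated_algebra pair_coords"
  shows "(\<lambda>z. f (fst z ** matrix_inv g\<^sub>0, conj0 (snd z))) \<in> generated_algebra pair_coords"
proof -
  have "\<exists>f'\<in>generated_algebra pair_coords. \<forall>z\<in>UNIV. f' z = f (fst z ** matrix_inv g\<^sub>0, conj0 (snd z))"
  proof (rule generated_algebra_compose[OF assms])
    fix q :: "(complex^'n^'n) \<times> (complex^'n^'n) \<Rightarrow> complex" assume "q \<in> pair_coords"
    then obtain i j where q: "q = (\<lambda>X. X $ i $ j) \<circ> fst \<or> q = (\<lambda>X. X $ i $ j) \<circ> snd"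
      by (auto simp: pair_coords_def mat_coords_def)
    have 1: "(\<lambda>z. (fst z ** matrix_inv g\<^sub>0) $ i $ j) \<in> generated_algebra pair_coords"
      and 2: "(\<lambda>z. (conj0 (snd z)) $ i $ j) \<in> generated_algebra pair_coords"
      by (intro generated_algebra_matrix_mult generated_algebra.const pair_coords_poly)+
    from q show "\<exists>f'\<in>generated_algebra pair_coords.
        \<forall>z\<in>UNIV. f' z = q (fst z ** matrix_inv g\<^sub>0, conj0 (snd z))"
      by (elim disjE) (rule bexI[OF _ 1], simp, rule bexI[OF _ 2], simp)
  qed
  then obtain f' where "f' \<in> generated_algebra pair_coords"
    and "\<forall>z. f' z = f (fst z ** matrix_inv g\<^sub>0, conj0 (snd z))" by auto
  moreover from this(2) have "f' = (\<lambda>z. f (fst z ** matrix_inv g\<^sub>0, conj0 (snd z)))" by auto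
  ultimately show ?thesis by simp
qed

text \<open>Injectivity: a difference that vanishes on the orbit of the bidiagonal matrix lies in
  the ideal and so vanishes on the whole fibre. Surjectivity is \<open>invariant_polynomial\<close>
  in translated coordinates.\<close>

lemma pullback_bij:
  "bij_betw (pullback level_space conj_map) (coord (kostant_variety p c))
     (coord (invariant_functions (borel g\<^sub>0) borel_act level_space))"
  unfolding bij_betw_def
proof (intro conjI inj_onI equalityI subsetI)
  let ?Q = "points (kostant_variety p c)"
  fix f f' assume "f \<in> coord (kostant_variety p c)" "f' \<in> coord (kostant_variety p c)"
    and eq: "pullback level_space conj_map f = pullback level_space conj_map f'"
  then obtain h h' where h: "h \<in> matrix_polys" "f = restrict h ?Q" "h' \<in> matrix_polys" "f' = restrict h' ?Q"
    unfolding coord_kostant by blast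
  have eq': "h (conj_map z) = h' (conj_map z)" if "z \<in> points level_space" for z
    using fun_cong[OF eq, of z] that unfolding h(2,4) pullback_restrict by simp
  have "(\<lambda>X. h X - h' X) \<in> kostant_ideal l"
  proof (rule vanish_on_orbit)
    show "(\<lambda>X. h X - h' X) \<in> matrix_polys" by (intro generated_algebra_intros h)
    fix g :: "complex^'n^'n" assume g: "det g = 1"
    let ?z = "(g ** matrix_inv g\<^sub>0, conj0 (bidiagonal l))"
    have "?z \<in> points level_space"
      unfolding points_level using g g0 bidiagonal_slice by (auto simp: carrier_SL det_mul det_matrix_inv)
    moreover have "conj_map ?z = g ** bidiagonal l ** matrix_inv g"
    proof -
      have "conj_map ?z = (g ** matrix_inv g\<^sub>0) ** conj0 (bidiagonal l) ** matrix_inv (g ** matrix_inv g\<^sub>0)"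
        by (simp add: conj_map_def conj_mat_def)
      also have "\<dots> = (g ** matrix_inv g\<^sub>0 ** g\<^sub>0) ** bidiagonal l ** matrix_inv (g ** matrix_inv g\<^sub>0 ** g\<^sub>0)"
        by (rule conj_mult_assoc) (use g g0 in \<open>simp add: det_mul det_matrix_inv\<close>)
      also have "g ** matrix_inv g\<^sub>0 ** g\<^sub>0 = g" using g0 by (simp add: matrix_inv_det flip: matrix_mul_assoc)
      finally show ?thesis .
    qed
    ultimately show "h (g ** bidiagonal l ** matrix_inv g) - h' (g ** bidiagonal l ** matrix_inv g) = 0"
      using eq'[of ?z] by simp
  qed
  then have "h X - h' X = 0" if "X \<in> ?Q" for X
    using kostant_ideal_vanish[OF _ kostant_char_fps[OF that]] by blast
  then show "f = f'" unfolding h(2,4) by (intro restrict_ext) simp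
next
  fix f assume "f \<in> pullback level_space conj_map ` coord (kostant_variety p c)"
  then obtain h where h: "h \<in> matrix_polys" "f = (\<lambda>z\<in>points level_space. h (conj_map z))"
    unfolding coord_kostant image_image pullback_restrict by blast
  obtain h' where h': "h' \<in> generated_algebra pair_coords"
    "\<And>g Y. det g = 1 \<Longrightarrow> h' (g, Y) = h (g ** Y ** matrix_inv g)" using conj_pair_poly[OF h(1)] by metis
  have "f = restrict h' (points level_space)"
    unfolding h(2) points_level
    by (intro restrict_ext) (auto simp: h'(2) conj_map_def conj_mat_def carrier_SL)
  then have "f \<in> coord level_space" unfolding coord_level using h'(1) by blast
  moreover have "f (borel_act b z) = f z" if "b \<in> borel g\<^sub>0" "z \<in> points level_space" for b z
    unfolding h(2) using borel_act_level[OF that] that by simp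
  ultimately show "f \<in> coord (invariant_functions (borel g\<^sub>0) borel_act level_space)"
    by (simp add: invariant_functions_def)
next
  fix f assume "f \<in> coord (invariant_functions (borel g\<^sub>0) borel_act level_space)"
  then have "f \<in> coord level_space"
    and inv: "\<And>b z. b \<in> borel g\<^sub>0 \<Longrightarrow> z \<in> points level_space \<Longrightarrow> f (borel_act b z) = f z"
    by (auto simp: invariant_functions_def)
  then obtain f\<^sub>0 where f0: "f\<^sub>0 \<in> generated_algebra pair_coords" "f = restrict f\<^sub>0 (points level_space)"
    unfolding coord_level by blast
  let ?f = "\<lambda>z. f\<^sub>0 (fst z ** matrix_inv g\<^sub>0, conj0 (snd z))"
  have "\<exists>h\<in>matrix_polys. \<forall>g Y. det g = 1 \<longrightarrow> Y \<in> slice l \<longrightarrow> ?f (g, Y) = h (g ** Y ** matrix_inv g)"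
  proof (rule invariant_polynomial[OF translate_poly[OF f0(1)]])
    fix b g Y :: "complex^'n^'n" assume b: "det b = 1" "upper b" and g: "det g = 1" and Y: "Y \<in> slice l"
    let ?z = "(g ** matrix_inv g\<^sub>0, conj0 Y)"
    have z: "?z \<in> points level_space"
      unfolding points_level using g g0 Y by (auto simp: carrier_SL det_mul det_matrix_inv)
    have c: "conj0 b \<in> borel g\<^sub>0"
      using b g0 by (simp add: borel_iff conj_cancel(1)[OF g0] det_mul det_matrix_inv)
    have ic: "matrix_inv (conj0 b) = conj0 (matrix_inv b)"
      using g0 b by (simp add: matrix_inv_mult det_mul det_matrix_inv matrix_inv_matrix_inv matrix_mul_assoc)
    have hom: "conj0 x ** conj0 y = conj0 (x ** y)" for x y
    proof -
      have "conj0 x ** conj0 y = g\<^sub>0 ** x ** (matrix_inv g\<^sub>0 ** g\<^sub>0) ** y ** matrix_inv g\<^sub>0"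
        by (simp only: matrix_mul_assoc)
      then show ?thesis using g0 by (simp add: matrix_inv_det matrix_mul_assoc)
    qed
    have "g ** matrix_inv g\<^sub>0 ** conj0 (matrix_inv b) =
        g ** (matrix_inv g\<^sub>0 ** g\<^sub>0) ** matrix_inv b ** matrix_inv g\<^sub>0" by (simp only: matrix_mul_assoc)
    then have "g ** matrix_inv g\<^sub>0 ** conj0 (matrix_inv b) = g ** matrix_inv b ** matrix_inv g\<^sub>0"
      using g0 by (simp add: matrix_inv_det)
    then have act: "borel_act (conj0 b) ?z = (g ** matrix_inv b ** matrix_inv g\<^sub>0, conj0 (b ** Y ** matrix_inv b))"
      by (simp only: borel_act_def conj_mat_def prod.case ic hom)
    show "?f (g ** matrix_inv b, b ** Y ** matrix_inv b) = ?f (g, Y)"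
      using inv[OF c z] borel_act_level(1)[OF c z] z unfolding act f0(2) by simp
  qed
  then obtain h where h: "h \<in> matrix_polys"
    "\<And>g Y. det g = 1 \<Longrightarrow> Y \<in> slice l \<Longrightarrow> ?f (g, Y) = h (g ** Y ** matrix_inv g)" by blast
  have "f = (\<lambda>z\<in>points level_space. h (conj_map z))"
    unfolding f0(2)
  proof (rule restrict_ext)
    fix z assume "z \<in> points level_space"
    then obtain a Y where z: "z = (a, conj0 Y)" "det a = 1" "Y \<in> slice l"
      unfolding points_level by (auto simp: carrier_SL)
    have "a ** g\<^sub>0 ** matrix_inv g\<^sub>0 = a" using g0 by (simp add: matrix_inv_det flip: matrix_mul_assoc)
    then have "f\<^sub>0 z = ?f (a ** g\<^sub>0, Y)" by (simp add: z(1))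
    also have "\<dots> = h ((a ** g\<^sub>0) ** Y ** matrix_inv (a ** g\<^sub>0))"
      using z g0 by (intro h(2)) (simp_all add: det_mul)
    also have "\<dots> = h (conj_map z)"
      using z(2) by (simp add: z(1) conj_map_def conj_mat_def conj_mult_assoc)
    finally show "f\<^sub>0 z = h (conj_map z)" .
  qed
  then have "f = pullback level_space conj_map (restrict h (points (kostant_variety p c)))"
    by (simp only: pullback_restrict)
  then show "f \<in> pullback level_space conj_map ` coord (kostant_variety p c)"
    unfolding coord_kostant using h(1) by blast
qed

lemma reduction_iso:
  "\<exists>F. variety_iso (torus_reduction (borel g\<^sub>0) X0) (kostant_variety p c) F \<and>
     (\<forall>z\<in>points level_space. F (GIT_map (borel g\<^sub>0) borel_act level_space z) = conj_map z)"
proof -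
  let ?R = "invariant_functions (borel g\<^sub>0) borel_act level_space"
  let ?I = "{1..CARD('n) - 1}"
  have "\<exists>f. \<forall>k\<in>?I. f k \<in> matrix_polys \<and> p k = restrict (f k) sl"
  proof (rule bchoice, rule ballI)
    fix k assume "k \<in> ?I"
    then have "p k \<in> coord invariant_polynomials"
      using generators unfolding generate_invariants_def by blast
    then show "\<exists>f. f \<in> matrix_polys \<and> p k = restrict f sl"
      by (auto simp: invariant_polynomials_def invariant_functions_def affine_variety_def)
  qed
  then obtain f where f: "\<And>k. k \<in> ?I \<Longrightarrow> f k \<in> matrix_polys" "\<And>k. k \<in> ?I \<Longrightarrow> p k = restrict (f k) sl" by blast
  \<comment> \<open>\<open>Spec_iso\<close> needs equations on the space of all matrices, but
    \<open>p k\<close> is meaningful only on \<open>sl\<close>; hence the polynomial extensions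
    \<open>f k\<close>, together with the trace.\<close>
  let ?S = "insert trace ((\<lambda>k X. f k X - c k) ` ?I)"
  let ?Q = "{X \<in> sl. rho p X = c}"
  have Q: "?Q = {X. \<forall>h\<in>?S. h X = 0}"
  proof -
    have "rho p X = c \<longleftrightarrow> (\<forall>k\<in>?I. f k X = c k)" if "X \<in> sl" for X
    proof -
      have "rho p X = c \<longleftrightarrow> (\<forall>k\<in>?I. p k X = c k)"
        unfolding c by (auto simp: rho_def restrict_def fun_eq_iff)
      then show ?thesis using f(2) that by simp
    qed
    then show ?thesis by (auto simp: sl_def)
  qed
  have "trace \<in> matrix_polys"
    unfolding trace_def[abs_def] by (intro generated_algebra_intros entry_poly)
  then have S: "?S \<subseteq> matrix_polys" using f(1) by (auto intro!: generated_algebra_intros)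
  have points: "points ?R = points level_space" by (simp add: invariant_functions_def)
  have K: "kostant_variety p c = affine_variety mat_coords ?Q" by (simp add: kostant_variety_def)
  have "conj_map ` points ?R \<subseteq> ?Q"
    using conj_map_level unfolding points by (auto simp: K affine_variety_def)
  moreover have "pullback ?R conj_map = pullback level_space conj_map"
    by (simp add: pullback_def fun_eq_iff points)
  then have "bij_betw (pullback ?R conj_map) (coord (affine_variety mat_coords ?Q)) (coord ?R)"
    using pullback_bij by (simp add: K)
  ultimately obtain F where "variety_iso (Spec ?R) (affine_variety mat_coords ?Q) F"
    "\<forall>z\<in>points ?R. F (\<lambda>f\<in>coord ?R. f z) = conj_map z"
    using Spec_iso[OF Q S] by blast
  then show ?thesis
    by (intro exI[of _ F]) (simp add: torus_reduction_def GIT_quotient_def GIT_map_def K points)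
qed

end

end

theorem mainTheorem5:
  fixes B \<tt> :: "(complex^'n^'n) set"
    and X0 :: "complex^'n^'n"
    and p :: "nat \<Rightarrow> complex^'n^'n \<Rightarrow> complex"
    and c :: "nat \<Rightarrow> complex"
  assumes borel: "borel_subgroup B"
    and cartan: "cartan_subalgebra \<tt>"
    and decomp: "lie_algebra B = {H + Y | H Y. H \<in> \<tt> \<and> Y \<in> lie_algebra (derived SL B)}"
      "\<tt> \<inter> lie_algebra (derived SL B) = {0}"
    and generators: "generate_invariants p"
    and level: "X0 \<in> \<tt>" "c = rho p X0"
  shows "conj_map ` points (level_variety B X0) \<subseteq> points (kostant_variety p c) \<and>
    (\<forall>b\<in>B. \<forall>z\<in>points (level_variety B X0).
       borel_act b z \<in> points (level_variety B X0) \<and> conj_map (borel_act b z) = conj_map z) \<and>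
    bij_betw (pullback (level_variety B X0) conj_map)
      (coord (kostant_variety p c))
      (coord (invariant_functions B borel_act (level_variety B X0))) \<and>
    (\<exists>F. variety_iso (torus_reduction B X0) (kostant_variety p c) F \<and>
       (\<forall>z\<in>points (level_variety B X0).
          F (GIT_map B borel_act (level_variety B X0) z) = conj_map z))"
proof -
  obtain r :: "'n \<Rightarrow> nat" where "bij_betw r UNIV {0..<CARD('n)}"
    using ex_bij_betw_finite_nat[of "UNIV :: 'n set"] by auto
  then interpret ranking r by unfold_locales (simp add: atLeast0LessThan)
  obtain g where g: "det g = 1" "B = ranking.filt r g 0"
    using borel_subgroup_conjugate[OF borel] by blast
  \<comment> \<open>Taking the nilpotent component to be 0 in the decomposition shows that
    \<open>X0\<close> lies in the Lie algebra of \<open>B\<close>.\<close>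
  have "0 \<in> lie_algebra (derived SL B)" using decomp(2) by blast
  then have "X0 + 0 \<in> lie_algebra B" using level(1) unfolding decomp(1) by blast
  then have X0: "X0 \<in> lie_algebra (ranking.filt r g 0)" using g(2) by simp
  have sl: "X0 \<in> sl" using cartan level(1) by (auto simp: cartan_subalgebra_def lie_subalgebra_def)
  note facts = g(1) X0 sl refl generators level(2)
  show ?thesis
    unfolding g(2)
    using conj_map_level[OF facts] borel_act_level[OF facts] pullback_bij[OF facts] reduction_iso[OF facts]
    by blast
qed

end
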